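(* Let $\Lambda=(\Lambda_i)_{i\le\kappa}$ be a representable primitive substitution Delone $\kappa$-set in $\mathbb{R}^d$ with expansion map $Q$, and let $\mu$ be the unique translation-invariant Borel probability measure on $X_\Lambda$. Let $m\ge m_0$ and $\alpha\in\{1,\dots,N_m\}$. For $z\in\Xi_{\rm legal}(\Lambda)$ there exists $\delta=\delta(z)>0$, independent of $(m,\alpha)$, such that for all $n$ sufficiently large, $n\ge n(m,\alpha)$, $$\mu\bigl(X(U_{m,\alpha})\cap \mathsf{T}_{-Q^nz}X(U_{m,\alpha})\bigr)>\delta\,\mu(X(U_{m,\alpha})).$$
   Context: A $\kappa$-set $\Lambda=(\Lambda_i)_{i\le\kappa}$ is a tuple of pairwise disjoint subsets of $\mathbb{R}^d$, identified with $\{(x,i):x\in\Lambda_i\}\subset\mathbb{R}^d\times\{1,\dots,\kappa\}$; $\mathrm{supp}(\Lambda)=\bigcup_i\Lambda_i$. It is a Delone $\kappa$-set if each $\Lambda_i$ and $\mathrm{supp}(\Lambda)$ are Delone (relatively dense and uniformly discrete). A linear map $Q$ on $\mathbb{R}^d$ is expansive if all its (real and complex) eigenvalues have modulus $>1$. $\Lambda$ is a substitution Delone $\kappa$-set with expansion map $Q$ if it is a Delone $\kappa$-set and there are an expansive $Q$ and finite sets $\mathcal{D}_{ij}\subset\mathbb{R}^d$ such that $\Lambda_i=\bigcup_{j=1}^\kappa(Q\Lambda_j+\mathcal{D}_{ij})$ for $i\le\kappa$, all unions (over $j$ and over elements of $\mathcal{D}_{ij}$) being disjoint. It is primitive if some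 positive power of the matrix $(\#\mathcal{D}_{ij})_{i,j}$ has no zero entries. Let $(A_1,\dots,A_\kappa)$ be the unique family of nonempty compact sets solving $QA_j=\bigcup_{i=1}^\kappa(\mathcal{D}_{ij}+A_i)$, $j\le\kappa$, and $T_i=(A_i,i)$. $\Lambda$ is representable if the tiles $x+T_i=(x+A_i,i)$, $x\in\Lambda_i$, $i\le\kappa$, form a tiling $\mathcal{T}_\Lambda$ of $\mathbb{R}^d$ (supports cover $\mathbb{R}^d$, distinct tiles have supports with disjoint interiors). The associated tile-substitution is $\omega(T_j+x)=\{u+T_i+Qx:u\in\mathcal{D}_{ij},i\le\kappa\}$, extended to patches (finite sets of tiles with disjoint interiors) by unions. A patch is legal if it is a translate of a subpatch of $\omega^k(T_i)$ for some $k\in\mathbb{N}$ and $i\le\kappa$. $\Xi_{\rm legal}(\Lambda)$ is the set of $x\in\mathbb{R}^d$ such that there are a legal patch $P\subset\mathcal{T}_\Lambda$ and tiles $T,T'\in P$ with $T'=T+x$. Dynamical system: let $X$ be the collection of all Delone $\kappa$-sets in $\mathbb{R}^d$. For coloured sets, intersection with subsets of $\mathbb{R}^d$ and addition of balls are applied to the $\mathbb{R}^d$-coordinate, keeping colours. Metric: $d(\Gamma,\Gamma')=\min\{2^{-1/2},\inf\{\epsilon>0:B_{1/\epsilon}(0)\cap\Gamma'\subset\Gamma+B_\epsilon(0),\ B_{1/\epsilon}(0)\cap\Gamma\subset\Gamma'+B_\epsilon(0)\}\}$. $X_\Lambda$ is the closure of $\{\Lambda-g:g\in\mathbb{R}^d\}$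 in $X$; it is compact, and $\mathbb{R}^d$ acts by $\mathsf{T}_g\Gamma=\Gamma-g$. For $\Lambda$ as in the claim this system is uniquely ergodic. Grid: choose $\eta(\Lambda)>0$ such that every ball of radius $\eta(\Lambda)/2$ (in the $\ell^\infty$ metric) contains at most one point of $\mathrm{supp}(\Lambda)$, and $m_0$ with $2^{-m_0}<\eta(\Lambda)/2$. For $m\ge m_0$ subdivide $[-2^m,2^m)^d$ into the half-open cubes $\prod_{i=1}^d[\frac{k_i}{2^m},\frac{k_i+1}{2^m})$, $k_i\in[-4^m,4^m)\cap\mathbb{Z}$. $\Delta_m$ is the finite set of all coloured cubes $C=(B,i)$, $B$ such a cube, $1\le i\le\kappa$, identified with $B\times\{i\}$. Let $\Delta_{m,\alpha}$, $\alpha=1,\dots,N_m$, enumerate the subsets of $\Delta_m$ in which distinct elements have disjoint cubes $B$. $U_{m,\alpha}$ is the family of finite sets $P\subset[-2^m,2^m)^d\times\{1,\dots,\kappa\}$ such that $P\cap C$ is exactly one coloured point for each $C\in\Delta_{m,\alpha}$ and $P\cap C'=\emptyset$ for each $C'\in\Delta_m\setminus\Delta_{m,\alpha}$. Finally $X(U_{m,\alpha})=\{\Gamma\in X_\Lambda:\Gamma\cap[-2^m,2^m)^d\in U_{m,\alpha}\}$.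
   Formalization: The inequality is proved for those (m,α) with μ(X(U_{m,α})) > 0; when this measure is 0 (e.g. the empty selection of cubes for large m, where X(U_{m,α}) is empty) the strict inequality would read 0 > 0 and is false. *)

theory Defs
  imports "HOL-Analysis.Analysis"
begin

text \<open>Colours are the elements of a finite type \<open>'k\<close> (so \<open>\<kappa> = CARD('k)\<close>) and the ambient space is
  \<open>real ^ 'd\<close> (so \<open>d = CARD('d)\<close>). A coloured set is the family of its components.\<close>

type_synonym ('d, 'k) kset = "'k \<Rightarrow> (real, 'd) vec set"

definition supp :: "('d::finite, 'k::finite) kset \<Rightarrow> (real ^ 'd) set" where
  "supp \<Lambda> = (\<Union>i. \<Lambda> i)"

definition coloured_points :: "('d::finite, 'k::finite) kset \<Rightarrow> ((real ^ 'd) \<times> 'k) set" where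
  "coloured_points \<Lambda> = {(x, i). x \<in> \<Lambda> i}"

definition relatively_dense :: "'a::metric_space set \<Rightarrow> bool" where
  "relatively_dense S \<longleftrightarrow> (\<exists>R>0. \<forall>x. \<exists>y\<in>S. dist x y \<le> R)"

definition delone :: "'a::metric_space set \<Rightarrow> bool" where
  "delone S \<longleftrightarrow> relatively_dense S \<and> uniform_discrete S"

definition delone_kset :: "('d::finite, 'k::finite) kset \<Rightarrow> bool" where
  "delone_kset \<Lambda> \<longleftrightarrow> disjoint_family \<Lambda> \<and> (\<forall>i. delone (\<Lambda> i)) \<and> delone (supp \<Lambda>)"

text \<open>Eigenvalues are those of the complexification of \<open>Q\<close>, so that the non-real ones are included.\<close>

definition complex_eigenvalue :: "(real ^ 'd \<Rightarrow> real ^ 'd::finite) \<Rightarrow> complex \<Rightarrow> bool" where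
  "complex_eigenvalue Q c \<longleftrightarrow>
     (\<exists>v :: complex ^ 'd. v \<noteq> 0 \<and> (\<chi> i j. complex_of_real (matrix Q $ i $ j)) *v v = c *s v)"

definition expansive :: "(real ^ 'd \<Rightarrow> real ^ 'd::finite) \<Rightarrow> bool" where
  "expansive Q \<longleftrightarrow> linear Q \<and> (\<forall>c. complex_eigenvalue Q c \<longrightarrow> cmod c > 1)"

definition substitution_delone ::
  "(real ^ 'd \<Rightarrow> real ^ 'd) \<Rightarrow> ('k \<Rightarrow> 'k \<Rightarrow> (real ^ 'd) set) \<Rightarrow> ('d::finite, 'k::finite) kset \<Rightarrow> bool" where
  "substitution_delone Q D \<Lambda> \<longleftrightarrow>
     delone_kset \<Lambda> \<and> expansive Q \<and> (\<forall>i j. finite (D i j)) \<and>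
     (\<forall>i. \<Lambda> i = (\<Union>j. \<Union>a\<in>D i j. (\<lambda>x. Q x + a) ` \<Lambda> j)) \<and>
     (\<forall>i. disjoint_family_on (\<lambda>(j, a). (\<lambda>x. Q x + a) ` \<Lambda> j) (SIGMA j:UNIV. D i j))"

definition substitution_matrix :: "('k \<Rightarrow> 'k \<Rightarrow> (real ^ 'd) set) \<Rightarrow> nat ^ 'k ^ 'k::finite" where
  "substitution_matrix D = (\<chi> i j. card (D i j))"

definition primitive :: "nat ^ 'k ^ 'k::finite \<Rightarrow> bool" where
  "primitive M \<longleftrightarrow> (\<exists>p>0. \<forall>i j. (((**) M ^^ p) (mat 1)) $ i $ j \<noteq> 0)"

definition prototile_supports ::
  "(real ^ 'd \<Rightarrow> real ^ 'd) \<Rightarrow> ('k \<Rightarrow> 'k \<Rightarrow> (real ^ 'd) set) \<Rightarrow> ('k::finite \<Rightarrow> (real ^ 'd::finite) set) \<Rightarrow> bool" where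
  "prototile_supports Q D A \<longleftrightarrow>
     (\<forall>j. A j \<noteq> {} \<and> compact (A j)) \<and>
     (\<forall>j. Q ` A j = (\<Union>i. \<Union>a\<in>D i j. (+) a ` A i))"

type_synonym ('d, 'k) tile = "(real, 'd) vec set \<times> 'k"

definition translate_tile :: "real ^ 'd::finite \<Rightarrow> ('d, 'k) tile \<Rightarrow> ('d, 'k) tile" where
  "translate_tile x T = ((+) x ` fst T, snd T)"

definition prototile :: "('k \<Rightarrow> (real ^ 'd::finite) set) \<Rightarrow> 'k \<Rightarrow> ('d, 'k) tile" where
  "prototile A i = (A i, i)"

definition non_overlapping :: "('d::finite, 'k) tile set \<Rightarrow> bool" where
  "non_overlapping P \<longleftrightarrow> pairwise (\<lambda>T T'. interior (fst T) \<inter> interior (fst T') = {}) P"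

definition tiles_of :: "('k \<Rightarrow> (real ^ 'd::finite) set) \<Rightarrow> ('d, 'k) kset \<Rightarrow> ('d, 'k) tile set" where
  "tiles_of A \<Lambda> = {translate_tile x (prototile A i) |x i. x \<in> \<Lambda> i}"

definition representable :: "('k \<Rightarrow> (real ^ 'd::finite) set) \<Rightarrow> ('d, 'k) kset \<Rightarrow> bool" where
  "representable A \<Lambda> \<longleftrightarrow> (\<Union>T\<in>tiles_of A \<Lambda>. fst T) = UNIV \<and> non_overlapping (tiles_of A \<Lambda>)"

definition tile_substitution ::
  "(real ^ 'd \<Rightarrow> real ^ 'd) \<Rightarrow> ('k \<Rightarrow> 'k \<Rightarrow> (real ^ 'd) set) \<Rightarrow> ('k \<Rightarrow> (real ^ 'd::finite) set) \<Rightarrow>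
   ('d, 'k) tile set \<Rightarrow> ('d, 'k) tile set" where
  "tile_substitution Q D A P =
     {translate_tile (u + Q x) (prototile A i) |u x i j.
        translate_tile x (prototile A j) \<in> P \<and> u \<in> D i j}"

definition patch :: "('k \<Rightarrow> (real ^ 'd::finite) set) \<Rightarrow> ('d, 'k) tile set \<Rightarrow> bool" where
  "patch A P \<longleftrightarrow>
     finite P \<and> P \<subseteq> {translate_tile x (prototile A i) |x i. True} \<and> non_overlapping P"

definition legal ::
  "(real ^ 'd \<Rightarrow> real ^ 'd) \<Rightarrow> ('k \<Rightarrow> 'k \<Rightarrow> (real ^ 'd) set) \<Rightarrow> ('k \<Rightarrow> (real ^ 'd::finite) set) \<Rightarrow>
   ('d, 'k) tile set \<Rightarrow> bool" where
  "legal Q D A P \<longleftrightarrow>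
     (\<exists>k i y P'. patch A P' \<and> P' \<subseteq> (tile_substitution Q D A ^^ k) {prototile A i} \<and>
        P = translate_tile y ` P')"

definition Xi_legal ::
  "(real ^ 'd \<Rightarrow> real ^ 'd) \<Rightarrow> ('k \<Rightarrow> 'k \<Rightarrow> (real ^ 'd) set) \<Rightarrow> ('k \<Rightarrow> (real ^ 'd::finite) set) \<Rightarrow>
   ('d, 'k) kset \<Rightarrow> (real ^ 'd) set" where
  "Xi_legal Q D A \<Lambda> =
     {x. \<exists>P T T'. P \<subseteq> tiles_of A \<Lambda> \<and> legal Q D A P \<and> T \<in> P \<and> T' \<in> P \<and> T' = translate_tile x T}"

definition near :: "real \<Rightarrow> ('d::finite, 'k::finite) kset \<Rightarrow> ('d, 'k) kset \<Rightarrow> bool" where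
  "near e \<Gamma> \<Gamma>' \<longleftrightarrow> (\<forall>i. ball 0 (1 / e) \<inter> \<Gamma>' i \<subseteq> {x + b |x b. x \<in> \<Gamma> i \<and> b \<in> ball 0 e})"

text \<open>Including \<open>1 / sqrt 2\<close> in the set gives the minimum of \<open>1 / sqrt 2\<close> and the infimum, with
  \<open>+\<infinity>\<close> as the infimum of the empty set; on the reals \<open>Inf {}\<close> is unspecified.\<close>

definition kdist :: "('d::finite, 'k::finite) kset \<Rightarrow> ('d, 'k) kset \<Rightarrow> real" where
  "kdist \<Gamma> \<Gamma>' = Inf (insert (1 / sqrt 2) {e. e > 0 \<and> near e \<Gamma> \<Gamma>' \<and> near e \<Gamma>' \<Gamma>})"

lemma near_triangle:
  assumes "near a X Y" "near b Y Z" "0 < a" "0 < b" "a + b \<le> 1 / sqrt 2"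
  shows "near (a + b) X Z"
  unfolding near_def
proof (intro allI subsetI)
  fix i z assume z: "z \<in> ball 0 (1 / (a + b)) \<inter> Z i"
  have "1 / (a + b) \<le> 1 / b" using assms by (simp add: frac_le)
  then have "z \<in> ball 0 (1 / b) \<inter> Z i" using z by auto
  then obtain y v where y: "y \<in> Y i" and v: "norm v < b" and zy: "z = y + v"
    using assms(2) unfolding near_def by (force dest: spec[of _ i])
  have "a * (a + b) \<le> (a + b) * (a + b)" using assms by (intro mult_right_mono) auto
  also have "\<dots> \<le> (1 / sqrt 2) * (1 / sqrt 2)" using assms by (intro mult_mono) auto
  also have "\<dots> \<le> 1" by (simp add: field_simps)
  finally have "a * (a + b) \<le> 1" .
  then have "b * (a * (a + b)) \<le> b * 1" using assms by (intro mult_left_mono) auto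
  then have "1 / (a + b) + b \<le> 1 / a"
    using assms by (simp add: field_simps)
  moreover have "norm y \<le> norm z + norm v" unfolding zy by (metis add_diff_cancel_right' norm_triangle_ineq4)
  ultimately have "y \<in> ball 0 (1 / a) \<inter> Y i" using y v z by auto
  then obtain x w where x: "x \<in> X i" and w: "norm w < a" and yx: "y = x + w"
    using assms(1) unfolding near_def by (force dest: spec[of _ i])
  have "w + v \<in> ball 0 (a + b)" using v w norm_triangle_ineq[of w v] by simp
  moreover have "z = x + (w + v)" using zy yx by (simp add: add.assoc)
  ultimately show "z \<in> {x + c |x c. x \<in> X i \<and> c \<in> ball 0 (a + b)}"
    using x by blast
qed

lemma kdist_less_iff:
  "kdist \<Gamma> \<Gamma>' < r \<longleftrightarrow> 1 / sqrt 2 < r \<or> (\<exists>e>0. e < r \<and> near e \<Gamma> \<Gamma>' \<and> near e \<Gamma>' \<Gamma>)"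
proof -
  have "bdd_below (insert (1 / sqrt 2) {e. e > 0 \<and> near e \<Gamma> \<Gamma>' \<and> near e \<Gamma>' \<Gamma>})"
    by (rule bdd_belowI[of _ 0]) auto
  then show ?thesis unfolding kdist_def by (subst cInf_less_iff) auto
qed

lemma kdist_nonneg: "0 \<le> kdist \<Gamma> \<Gamma>'"
  unfolding kdist_def by (rule cInf_greatest) auto

lemma kdist_le: "kdist \<Gamma> \<Gamma>' \<le> 1 / sqrt 2"
  unfolding kdist_def by (rule cInf_lower) (auto intro!: bdd_belowI[of _ 0])

lemma kdist_commute: "kdist \<Gamma> \<Gamma>' = kdist \<Gamma>' \<Gamma>"
  unfolding kdist_def by (simp add: conj_commute)

lemma kdist_triangle: "kdist X Z \<le> kdist X Y + kdist Y Z"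
proof (rule field_le_epsilon)
  fix c :: real assume c: "0 < c"
  show "kdist X Z \<le> kdist X Y + kdist Y Z + c"
  proof (cases "kdist X Y + kdist Y Z + c < 1 / sqrt 2")
    case False
    then show ?thesis using kdist_le[of X Z] by linarith
  next
    case True
    have *: "kdist X Y < kdist X Y + c / 2" "kdist Y Z < kdist Y Z + c / 2" using c by auto
    obtain a where a: "a > 0" "a < kdist X Y + c / 2" "near a X Y" "near a Y X"
      using *(1) True kdist_nonneg[of Y Z] c unfolding kdist_less_iff[of X Y "kdist X Y + c / 2"] by auto
    obtain b where b: "b > 0" "b < kdist Y Z + c / 2" "near b Y Z" "near b Z Y"
      using *(2) True kdist_nonneg[of X Y] c unfolding kdist_less_iff[of Y Z "kdist Y Z + c / 2"] by auto
    have ab: "a + b < kdist X Y + kdist Y Z + c" using a b by linarith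
    have "near (a + b) X Z" using near_triangle[of a X Y b Z] a b ab True by linarith
    moreover have "near (a + b) Z X"
      using near_triangle[of b Z Y a X] a b ab True by (simp add: add.commute)
    ultimately have "kdist X Z < kdist X Y + kdist Y Z + c"
      unfolding kdist_less_iff using a b ab by (intro disjI2 exI[of _ "a + b"]) auto
    then show ?thesis by simp
  qed
qed

lemma kdist_zero_subset:
  assumes "kdist X Y = 0" "uniform_discrete (X i)"
  shows "Y i \<subseteq> X i"
proof
  fix y assume y: "y \<in> Y i"
  have "closed (X i)"
    using assms(2) unfolding uniform_discrete_def
    by (metis discrete_imp_closed)
  moreover have "\<exists>x\<in>X i. dist x y < r" if r: "r > 0" for r
  proof -
    define s where "s = min (min r (1 / sqrt 2)) (1 / (norm y + 1))"
    have npos: "norm y + 1 > 0" using norm_ge_zero[of y] by linarith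
    have s: "0 < s" "s \<le> r" "s \<le> 1 / sqrt 2" "s \<le> 1 / (norm y + 1)"
      using r npos unfolding s_def by auto
    obtain e where e: "e > 0" "e < s" "near e X Y"
      using kdist_less_iff[of X Y s] assms(1) s by auto
    have "norm y + 1 \<le> 1 / s" using s(1,4) npos by (simp add: field_simps)
    also have "1 / s < 1 / e" using e by (simp add: frac_less2)
    finally have "y \<in> ball 0 (1 / e) \<inter> Y i" using y by simp
    then obtain x b where "x \<in> X i" "norm b < e" "y = x + b"
      using e(3) unfolding near_def by (force dest: spec[of _ i])
    then show ?thesis using e s by (intro bexI[of _ x]) (auto simp: dist_norm)
  qed
  ultimately show "y \<in> X i" using closed_approachable by blast
qed

lemma near_self: "e > 0 \<Longrightarrow> near e \<Gamma> \<Gamma>"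
  unfolding near_def
  by (intro allI subsetI CollectI, rename_tac i x, rule_tac x = x in exI, rule_tac x = 0 in exI) auto

lemma Metric_space_kdist: "Metric_space {\<Gamma>. delone_kset \<Gamma>} kdist"
proof
  fix X Y :: "('d::finite, 'k::finite) kset"
  assume XY: "X \<in> {\<Gamma>. delone_kset \<Gamma>}" "Y \<in> {\<Gamma>. delone_kset \<Gamma>}"
  show "kdist X Y = 0 \<longleftrightarrow> X = Y"
  proof
    assume "kdist X Y = 0"
    with XY show "X = Y"
      using kdist_zero_subset[of X Y] kdist_zero_subset[of Y X] kdist_commute[of X Y]
      unfolding delone_kset_def delone_def by (intro ext equalityI) auto
  next
    assume "X = Y"
    then have "kdist X Y < r" if "r > 0" for r
      using that unfolding kdist_less_iff
      by (intro disjI2 exI[of _ "r / 2"]) (simp add: near_self)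
    then show "kdist X Y = 0"
      using kdist_nonneg[of X Y] by (metis less_le not_less_iff_gr_or_eq)
  qed
qed (auto simp: kdist_nonneg kdist_commute kdist_triangle)

definition kset_topology :: "('d::finite, 'k::finite) kset topology" where
  "kset_topology = Metric_space.mtopology {\<Gamma>. delone_kset \<Gamma>} kdist"

definition shift :: "real ^ 'd::finite \<Rightarrow> ('d, 'k::finite) kset \<Rightarrow> ('d, 'k) kset" where
  "shift g \<Gamma> = (\<lambda>i. (\<lambda>x. x - g) ` \<Gamma> i)"

definition hull_of :: "('d::finite, 'k::finite) kset \<Rightarrow> ('d, 'k) kset set" where
  "hull_of \<Lambda> = kset_topology closure_of (range (\<lambda>g. shift g \<Lambda>))"

definition hull_borel :: "('d::finite, 'k::finite) kset \<Rightarrow> ('d, 'k) kset measure" where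
  "hull_borel \<Lambda> = sigma (hull_of \<Lambda>) {U. openin (subtopology kset_topology (hull_of \<Lambda>)) U}"

definition invariant_probability :: "('d::finite, 'k::finite) kset \<Rightarrow> ('d, 'k) kset measure \<Rightarrow> bool" where
  "invariant_probability \<Lambda> \<mu> \<longleftrightarrow>
     sets \<mu> = sets (hull_borel \<Lambda>) \<and> emeasure \<mu> (space \<mu>) = 1 \<and>
     (\<forall>g. \<forall>E\<in>sets \<mu>. emeasure \<mu> (shift g -` E \<inter> space \<mu>) = emeasure \<mu> E)"

definition box_of :: "nat \<Rightarrow> (real ^ 'd::finite) set" where
  "box_of m = {x. \<forall>j. -(2 ^ m) \<le> x $ j \<and> x $ j < 2 ^ m}"

definition grid_cube :: "nat \<Rightarrow> ('d \<Rightarrow> int) \<Rightarrow> (real ^ 'd::finite) set" where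
  "grid_cube m k = {x. \<forall>j. of_int (k j) / 2 ^ m \<le> x $ j \<and> x $ j < (of_int (k j) + 1) / 2 ^ m}"

definition coloured_cubes :: "nat \<Rightarrow> ((real ^ 'd::finite) set \<times> 'k::finite) set" where
  "coloured_cubes m = {(grid_cube m k, i) |k i. \<forall>j. -(4 ^ m) \<le> k j \<and> k j < 4 ^ m}"

text \<open>The sets \<open>\<Delta>\<^bsub>m,\<alpha>\<^esub>\<close>; they are used directly in place of an enumeration index \<open>\<alpha>\<close>.\<close>

definition cube_selections :: "nat \<Rightarrow> ((real ^ 'd::finite) set \<times> 'k::finite) set set" where
  "cube_selections m = {S. S \<subseteq> coloured_cubes m \<and> pairwise (\<lambda>C C'. fst C \<inter> fst C' = {}) S}"

definition cube_patterns ::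
  "nat \<Rightarrow> ((real ^ 'd::finite) set \<times> 'k::finite) set \<Rightarrow> ((real ^ 'd) \<times> 'k) set set" where
  "cube_patterns m S =
     {P. finite P \<and> P \<subseteq> box_of m \<times> UNIV \<and>
        (\<forall>C\<in>S. \<exists>!p. p \<in> P \<inter> fst C \<times> {snd C}) \<and>
        (\<forall>C\<in>coloured_cubes m - S. P \<inter> fst C \<times> {snd C} = {})}"

definition grid_cylinder ::
  "('d, 'k) kset \<Rightarrow> nat \<Rightarrow> ((real ^ 'd::finite) set \<times> 'k::finite) set \<Rightarrow> ('d, 'k) kset set" where
  "grid_cylinder \<Lambda> m S =
     {\<Gamma> \<in> hull_of \<Lambda>. coloured_points \<Gamma> \<inter> box_of m \<times> UNIV \<in> cube_patterns m S}"

end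

(*
  Two occurrences of a pattern in a supertile of level n whose positions differ by Q^n v recur in
  every supertile of level n + K, as soon as all K-fold digit sets contain two digits differing by v;
  for a legal return vector z this holds with v = Q^p z, by primitivity.  Since the boundaries of the
  prototiles are null sets, for large n almost every position lies deep inside a supertile, where the
  pattern is determined by the type of the supertile alone.  Hence a positive fraction mu(E) of
  positions carrying the pattern forces one type of supertile to carry it with frequency at least
  mu(E)/2, and each supertile of level n + K contributes two such supertiles at distance Q^(n+p) z.
  Both estimates hold for windows of the Delone set, uniformly in the position of the window, pass to
  almost every position in an element of the hull, and are integrated against mu by Fubini.
*)
theory Submission
  imports Defs "HOL-Computational_Algebra.Fundamental_Theorem_Algebra"
begin

section \<open>Backward orbits of expansive maps\<close>

text \<open>Expansiveness is a condition on complex eigenvalues, so Q may shrink some vectors for a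
  while. The geometry rests on a consequence: the inverse powers tend to 0 in norm, so that every
  fixed radius becomes negligible against supertiles of high level. Proving this is the purpose of
  the complex polynomials at the start. One lower bound for all windows requires supertiles of every
  type to contribute, and each must contain both members of the pair itself. The price is a passage
  from z to its image under a power of Q, which is repaid by working at a lower level of the
  hierarchy. Cylinders are built from half-open cubes and are in general neither open nor closed in
  the hull. Their measurability and that of their translates is extracted from the positivity of
  their measure, and jumps at the cube faces are handled in two ways: they occur at a null set of
  positions, and they disappear when a position is approached from below in every coordinate. The
  resulting constant depends on z only through K, hence neither on the grid nor on the
  pattern.\<close>

definition poly_mv :: "complex ^ 'n ^ 'n::finite \<Rightarrow> complex poly \<Rightarrow> complex ^ 'n \<Rightarrow> complex ^ 'n" where
  "poly_mv M p = fold_coeffs (\<lambda>a f v. a *s v + f (M *v v)) p (\<lambda>_. 0)"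

lemma poly_mv_0 [simp]: "poly_mv M 0 v = 0"
  by (simp add: poly_mv_def)

lemma poly_mv_pCons [simp]: "poly_mv M (pCons a p) v = a *s v + poly_mv M p (M *v v)"
  by (cases "p = 0 \<and> a = 0") (auto simp: poly_mv_def)

lemma poly_mv_add: "poly_mv M (p + q) v = poly_mv M p v + poly_mv M q v"
proof (induction p arbitrary: q v)
  case (pCons a p)
  show ?case by (cases q) (simp add: pCons.IH vector_sadd_rdistrib)
qed simp

lemma poly_mv_smult: "poly_mv M (smult c p) v = c *s poly_mv M p v"
  by (induction p arbitrary: v) (simp_all add: vector_ssub_ldistrib vector_add_ldistrib)

lemma poly_mv_add_arg: "poly_mv M p (v + w) = poly_mv M p v + poly_mv M p w"
  by (induction p arbitrary: v w) (simp_all add: vector_add_ldistrib matrix_vector_right_distrib)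

lemma poly_mv_scale_arg: "poly_mv M p (c *s v) = c *s poly_mv M p v"
  by (induction p arbitrary: v) (simp_all add: vector_add_ldistrib vector_scalar_commute mult.commute)

lemma poly_mv_commute: "M *v poly_mv M p v = poly_mv M p (M *v v)"
  by (induction p arbitrary: v) (simp_all add: matrix_vector_right_distrib vector_scalar_commute)

text \<open>\<open>poly_mv M p v\<close> is p(M) v in Horner form, so a linear factor of p can be
  moved onto the vector. Roots of an annihilating polynomial are removed in this way.\<close>

lemma poly_mv_linear_factor: "poly_mv M ([:-c, 1:] * q) v = poly_mv M q (M *v v - c *s v)"
proof -
  have "M *v v - c *s v = M *v v + (-c) *s v" by simp
  then have "poly_mv M q (M *v v - c *s v) = poly_mv M q (M *v v) + (-c) *s poly_mv M q v"
    by (simp only: poly_mv_add_arg poly_mv_scale_arg)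
  moreover have "[:-c, 1:] * q = smult (-c) q + pCons 0 q" by simp
  ultimately show ?thesis by (simp only: poly_mv_add poly_mv_smult poly_mv_pCons) simp
qed

lemma contracting_recurrence_tendsto_0:
  fixes u r :: "nat \<Rightarrow> 'a::real_normed_vector"
  assumes b: "0 \<le> b" "b < 1" and r: "r \<longlonglongrightarrow> 0"
    and le: "\<And>n. norm (u (Suc n)) \<le> b * norm (u n) + norm (r n)"
  shows "u \<longlonglongrightarrow> 0"
proof (rule LIMSEQ_I)
  fix e :: real assume e: "e > 0"
  \<comment> \<open>With this bound on the perturbation, e / 2 is the fixed point of t |-> b t + s,
    and only the geometric transient remains besides it.\<close>
  define s where "s = e * (1 - b) / 2"
  have s: "s > 0" using e b by (simp add: s_def)
  obtain N where N: "\<And>n. n \<ge> N \<Longrightarrow> norm (r n) < s"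
    using LIMSEQ_D[OF r s] by auto
  have bd: "norm (u (N + k)) \<le> b ^ k * norm (u N) + e / 2" for k
  proof (induction k)
    case (Suc k)
    have "norm (u (N + Suc k)) \<le> b * norm (u (N + k)) + s"
      using le[of "N + k"] N[of "N + k"] by simp
    also have "\<dots> \<le> b * (b ^ k * norm (u N) + e / 2) + s"
      using Suc b by (intro add_right_mono mult_left_mono) auto
    also have "\<dots> = b ^ Suc k * norm (u N) + e / 2" by (simp add: s_def field_simps)
    finally show ?case .
  qed (use e in simp)
  have "(\<lambda>k. b ^ k * norm (u N)) \<longlonglongrightarrow> 0"
    using b by (intro tendsto_mult_left_zero LIMSEQ_realpow_zero) auto
  then obtain K where K: "\<And>k. k \<ge> K \<Longrightarrow> norm (b ^ k * norm (u N)) < e / 2"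
    using LIMSEQ_D[of _ 0 "e / 2"] e by (metis diff_zero half_gt_zero)
  have "norm (u n - 0) < e" if "n \<ge> N + K" for n
  proof -
    have "K \<le> n - N" "N + (n - N) = n" using that by auto
    then have "\<bar>b ^ (n - N) * norm (u N)\<bar> < e / 2" "norm (u n) \<le> b ^ (n - N) * norm (u N) + e / 2"
      using bd[of "n - N"] K[of "n - N"] by simp_all
    then show ?thesis by simp
  qed
  then show "\<exists>no. \<forall>n\<ge>no. norm (u n - 0) < e" by blast
qed

lemma norm_vector_smult: "norm (c *s (v :: complex ^ 'n::finite)) = cmod c * norm v"
  by (simp add: norm_vec_def L2_set_def norm_mult power_mult_distrib flip: sum_distrib_left)
     (simp add: real_sqrt_mult)

text \<open>Induction on the degree of a polynomial annihilating \<open>u 0\<close>, one root c at a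
  time, as along a Jordan block. If |c| > 1, then M u - c u is again a backward orbit and is killed
  by the remaining factor; u is recovered from it by a recurrence contracting at rate 1 / |c|. If
  |c| <= 1, then c is no eigenvalue, so the remaining factor already annihilates
  \<open>u 0\<close>.\<close>

lemma backward_orbit_tendsto_0_complex:
  fixes M :: "complex ^ 'n ^ 'n::finite"
  assumes ev: "\<And>c v. v \<noteq> 0 \<Longrightarrow> M *v v = c *s v \<Longrightarrow> cmod c > 1"
    and "p \<noteq> 0" "poly_mv M p (u 0) = 0" "\<And>n. M *v u (Suc n) = u n"
  shows "u \<longlonglongrightarrow> 0"
  using assms(2-)
proof (induction "degree p" arbitrary: p u)
  case 0
  then obtain a where a: "p = [:a:]" "a \<noteq> 0" by (metis degree_eq_zeroE pCons_0_0)
  \<comment> \<open>Since 0 is not an eigenvalue, M has trivial kernel and a backward orbit of 0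
    stays at 0.\<close>
  have "u n = 0" for n
  proof (induction n)
    case 0
    with a \<open>poly_mv M p (u 0) = 0\<close> show ?case by simp
  next
    case (Suc n)
    then show ?case using ev[of "u (Suc n)" 0] 0(4)[of n] by fastforce
  qed
  then have "u = (\<lambda>_. 0)" by auto
  then show ?case by simp
next
  case (Suc d)
  then have "\<not> constant (poly p)" by (simp add: constant_degree)
  then obtain c where "poly p c = 0" using fundamental_theorem_of_algebra by blast
  then obtain q where pq: "p = [:-c, 1:] * q" using poly_eq_0_iff_dvd by blast
  have q: "q \<noteq> 0" "d = degree q"
    using Suc(2,3) degree_mult_eq[of "[:-c, 1:]" q] unfolding pq by (auto simp del: mult_pCons_left)
  show ?case
  proof (cases "cmod c > 1")
    case True
    define u' where "u' n = M *v u n - c *s u n" for n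
    have "u' \<longlonglongrightarrow> 0"
    proof (rule Suc(1)[OF q(2,1)])
      show "poly_mv M q (u' 0) = 0"
        using Suc(4) unfolding pq poly_mv_linear_factor u'_def .
      show "M *v u' (Suc n) = u' n" for n
        unfolding u'_def using Suc(5)[of n]
        by (simp add: matrix_vector_mult_diff_distrib vector_scalar_commute)
    qed
    then have u': "(\<lambda>n. u' (Suc n)) \<longlonglongrightarrow> 0" by (rule LIMSEQ_Suc)
    show ?thesis
    proof (rule contracting_recurrence_tendsto_0[OF _ _ u'])
      show "0 \<le> 1 / cmod c" "1 / cmod c < 1" using True by (simp_all add: divide_less_eq)
      fix n
      have "c *s u (Suc n) = u n - u' (Suc n)"
        unfolding u'_def using Suc(5)[of n] by simp
      then have "cmod c * norm (u (Suc n)) \<le> norm (u n) + norm (u' (Suc n))"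
        by (metis norm_triangle_ineq4 norm_vector_smult)
      then have "norm (u (Suc n)) \<le> (norm (u n) + norm (u' (Suc n))) / cmod c"
        using True by (subst pos_le_divide_eq) (auto simp: mult.commute)
      also have "\<dots> \<le> 1 / cmod c * norm (u n) + norm (u' (Suc n))"
        using True divide_left_mono[of 1 "cmod c" "norm (u' (Suc n))"]
        by (force simp: add_divide_distrib)
      finally show "norm (u (Suc n)) \<le> 1 / cmod c * norm (u n) + norm (u' (Suc n))" .
    qed
  next
    case False
    define v where "v = poly_mv M q (u 0)"
    have "poly_mv M q (M *v u 0 - c *s u 0) = 0"
      using Suc(4) unfolding pq poly_mv_linear_factor .
    moreover have "M *v u 0 = c *s u 0 + (M *v u 0 - c *s u 0)" by simp
    ultimately have "M *v v = c *s v"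
      unfolding v_def poly_mv_commute by (metis add.right_neutral poly_mv_add_arg poly_mv_scale_arg)
    then have "v = 0" using ev False by blast
    then show ?thesis using Suc(5) v_def by (intro Suc(1)[OF q(2,1)]) auto
  qed
qed

lemma poly_mv_sum: "poly_mv M (\<Sum>i\<in>I. f i) v = (\<Sum>i\<in>I. poly_mv M (f i) v)"
  by (induction I rule: infinite_finite_induct) (simp_all add: poly_mv_add)

lemma poly_mv_monom: "poly_mv M (monom a i) v = a *s (((*v) M ^^ i) v)"
  by (induction i arbitrary: v) (simp_all add: monom_0 monom_Suc funpow_swap1)

section \<open>Annihilating polynomials of real vectors through complexification\<close>

definition cvec :: "real ^ 'n \<Rightarrow> complex ^ 'n::finite" where
  "cvec v = (\<chi> i. complex_of_real (v $ i))"

definition cmat :: "real ^ 'n ^ 'n \<Rightarrow> complex ^ 'n ^ 'n::finite" where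
  "cmat M = (\<chi> i j. complex_of_real (M $ i $ j))"

lemma cmat_cvec: "cmat M *v cvec v = cvec (M *v v)"
  by (simp add: cmat_def cvec_def matrix_vector_mult_def vec_eq_iff)

lemma norm_cvec: "norm (cvec v) = norm v"
  by (simp add: cvec_def norm_vec_def)

lemma cmat_cvec_funpow: "((*v) (cmat M) ^^ i) (cvec v) = cvec (((*v) M ^^ i) v)"
  by (induction i) (simp_all add: cmat_cvec)

text \<open>The DIM + 1 vectors from v to its iterate of order DIM are linearly dependent over the
  reals, and a dependency is read as the coefficients of p.\<close>

lemma annihilating_poly_exists:
  fixes M :: "real ^ 'n ^ 'n::finite"
  shows "\<exists>p. p \<noteq> 0 \<and> poly_mv (cmat M) p (cvec v) = 0"
proof -
  define f where "f i = ((*v) M ^^ i) v" for i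
  show ?thesis
  proof (cases "inj_on f {..DIM(real^'n)}")
    case True
    then have "card (f ` {..DIM(real^'n)}) > DIM(real^'n)" by (simp add: card_image)
    then have "dependent (f ` {..DIM(real^'n)})" using dependent_biggerset[of "f ` {..DIM(real^'n)}"] by simp
    then obtain c where c: "\<exists>w\<in>f ` {..DIM(real^'n)}. c w \<noteq> 0" "(\<Sum>w\<in>f ` {..DIM(real^'n)}. c w *\<^sub>R w) = 0"
      by (auto simp: dependent_finite)
    define p where "p = (\<Sum>i\<le>DIM(real^'n). monom (complex_of_real (c (f i))) i)"
    obtain k where k: "k \<le> DIM(real^'n)" "c (f k) \<noteq> 0" using c(1) by auto
    have "coeff p k = (\<Sum>i\<le>DIM(real^'n). if i = k then complex_of_real (c (f i)) else 0)"
      unfolding p_def coeff_sum by (intro sum.cong) auto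
    also have "\<dots> \<noteq> 0" using k by simp
    finally have "p \<noteq> 0" by auto
    have "poly_mv (cmat M) p (cvec v) = (\<Sum>i\<le>DIM(real^'n). complex_of_real (c (f i)) *s cvec (f i))"
      by (simp add: p_def poly_mv_sum poly_mv_monom cmat_cvec_funpow f_def)
    also have "\<dots> = cvec (\<Sum>i\<le>DIM(real^'n). c (f i) *\<^sub>R f i)"
      by (simp add: vec_eq_iff cvec_def)
    also have "(\<Sum>i\<le>DIM(real^'n). c (f i) *\<^sub>R f i) = 0"
      using c(2) by (subst (asm) sum.reindex[OF True]) (simp add: o_def)
    finally have "poly_mv (cmat M) p (cvec v) = cvec 0" .
    then show ?thesis using \<open>p \<noteq> 0\<close> by (auto simp: cvec_def vec_eq_iff)
  next
    \<comment> \<open>Linear dependence concerns a set of vectors, so coinciding iterates are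
      treated apart: they give the polynomial X^i - X^j.\<close>
    case False
    then obtain i j where ij: "i \<noteq> j" "f i = f j" by (auto simp: inj_on_def)
    have "poly_mv (cmat M) (monom 1 i + smult (- 1) (monom 1 j)) (cvec v) = 0"
      using ij unfolding poly_mv_add poly_mv_smult poly_mv_monom cmat_cvec_funpow f_def by simp
    moreover have "coeff (monom 1 i + smult (- 1) (monom 1 j)) i = (1::complex)"
      using ij by simp
    then have "monom 1 i + smult (- 1) (monom (1::complex) j) \<noteq> 0"
      by (metis coeff_0 zero_neq_one)
    ultimately show ?thesis by blast
  qed
qed

lemma matrix_mult_linear:
  "linear f \<Longrightarrow> matrix f *v x = f x" for f :: "real ^ 'n \<Rightarrow> real ^ 'm"
  by (rule matrix_works) (simp only: linear_matrix_vector_mul_eq)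

lemma expansive_linear: "expansive Q \<Longrightarrow> linear Q"
  by (simp add: expansive_def)

lemma expansive_bij:
  assumes "expansive Q" shows "bij Q"
proof -
  have lin: "linear Q" using assms by (rule expansive_linear)
  have "x = 0" if "Q x = 0" for x
  proof (rule ccontr)
    assume "x \<noteq> 0"
    then have "cvec x \<noteq> 0" by (auto simp: cvec_def vec_eq_iff)
    moreover have "cmat (matrix Q) *v cvec x = 0 *s cvec x"
      unfolding cmat_cvec using that lin by (simp add: matrix_mult_linear) (simp add: cvec_def vec_eq_iff)
    ultimately have "complex_eigenvalue Q 0" unfolding complex_eigenvalue_def cmat_def by blast
    then show False using assms by (auto simp: expansive_def)
  qed
  then have "inj Q" using linear_injective_0[OF lin] by auto
  then show ?thesis using linear_injective_imp_surjective[OF lin] by (simp add: bij_def)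
qed

lemma linear_funpow:
  fixes f :: "'a::real_vector \<Rightarrow> 'a"
  assumes "linear f" shows "linear (f ^^ n)"
proof (induction n)
  case (Suc n)
  show ?case unfolding funpow.simps by (rule linear_compose[OF Suc assms])
qed (simp add: linear_id[unfolded id_def] id_def)

text \<open>After complexification the sequence is a backward orbit of the matrix of Q, and
  \<open>cvec\<close> preserves norms.\<close>

lemma expansive_inv_tendsto_0:
  assumes "expansive Q" shows "(\<lambda>n. (inv Q ^^ n) v) \<longlonglongrightarrow> 0"
proof -
  have lin: "linear Q" using assms by (rule expansive_linear)
  obtain p where p: "p \<noteq> 0" "poly_mv (cmat (matrix Q)) p (cvec v) = 0"
    using annihilating_poly_exists by blast
  have "(\<lambda>n. cvec ((inv Q ^^ n) v)) \<longlonglongrightarrow> 0"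
  proof (rule backward_orbit_tendsto_0_complex[OF _ p(1)])
    show "cmod c > 1" if "w \<noteq> 0" "cmat (matrix Q) *v w = c *s w" for c w
      using that assms unfolding expansive_def complex_eigenvalue_def cmat_def by blast
    show "cmat (matrix Q) *v cvec ((inv Q ^^ Suc n) v) = cvec ((inv Q ^^ n) v)" for n
      using expansive_bij[OF assms]
      by (simp add: cmat_cvec matrix_mult_linear[OF lin] surj_f_inv_f bij_is_surj)
  qed (simp add: p)
  then have "(\<lambda>n. norm (cvec ((inv Q ^^ n) v))) \<longlonglongrightarrow> 0" by (simp add: tendsto_norm_zero)
  then show ?thesis by (simp add: norm_cvec tendsto_norm_zero_iff)
qed

text \<open>A linear map is controlled by its values on a finite basis, so pointwise convergence of
  the inverse powers gives convergence in operator norm.\<close>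

lemma expansive_inv_uniform:
  assumes Q: "expansive (Q :: real ^ 'd \<Rightarrow> real ^ 'd::finite)" and e: "e > 0"
  shows "\<forall>\<^sub>F n in sequentially. \<forall>x. norm ((inv Q ^^ n) x) \<le> e * norm x"
proof -
  have lin: "linear (inv Q)"
    using Q by (intro inj_linear_imp_inv_linear expansive_linear bij_is_inj expansive_bij)
  have "(\<lambda>n. \<Sum>b\<in>(Basis :: (real ^ 'd) set). norm ((inv Q ^^ n) b)) \<longlonglongrightarrow> (\<Sum>b\<in>(Basis :: (real ^ 'd) set). norm (0 :: real ^ 'd))"
    by (intro tendsto_sum tendsto_norm expansive_inv_tendsto_0 Q)
  then have "\<forall>\<^sub>F n in sequentially. (\<Sum>b\<in>(Basis :: (real ^ 'd) set). norm ((inv Q ^^ n) b)) < e"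
    using e by (intro order_tendstoD(2)) auto
  then show ?thesis
  proof eventually_elim
    case (elim n)
    show ?case
    proof
      fix x :: "real ^ 'd"
      have ln: "linear (inv Q ^^ n)" by (rule linear_funpow[OF lin])
      have "(inv Q ^^ n) x = (inv Q ^^ n) (\<Sum>b\<in>Basis. (x \<bullet> b) *\<^sub>R b)"
        by (simp only: euclidean_representation)
      also have "\<dots> = (\<Sum>b\<in>Basis. (x \<bullet> b) *\<^sub>R (inv Q ^^ n) b)"
        using ln by (simp add: linear_sum linear_cmul)
      also have "norm \<dots> \<le> (\<Sum>b\<in>Basis. norm x * norm ((inv Q ^^ n) b))"
        by (rule sum_norm_le) (simp add: mult_right_mono Basis_le_norm)
      also have "\<dots> = (\<Sum>b\<in>(Basis :: (real ^ 'd) set). norm ((inv Q ^^ n) b)) * norm x"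
        by (simp add: sum_distrib_left mult.commute)
      also have "\<dots> \<le> e * norm x" using elim by (intro mult_right_mono) auto
      finally show "norm ((inv Q ^^ n) x) \<le> e * norm x" .
    qed
  qed
qed

section \<open>Volume under linear maps\<close>

lemma bij_linear_image_borel:
  fixes f :: "'a::euclidean_space \<Rightarrow> 'a"
  assumes "linear f" "bij f" "S \<in> sets borel"
  shows "f ` S \<in> sets borel"
proof -
  have "linear (inv f)" using assms by (simp add: inj_linear_imp_inv_linear bij_is_inj)
  then have "inv f \<in> borel_measurable borel"
    by (intro borel_measurable_continuous_onI linear_continuous_on) (simp add: linear_linear)
  then have "inv f -` S \<inter> space borel \<in> sets borel" using assms(3) by (rule measurable_sets)
  then show ?thesis using assms(2) by (simp add: bij_vimage_eq_inv_image inv_inv_eq bij_imp_bij_inv)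
qed

lemma nn_integral_lborel_translation:
  fixes f :: "'a::euclidean_space \<Rightarrow> ennreal"
  assumes [measurable]: "f \<in> borel_measurable borel"
  shows "(\<integral>\<^sup>+ x. f (c + x) \<partial>lborel) = (\<integral>\<^sup>+ x. f x \<partial>lborel)"
proof -
  have "(\<integral>\<^sup>+ x. f x \<partial>lborel) = (\<integral>\<^sup>+ x. f x \<partial>distr lborel borel ((+) c))"
    by (simp add: lborel_distr_plus)
  also have "\<dots> = (\<integral>\<^sup>+ x. f (c + x) \<partial>lborel)"
    by (rule nn_integral_distr) simp_all
  finally show ?thesis by simp
qed

text \<open>Uniqueness of Haar measure, by computing the double integral of
  \<open>1\<^sub>S(f\<^sup>-\<^sup>1 x) 1\<^sub>U(y - f\<^sup>-\<^sup>1 x)\<close> in both orders.\<close>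

lemma emeasure_lborel_linear_image_exchange:
  fixes f :: "'a::euclidean_space \<Rightarrow> 'a"
  assumes lin: "linear f" and bij: "bij f" and [measurable]: "S \<in> sets borel" "U \<in> sets borel"
  shows "emeasure lborel (f ` S) * emeasure lborel U = emeasure lborel S * emeasure lborel (f ` (uminus ` U))"
proof -
  define g where "g = inv f"
  have g: "linear g" using assms by (simp add: g_def inj_linear_imp_inv_linear bij_is_inj)
  then have [measurable]: "g \<in> borel_measurable borel"
    by (intro borel_measurable_continuous_onI linear_continuous_on) (simp add: linear_linear)
  have gf: "g (f x) = x" for x using bij by (simp add: g_def bij_is_inj)
  have mem: "x \<in> f ` T \<longleftrightarrow> g x \<in> T" for x T
    using bij unfolding g_def by (metis bij_image_Collect_eq bij_inv_eq_iff image_iff)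
  have image: "emeasure lborel (f ` T) = (\<integral>\<^sup>+ x. indicator T (g x) \<partial>lborel)" if "T \<in> sets borel" for T
  proof -
    have "emeasure lborel (f ` T) = (\<integral>\<^sup>+ x. indicator (f ` T) x \<partial>lborel)"
      using bij_linear_image_borel[OF lin bij that] by simp
    also have "(\<lambda>x. indicator (f ` T) x :: ennreal) = (\<lambda>x. indicator T (g x))"
      by (auto simp: fun_eq_iff mem split: split_indicator)
    finally show ?thesis .
  qed
  have umU: "uminus ` U = uminus -` U" by force
  have U': "uminus ` U \<in> sets borel"
    unfolding umU using measurable_sets[of "uminus :: 'a \<Rightarrow> 'a" borel borel U] by simp
  have "emeasure lborel (f ` S) * emeasure lborel U
      = (\<integral>\<^sup>+ x. indicator S (g x) * (\<integral>\<^sup>+ y. indicator U y \<partial>lborel) \<partial>lborel)"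
    by (simp add: image nn_integral_multc)
  also have "\<dots> = (\<integral>\<^sup>+ x. \<integral>\<^sup>+ y. indicator S (g x) * indicator U (y - g x) \<partial>lborel \<partial>lborel)"
  proof (intro nn_integral_cong)
    fix x :: 'a
    have "(\<integral>\<^sup>+ y. indicator U y \<partial>lborel) = (\<integral>\<^sup>+ y. indicator U (y - g x) \<partial>lborel :: ennreal)"
      using nn_integral_lborel_translation[of "indicator U" "- g x"] by simp
    then show "indicator S (g x) * (\<integral>\<^sup>+ y. indicator U y \<partial>lborel)
      = (\<integral>\<^sup>+ y. indicator S (g x) * indicator U (y - g x) \<partial>lborel :: ennreal)"
      by (subst nn_integral_cmult) auto
  qed
  also have "\<dots> = (\<integral>\<^sup>+ y. \<integral>\<^sup>+ x. indicator S (g x) * indicator U (y - g x) \<partial>lborel \<partial>lborel)"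
    by (rule lborel_pair.Fubini') simp
  \<comment> \<open>Substituting f y + x for x turns g x into y + g x and y - g x into - g
    x.\<close>
  also have "\<dots> = (\<integral>\<^sup>+ y. \<integral>\<^sup>+ x. indicator S (y + g x) * indicator U (- g x) \<partial>lborel \<partial>lborel)"
  proof (rule nn_integral_cong)
    fix y :: 'a
    show "(\<integral>\<^sup>+ x. indicator S (g x) * indicator U (y - g x) \<partial>lborel)
      = (\<integral>\<^sup>+ x. indicator S (y + g x) * indicator U (- g x) \<partial>lborel :: ennreal)"
      using nn_integral_lborel_translation[of "\<lambda>x. indicator S (g x) * indicator U (y - g x)" "f y"]
      by (simp add: linear_add[OF g] gf)
  qed
  also have "\<dots> = (\<integral>\<^sup>+ x. \<integral>\<^sup>+ y. indicator S (y + g x) * indicator U (- g x) \<partial>lborel \<partial>lborel)"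
    by (rule lborel_pair.Fubini') simp
  also have "\<dots> = (\<integral>\<^sup>+ x. emeasure lborel S * indicator (uminus ` U) (g x) \<partial>lborel)"
  proof (intro nn_integral_cong)
    fix x :: 'a
    have "(\<integral>\<^sup>+ y. indicator S (y + g x) \<partial>lborel) = emeasure lborel S"
      using nn_integral_lborel_translation[of "indicator S" "g x"] by (simp add: add.commute)
    moreover have "indicator (uminus ` U) (g x) = (indicator U (- g x) :: ennreal)"
      unfolding umU by (simp split: split_indicator)
    ultimately show "(\<integral>\<^sup>+ y. indicator S (y + g x) * indicator U (- g x) \<partial>lborel)
      = emeasure lborel S * (indicator (uminus ` U) (g x) :: ennreal)"
      by (subst nn_integral_multc) auto
  qed
  also have "\<dots> = emeasure lborel S * emeasure lborel (f ` (uminus ` U))"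
    using U' by (simp add: image nn_integral_cmult)
  finally show ?thesis .
qed

lemma lmeasurable_bounded_borel:
  fixes S :: "'a::euclidean_space set"
  assumes "S \<in> sets borel" "bounded S" shows "S \<in> lmeasurable"
  using assms by (intro bounded_set_imp_lmeasurable) auto

lemma measure_open_pos:
  fixes S :: "'a::euclidean_space set"
  assumes "open S" "bounded S" "S \<noteq> {}" shows "measure lebesgue S > 0"
proof -
  obtain x e where e: "e > 0" "ball x e \<subseteq> S" using assms open_contains_ball by blast
  have "0 < measure lebesgue (ball x e)" using e by (simp add: content_ball_pos)
  also have "\<dots> \<le> measure lebesgue S"
    using assms e by (intro measure_mono_fmeasurable lmeasurable_bounded_borel) auto
  finally show ?thesis .
qed

text \<open>The unit ball is its own reflection, so inserting it for U in the exchange formula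
  leaves one constant for all S: the ratio of the volumes of its image and of the ball
  itself.\<close>

lemma linear_image_measure_scaling:
  fixes f :: "'a::euclidean_space \<Rightarrow> 'a"
  assumes lin: "linear f" and bij: "bij f"
  obtains c where "c > 0" "\<And>S. S \<in> sets borel \<Longrightarrow> bounded S \<Longrightarrow> measure lebesgue (f ` S) = c * measure lebesgue S"
proof -
  define U where "U = ball (0::'a) 1"
  have U: "uminus ` U = U"
  proof -
    have "x \<in> uminus ` U \<longleftrightarrow> x \<in> U" for x
      using image_eqI[of x uminus "- x" U] by (auto simp: U_def)
    then show ?thesis by blast
  qed
  have fU: "open (f ` U)" "bounded (f ` U)"
    using lin bij by (simp_all add: U_def open_surjective_linear_image bij_is_surj bounded_linear_image linear_linear)
  define c where "c = measure lebesgue (f ` U) / measure lebesgue U"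
  have pos: "measure lebesgue U > 0" by (simp add: U_def content_ball_pos)
  have "f ` U \<noteq> {}" by (auto simp: U_def)
  then have "measure lebesgue (f ` U) > 0"
    using fU by (intro measure_open_pos) auto
  then have c: "c > 0" using pos by (simp add: c_def)
  show ?thesis
  proof (rule that[OF c])
    fix S :: "'a set" assume S: "S \<in> sets borel" "bounded S"
    have fS: "f ` S \<in> sets borel" "bounded (f ` S)"
      using S lin bij by (simp_all add: bij_linear_image_borel bounded_linear_image linear_linear)
    have fin: "emeasure lborel T = ennreal (measure lebesgue T)" if "T \<in> sets borel" "bounded T" for T :: "'a set"
      using that emeasure_bounded_finite[of T] by (simp add: emeasure_eq_ennreal_measure)
    have "measure lebesgue (f ` S) * measure lebesgue U = measure lebesgue S * measure lebesgue (f ` U)"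
      using emeasure_lborel_linear_image_exchange[OF lin bij S(1), of U] S fS fU
      by (simp add: U fin borel_open ennreal_mult[symmetric]) (simp add: U_def fin ennreal_mult[symmetric])
    then show "measure lebesgue (f ` S) = c * measure lebesgue S"
      using pos by (simp add: c_def field_simps)
  qed
qed

lemma ball_subset_expanded_ball:
  fixes f :: "'a::real_normed_vector \<Rightarrow> 'a"
  assumes lin: "linear f" and bij: "bij f" and R: "R > 0"
    and inv: "\<And>x. norm (inv f x) \<le> e / R * norm x" and e: "e > 0"
  shows "ball (f y) R \<subseteq> f ` ball y e"
proof
  fix u assume u: "u \<in> ball (f y) R"
  have "inv f (u - f y) = inv f u - y"
    using lin bij by (metis bij_inv_eq_iff linear_diff)
  then have "norm (inv f u - y) \<le> e / R * norm (u - f y)" using inv by metis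
  also have "\<dots> < e / R * R" using u R e by (intro mult_strict_left_mono) (auto simp: dist_norm norm_minus_commute)
  finally have "inv f u \<in> ball y e" using R by (simp add: dist_norm norm_minus_commute)
  then show "u \<in> f ` ball y e" using bij by (metis bij_inv_eq_iff imageI)
qed

section \<open>Uniformly discrete sets and Baire category\<close>

lemma uniform_discrete_finite_Int_bounded:
  fixes S :: "'a::heine_borel set"
  assumes "uniform_discrete S" "bounded B" shows "finite (S \<inter> B)"
  using assms uniform_discrete_finite_iff[of "S \<inter> B"] by (meson bounded_Int inf_le1 uniform_discrete_subset)

lemma uniform_discrete_countable:
  fixes S :: "'a::{heine_borel, real_normed_vector} set"
  assumes "uniform_discrete S" shows "countable S"
proof -
  have "S \<subseteq> (\<Union>n::nat. S \<inter> ball 0 (real n))"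
    using reals_Archimedean2 by fastforce
  moreover have "countable (\<Union>n::nat. S \<inter> ball 0 (real n))"
    using uniform_discrete_finite_Int_bounded[OF assms bounded_ball] by (intro countable_UN) (auto intro: countable_finite)
  ultimately show ?thesis by (rule countable_subset)
qed

text \<open>Were all complements dense, Baire would make their intersection dense, whereas the
  covering makes it empty.\<close>

lemma countable_closed_cover_interior:
  fixes F :: "'a::{real_normed_vector,heine_borel} set set"
  assumes "countable F" "\<And>S. S \<in> F \<Longrightarrow> closed S" "\<Union>F = UNIV"
  shows "\<exists>S\<in>F. interior S \<noteq> {}"
proof (rule ccontr)
  assume "\<not> ?thesis"
  then have "UNIV \<subseteq> closure (\<Inter>(uminus ` F))"
    using assms by (intro Baire) (auto simp: closure_complement)
  moreover have "\<Inter>(uminus ` F) = {}" using assms(3) by auto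
  ultimately show False by simp
qed

section \<open>Digits and supertiles\<close>

text \<open>The digits of the n-th power of the substitution, with j the colour of the ancestor and
  i that of the descendant.\<close>

primrec digits ::
  "(real ^ 'd \<Rightarrow> real ^ 'd) \<Rightarrow> ('k \<Rightarrow> 'k \<Rightarrow> (real ^ 'd) set) \<Rightarrow> nat \<Rightarrow> 'k \<Rightarrow> 'k \<Rightarrow> (real ^ 'd::finite) set" where
  "digits Q D 0 = (\<lambda>i j. if i = j then {0} else {})"
| "digits Q D (Suc n) = (\<lambda>i j. {Q d + a |d a l. d \<in> digits Q D n l j \<and> a \<in> D i l})"

lemma digits_add:
  assumes "linear Q"
  shows "digits Q D (m + n) i j = {(Q ^^ m) e + d |e d l. d \<in> digits Q D m i l \<and> e \<in> digits Q D n l j}"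
proof (induction m arbitrary: i)
  case (Suc m)
  show ?case
  proof (intro set_eqI iffI)
    fix x assume "x \<in> digits Q D (Suc m + n) i j"
    then obtain e d l l' a where "d \<in> digits Q D m l l'" "e \<in> digits Q D n l' j" "a \<in> D i l"
      "x = Q ((Q ^^ m) e + d) + a" by (auto simp: Suc)
    then have "x = (Q ^^ Suc m) e + (Q d + a)" "Q d + a \<in> digits Q D (Suc m) i l'"
      using linear_add[OF assms] by (auto simp: add.assoc)
    with \<open>e \<in> digits Q D n l' j\<close>
    show "x \<in> {(Q ^^ Suc m) e + d |e d l. d \<in> digits Q D (Suc m) i l \<and> e \<in> digits Q D n l j}" by blast
  next
    fix x assume "x \<in> {(Q ^^ Suc m) e + d |e d l. d \<in> digits Q D (Suc m) i l \<and> e \<in> digits Q D n l j}"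
    then obtain e d l l' a where "d \<in> digits Q D m l l'" "e \<in> digits Q D n l' j" "a \<in> D i l"
      "x = (Q ^^ Suc m) e + (Q d + a)" by auto
    then have "x = Q ((Q ^^ m) e + d) + a" "(Q ^^ m) e + d \<in> digits Q D (m + n) l j"
      using linear_add[OF assms] by (auto simp: add.assoc Suc)
    with \<open>a \<in> D i l\<close> show "x \<in> digits Q D (Suc m + n) i j" by auto
  qed
qed auto

text \<open>A nonzero entry of a matrix product has a nonzero summand, and these summands trace a
  chain of nonempty digit sets from j to i. Coincidences between digit sums along different chains
  are harmless in this direction.\<close>

lemma matrix_power_nonzero_imp_digits:
  assumes "((**) (substitution_matrix D) ^^ n) (mat 1) $ i $ j \<noteq> 0"
  shows "digits Q D n i j \<noteq> {}"
  using assms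
proof (induction n arbitrary: i)
  case 0
  then show ?case by (simp add: mat_def split: if_splits)
next
  case (Suc n)
  let ?M = "((**) (substitution_matrix D) ^^ n) (mat 1)"
  have "(substitution_matrix D ** ?M) $ i $ j = (\<Sum>l\<in>UNIV. card (D i l) * ?M $ l $ j)"
    unfolding matrix_matrix_mult_def by (simp add: substitution_matrix_def)
  then have "(\<Sum>l\<in>UNIV. card (D i l) * ?M $ l $ j) \<noteq> 0" using Suc.prems by simp
  then have "\<exists>l. card (D i l) * ?M $ l $ j \<noteq> 0" by (meson sum.not_neutral_contains_not_neutral)
  then obtain l where "card (D i l) \<noteq> 0" "((**) (substitution_matrix D) ^^ n) (mat 1) $ l $ j \<noteq> 0"
    by auto
  then have "D i l \<noteq> {}" "digits Q D n l j \<noteq> {}" using Suc.IH by auto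
  then show ?case by auto
qed

text \<open>A point of S that is extremal in the direction x - y would be moved further in that
  direction within S. For prototiles this means that a tile determines its position.\<close>

lemma compact_translation_inj:
  fixes S :: "'a::euclidean_space set"
  assumes "compact S" "S \<noteq> {}" "(+) x ` S = (+) y ` S" shows "x = y"
proof (rule ccontr)
  assume "x \<noteq> y"
  define v where "v = x - y"
  have v: "v \<noteq> 0" using \<open>x \<noteq> y\<close> by (simp add: v_def)
  obtain s where s: "s \<in> S" "\<And>t. t \<in> S \<Longrightarrow> v \<bullet> t \<le> v \<bullet> s"
    using continuous_attains_sup[OF assms(1,2), of "\<lambda>t. v \<bullet> t"] continuous_on_inner[OF continuous_on_const continuous_on_id]
    by blast
  have "x + s \<in> (+) y ` S" using s(1) assms(3) by blast
  then have "v + s \<in> S" unfolding v_def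
    by (smt (verit) add.commute add_diff_eq add_left_imp_eq diff_add_cancel imageE)
  then have "v \<bullet> (v + s) \<le> v \<bullet> s" by (rule s(2))
  then have "v \<bullet> v \<le> 0" by (simp add: inner_add_right)
  then show False using v by (metis inner_gt_zero_iff not_le)
qed

locale substitution_tiling =
  fixes \<Lambda> :: "('d::finite, 'k::finite) kset"
    and Q :: "real ^ 'd \<Rightarrow> real ^ 'd"
    and D :: "'k \<Rightarrow> 'k \<Rightarrow> (real ^ 'd) set"
    and A :: "'k \<Rightarrow> (real ^ 'd) set"
  assumes substitution: "substitution_delone Q D \<Lambda>"
    and prim: "primitive (substitution_matrix D)"
    and prototiles: "prototile_supports Q D A"
    and rep: "representable A \<Lambda>"
begin

abbreviation digit_set ("\<D>") where "\<D> \<equiv> digits Q D"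

lemma expansive_Q: "expansive Q" and finite_D: "finite (D i j)"
  and uniform_discrete_\<Lambda>: "uniform_discrete (\<Lambda> i)"
  and \<Lambda>_eq: "\<Lambda> i = (\<Union>j. \<Union>a\<in>D i j. (\<lambda>x. Q x + a) ` \<Lambda> j)"
  using substitution unfolding substitution_delone_def delone_kset_def delone_def by blast+

lemma A_nonempty: "A j \<noteq> {}" and compact_A: "compact (A j)"
  and Q_A: "Q ` A j = (\<Union>i. \<Union>a\<in>D i j. (+) a ` A i)"
  using prototiles by (auto simp: prototile_supports_def)

lemma linear_Q: "linear Q" by (rule expansive_linear[OF expansive_Q])

lemma linear_Qn: "linear (Q ^^ n)" by (rule linear_funpow[OF linear_Q])

lemma bij_Qn: "bij (Q ^^ n)" by (rule bij_betw_funpow[OF expansive_bij[OF expansive_Q]])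

lemma Qn_add: "(Q ^^ n) (x + y) = (Q ^^ n) x + (Q ^^ n) y"
  by (rule linear_add[OF linear_Qn])

lemma finite_digits: "finite (\<D> n i j)"
proof (induction n arbitrary: i)
  case (Suc n)
  have "\<D> (Suc n) i j = (\<Union>l. \<Union>d\<in>\<D> n l j. \<Union>a\<in>D i l. {Q d + a})" by auto
  with Suc finite_D show ?case by simp
qed auto

lemma mem_\<Lambda>_digits: "u \<in> \<Lambda> i \<longleftrightarrow> (\<exists>j x d. x \<in> \<Lambda> j \<and> d \<in> \<D> n i j \<and> u = (Q ^^ n) x + d)"
proof (induction n arbitrary: i u)
  case (Suc n)
  define R where "R v l \<longleftrightarrow> (\<exists>j x d. x \<in> \<Lambda> j \<and> d \<in> \<D> n l j \<and> v = (Q ^^ n) x + d)" for v l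
  have R: "v \<in> \<Lambda> l \<longleftrightarrow> R v l" for v l unfolding R_def by (rule Suc)
  have "u \<in> \<Lambda> i \<longleftrightarrow> (\<exists>l v a. v \<in> \<Lambda> l \<and> a \<in> D i l \<and> u = Q v + a)"
    by (subst \<Lambda>_eq) blast
  also have "\<dots> \<longleftrightarrow> (\<exists>l v a. R v l \<and> a \<in> D i l \<and> u = Q v + a)"
    by (simp only: R)
  also have "\<dots> \<longleftrightarrow> (\<exists>l j x d a. x \<in> \<Lambda> j \<and> d \<in> \<D> n l j \<and> a \<in> D i l \<and> u = Q ((Q ^^ n) x + d) + a)"
    unfolding R_def by blast
  also have "\<dots> \<longleftrightarrow> (\<exists>l j x d a. x \<in> \<Lambda> j \<and> d \<in> \<D> n l j \<and> a \<in> D i l \<and> u = (Q ^^ Suc n) x + (Q d + a))"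
    by (simp add: linear_add[OF linear_Q] add.assoc)
  also have "\<dots> \<longleftrightarrow> (\<exists>j x d. x \<in> \<Lambda> j \<and> d \<in> \<D> (Suc n) i j \<and> u = (Q ^^ Suc n) x + d)"
    unfolding digits.simps by blast
  finally show ?case .
qed (auto split: if_splits)

lemma digit_in_\<Lambda>: "x \<in> \<Lambda> j \<Longrightarrow> d \<in> \<D> n i j \<Longrightarrow> (Q ^^ n) x + d \<in> \<Lambda> i"
  using mem_\<Lambda>_digits by blast

lemma mem_A_digits: "u \<in> (Q ^^ n) ` A j \<longleftrightarrow> (\<exists>i d. d \<in> \<D> n i j \<and> u \<in> (+) d ` A i)"
proof (induction n arbitrary: u)
  case (Suc n)
  have QA: "w \<in> Q ` A l \<longleftrightarrow> (\<exists>i a. a \<in> D i l \<and> w \<in> (+) a ` A i)" for w l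
    unfolding Q_A by blast
  have "u \<in> (Q ^^ Suc n) ` A j \<longleftrightarrow> (\<exists>v. v \<in> (Q ^^ n) ` A j \<and> u = Q v)" by auto
  also have "\<dots> \<longleftrightarrow> (\<exists>l d w. d \<in> \<D> n l j \<and> w \<in> Q ` A l \<and> u = Q d + w)"
    unfolding Suc by (force simp: linear_add[OF linear_Q])
  also have "\<dots> \<longleftrightarrow> (\<exists>l d i a. d \<in> \<D> n l j \<and> a \<in> D i l \<and> u \<in> (+) (Q d + a) ` A i)"
    unfolding QA by (force simp: add.assoc)
  also have "\<dots> \<longleftrightarrow> (\<exists>i d. d \<in> \<D> (Suc n) i j \<and> u \<in> (+) d ` A i)"
    unfolding digits.simps by blast
  finally show ?case .
qed (auto split: if_splits)

lemma digit_tile_subset: "d \<in> \<D> n i j \<Longrightarrow> (+) d ` A i \<subseteq> (Q ^^ n) ` A j"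
  using mem_A_digits by blast

lemma primitive_digits: obtains p where "\<And>i j. \<D> p i j \<noteq> {}"
  using prim matrix_power_nonzero_imp_digits[where D = D and Q = Q] unfolding primitive_def by metis

lemma tiles_cover: "\<exists>i x. x \<in> \<Lambda> i \<and> p \<in> (+) x ` A i"
proof -
  have "p \<in> (\<Union>T\<in>tiles_of A \<Lambda>. fst T)" using rep by (simp add: representable_def)
  then show ?thesis by (auto simp: tiles_of_def translate_tile_def prototile_def)
qed

text \<open>Non-overlap is a property of a set of tiles, so distinct coloured points must first be
  seen to carry distinct tiles; for equal colours this is injectivity of translation on compact
  sets.\<close>

lemma tiles_interior_disjoint:
  assumes "x \<in> \<Lambda> i" "y \<in> \<Lambda> j" "(x, i) \<noteq> (y, j)"
  shows "(+) x ` interior (A i) \<inter> (+) y ` interior (A j) = {}"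
proof -
  let ?T = "translate_tile x (prototile A i)" and ?T' = "translate_tile y (prototile A j)"
  have "?T \<in> tiles_of A \<Lambda>" "?T' \<in> tiles_of A \<Lambda>" using assms by (auto simp: tiles_of_def)
  moreover have "?T \<noteq> ?T'"
    using assms(3) compact_translation_inj[OF compact_A A_nonempty]
    by (auto simp: translate_tile_def prototile_def)
  ultimately show ?thesis
    using rep unfolding representable_def non_overlapping_def pairwise_def
    by (force simp: translate_tile_def prototile_def interior_translation)
qed

text \<open>The support of a level-n supertile with its control point at the origin; the one
  belonging to a point x of \<open>\<Lambda> j\<close> is its translate by
  \<open>(Q ^^ n) x\<close>.\<close>

definition supertile :: "nat \<Rightarrow> 'k \<Rightarrow> (real ^ 'd) set" where
  "supertile n j = (Q ^^ n) ` A j"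

lemma compact_supertile: "compact (supertile n j)"
  unfolding supertile_def
  by (intro compact_continuous_image compact_A linear_continuous_on) (simp add: linear_Qn linear_linear)

lemma interior_supertile: "interior (supertile n j) = (Q ^^ n) ` interior (A j)"
  unfolding supertile_def by (rule interior_injective_linear_image[OF linear_Qn bij_is_inj[OF bij_Qn]])

lemma supertiles_cover: "\<exists>i x. x \<in> \<Lambda> i \<and> p \<in> (+) ((Q ^^ n) x) ` supertile n i"
proof -
  obtain p' where p': "p = (Q ^^ n) p'" using bij_Qn by (metis bij_pointE)
  obtain i x where "x \<in> \<Lambda> i" "p' \<in> (+) x ` A i" using tiles_cover by blast
  then show ?thesis unfolding p' supertile_def by (force simp: Qn_add)
qed

lemma supertiles_interior_disjoint:
  assumes "x \<in> \<Lambda> i" "y \<in> \<Lambda> j" "(x, i) \<noteq> (y, j)"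
  shows "(+) ((Q ^^ n) x) ` interior (supertile n i) \<inter> (+) ((Q ^^ n) y) ` interior (supertile n j) = {}"
proof -
  have "(+) ((Q ^^ n) u) ` interior (supertile n l) = (Q ^^ n) ` (+) u ` interior (A l)" for u l
    unfolding interior_supertile by (auto simp: image_image Qn_add)
  then show ?thesis
    using tiles_interior_disjoint[OF assms] bij_Qn
    by (metis bij_is_inj image_Int image_empty)
qed

text \<open>Countably many translated prototiles cover the space, so Baire gives one prototile with
  interior. By primitivity a copy of it lies in a supertile of every type, and interiors correspond
  under the linear bijection \<open>Q ^^ p\<close>.\<close>

lemma interior_A_nonempty: "interior (A j) \<noteq> {}"
proof -
  let ?F = "\<Union>i. (\<lambda>x. (+) x ` A i) ` \<Lambda> i"
  have "\<exists>S\<in>?F. interior S \<noteq> {}"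
  proof (rule countable_closed_cover_interior)
    show "countable ?F"
      using uniform_discrete_countable[OF uniform_discrete_\<Lambda>] by (intro countable_UN) auto
    show "closed S" if "S \<in> ?F" for S
      using that compact_A by (auto intro!: compact_imp_closed compact_translation)
    have "p \<in> \<Union>?F" for p
    proof -
      obtain i x where "x \<in> \<Lambda> i" "p \<in> (+) x ` A i" using tiles_cover by blast
      moreover from this have "(+) x ` A i \<in> ?F" by blast
      ultimately show ?thesis by (meson UnionI)
    qed
    then show "\<Union>?F = UNIV" by blast
  qed
  then obtain i where i: "interior (A i) \<noteq> {}" by (auto simp: interior_translation)
  obtain p where p: "\<And>i j. \<D> p i j \<noteq> {}" using primitive_digits by metis
  then obtain d where "d \<in> \<D> p i j" by blast
  then have "interior ((+) d ` A i) \<subseteq> interior (supertile p j)"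
    unfolding supertile_def by (intro interior_mono digit_tile_subset)
  then show ?thesis using i unfolding interior_supertile interior_translation by blast
qed

lemma tile_radius: obtains r where "r > 0" "\<And>i. A i \<subseteq> ball 0 r"
proof -
  have "bounded (\<Union>i. A i)" using compact_A by (simp add: bounded_UN compact_imp_bounded)
  then obtain r where "r > 0" "(\<Union>i. A i) \<subseteq> ball 0 r" using bounded_subset_ballD by blast
  then show ?thesis using that by blast
qed

text \<open>Uniform contraction of the inverse powers: pulled back by n levels, a fixed radius R
  becomes smaller than e.\<close>

lemma ball_subset_Qn_ball:
  assumes "e > 0" "R > 0"
  shows "\<forall>\<^sub>F n in sequentially. \<forall>y. ball ((Q ^^ n) y) R \<subseteq> (Q ^^ n) ` ball y e"
proof -
  have "\<forall>\<^sub>F n in sequentially. \<forall>x. norm ((inv Q ^^ n) x) \<le> e / R * norm x"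
    using assms by (intro expansive_inv_uniform[OF expansive_Q]) simp
  then show ?thesis
  proof eventually_elim
    case (elim n)
    have "inv (Q ^^ n) = inv Q ^^ n"
      using expansive_bij[OF expansive_Q] by (simp add: inv_fn)
    then show ?case
      using ball_subset_expanded_ball[OF linear_Qn bij_Qn assms(2) _ assms(1)] elim by metis
  qed
qed

end

section \<open>Null boundaries and locality\<close>

lemma finite_measure_disjoint_le:
  fixes F :: "'i \<Rightarrow> 'a::euclidean_space set"
  assumes "finite I" "\<And>i. i \<in> I \<Longrightarrow> F i \<in> lmeasurable" "disjoint_family_on F I"
    "(\<Union>i\<in>I. F i) \<subseteq> T" "T \<in> lmeasurable"
  shows "(\<Sum>i\<in>I. measure lebesgue (F i)) \<le> measure lebesgue T"
proof -
  have "(\<Sum>i\<in>I. measure lebesgue (F i)) = measure lebesgue (\<Union>i\<in>I. F i)"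
    using assms by (intro measure_UNION'[symmetric]) (auto simp: pairwise_def disjnt_def disjoint_family_on_def)
  also have "\<dots> \<le> measure lebesgue T"
    using assms by (intro measure_mono_fmeasurable) (auto intro!: sets.finite_UN)
  finally show ?thesis .
qed

lemma finite_measure_cover_le:
  fixes F :: "'i \<Rightarrow> 'a::euclidean_space set"
  assumes "finite I" "\<And>i. i \<in> I \<Longrightarrow> F i \<in> lmeasurable" "T \<subseteq> (\<Union>i\<in>I. F i)" "T \<in> sets lebesgue"
  shows "measure lebesgue T \<le> (\<Sum>i\<in>I. measure lebesgue (F i))"
proof -
  have "measure lebesgue T \<le> measure lebesgue (\<Union>i\<in>I. F i)"
    using assms by (intro measure_mono_fmeasurable) (auto intro!: fmeasurable.finite_UN)
  also have "\<dots> \<le> (\<Sum>i\<in>I. measure lebesgue (F i))"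
    using assms by (intro measure_UNION_le) auto
  finally show ?thesis .
qed

text \<open>The complement is the union of the balls of radius R about the points outside F, hence
  open whatever F is.\<close>

lemma closed_inner_parallel_set:
  fixes F :: "'a::euclidean_space set" shows "closed {h. ball h R \<subseteq> F}"
proof -
  have "{h. ball h R \<subseteq> F} = - (\<Union>y\<in>-F. ball y R)" by (auto simp: dist_commute)
  then show ?thesis by auto
qed

context substitution_tiling
begin

text \<open>This is |det Q|, characterised by its effect on volumes.\<close>

definition theta :: real where
  "theta = (SOME c. c > 0 \<and> (\<forall>S\<in>sets borel. bounded S \<longrightarrow> measure lebesgue (Q ` S) = c * measure lebesgue S))"

lemma theta: "theta > 0" "S \<in> sets borel \<Longrightarrow> bounded S \<Longrightarrow> measure lebesgue (Q ` S) = theta * measure lebesgue S"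
proof -
  obtain c where "c > 0" "\<And>S. S \<in> sets borel \<Longrightarrow> bounded S \<Longrightarrow> measure lebesgue (Q ` S) = c * measure lebesgue S"
    using linear_image_measure_scaling[OF linear_Q expansive_bij[OF expansive_Q]] by metis
  then have "\<exists>c. c > 0 \<and> (\<forall>S\<in>sets borel. bounded S \<longrightarrow> measure lebesgue (Q ` S) = c * measure lebesgue S)"
    by blast
  from someI_ex[OF this, folded theta_def]
  show "theta > 0" "S \<in> sets borel \<Longrightarrow> bounded S \<Longrightarrow> measure lebesgue (Q ` S) = theta * measure lebesgue S"
    by auto
qed

lemma Qn_image_borel: "S \<in> sets borel \<Longrightarrow> (Q ^^ n) ` S \<in> sets borel"
  by (rule bij_linear_image_borel[OF linear_Qn bij_Qn])

lemma Qn_image_bounded: "bounded S \<Longrightarrow> bounded ((Q ^^ n) ` S)"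
  by (rule bounded_linear_image) (simp_all add: linear_Qn linear_linear)

lemma measure_Qn_image:
  assumes "S \<in> sets borel" "bounded S"
  shows "measure lebesgue ((Q ^^ n) ` S) = theta ^ n * measure lebesgue S"
proof (induction n)
  case (Suc n)
  have "measure lebesgue ((Q ^^ Suc n) ` S) = measure lebesgue (Q ` (Q ^^ n) ` S)"
    by (simp add: image_comp)
  also have "\<dots> = theta * measure lebesgue ((Q ^^ n) ` S)"
    using assms by (intro theta(2) Qn_image_borel Qn_image_bounded)
  finally show ?case using Suc by simp
qed simp

definition inner_vol :: "'k \<Rightarrow> real" where "inner_vol j = measure lebesgue (interior (A j))"

lemma bounded_A: "bounded (A j)" by (rule compact_imp_bounded[OF compact_A])

lemma bounded_interior_A: "bounded (interior (A j))"
  by (rule bounded_subset[OF bounded_A interior_subset])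

lemma borel_A: "A j \<in> sets borel"
  by (intro borel_closed compact_imp_closed compact_A)

lemma inner_vol_pos: "inner_vol j > 0"
  unfolding inner_vol_def by (intro measure_open_pos bounded_interior_A interior_A_nonempty) simp

lemma boundary_A: "A j - interior (A j) \<in> sets borel" "bounded (A j - interior (A j))"
  using borel_A[of j] bounded_subset[OF bounded_A[of j], of "A j - interior (A j)"] by auto

lemma lmeasurable_A: "A j \<in> lmeasurable" "interior (A j) \<in> lmeasurable" "A j - interior (A j) \<in> lmeasurable"
  by (intro lmeasurable_bounded_borel borel_A bounded_A bounded_interior_A boundary_A borel_open open_interior)+

lemma \<Lambda>_nonempty: "\<Lambda> i \<noteq> {}"
proof -
  have "delone_kset \<Lambda>"
    using substitution unfolding substitution_delone_def by (rule conjunct1)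
  then have "relatively_dense (\<Lambda> i)" by (simp add: delone_kset_def delone_def)
  then show ?thesis unfolding relatively_dense_def by (metis empty_iff)
qed

text \<open>A point x of \<open>\<Lambda> j\<close> turns digit tiles into tiles of the tiling, at
  \<open>(Q ^^ n) x + d\<close>, where disjointness is known.\<close>

lemma digit_tiles_interior_disjoint:
  assumes "d \<in> \<D> n i j" "d' \<in> \<D> n i' j" "(i, d) \<noteq> (i', d')"
  shows "(+) d ` interior (A i) \<inter> (+) d' ` interior (A i') = {}"
proof -
  obtain x where x: "x \<in> \<Lambda> j" using \<Lambda>_nonempty by blast
  let ?x = "(Q ^^ n) x"
  have "(+) (?x + d) ` interior (A i) \<inter> (+) (?x + d') ` interior (A i') = {}"
    using digit_in_\<Lambda>[OF x] assms by (intro tiles_interior_disjoint) auto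
  moreover have "(+) (?x + e) ` S = (+) ?x ` (+) e ` S" for e S
    by (simp add: image_image add.assoc)
  ultimately have "(+) ?x ` ((+) d ` interior (A i) \<inter> (+) d' ` interior (A i')) = {}"
    by (simp add: image_Int)
  then show ?thesis by simp
qed

text \<open>If \<open>b\<^sub>j\<close> is the measure of the boundary and \<open>w\<^sub>j\<close> that of the interior of \<open>A\<^sub>j\<close>, then
  \<open>w\<close> is superharmonic and \<open>b\<close> is subharmonic for the digit counts, and \<open>b\<close> strictly so at \<open>j\<close>
  once some tile of level \<open>K\<close> lies inside the expanded interior.  A maximal ratio
  \<open>b\<^sub>j / w\<^sub>j\<close> therefore vanishes.\<close>

lemma measure_boundary_A: "measure lebesgue (A j - interior (A j)) = 0"
proof -
  define b where "b i = measure lebesgue (A i - interior (A i))" for i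
  define \<rho> where "\<rho> = Max (range (\<lambda>i. b i / inner_vol i))"
  have "\<rho> \<in> range (\<lambda>i. b i / inner_vol i)" unfolding \<rho>_def by (rule Max_in) auto
  then obtain l where l: "\<rho> = b l / inner_vol l" by auto
  have le: "b i \<le> \<rho> * inner_vol i" for i
  proof -
    have "b i / inner_vol i \<le> \<rho>" unfolding \<rho>_def by (rule Max_ge) auto
    then show ?thesis using inner_vol_pos[of i] by (simp add: pos_divide_le_eq)
  qed
  have "\<rho> \<le> 0"
  proof (rule ccontr)
    assume "\<not> \<rho> \<le> 0"
    then have \<rho>: "\<rho> > 0" by simp
    obtain y e where e: "e > 0" "ball y e \<subseteq> A l"
      using interior_A_nonempty[of l] by (metis ex_in_conv mem_interior)
    obtain r where r: "r > 0" "\<And>i. A i \<subseteq> ball 0 r" using tile_radius by blast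
    \<comment> \<open>The radius 2 r exceeds the diameter of every prototile, so a tile through the
      centre of the ball fits into it.\<close>
    obtain K where K: "ball ((Q ^^ K) y) (2 * r) \<subseteq> (Q ^^ K) ` ball y e"
      using eventually_happens[OF ball_subset_Qn_ball[OF e(1), of "2 * r"]] r(1) by fastforce
    also have "\<dots> \<subseteq> supertile K l" unfolding supertile_def using e by (intro image_mono)
    finally have inner: "ball ((Q ^^ K) y) (2 * r) \<subseteq> interior (supertile K l)"
      by (intro interior_maximal) auto
    have "(Q ^^ K) y \<in> (Q ^^ K) ` A l" using e by (intro imageI) auto
    then obtain i0 d0 where d0: "d0 \<in> \<D> K i0 l" "(Q ^^ K) y \<in> (+) d0 ` A i0"
      unfolding mem_A_digits by blast
    have "(+) d0 ` A i0 \<subseteq> ball ((Q ^^ K) y) (2 * r)"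
    proof
      fix u assume "u \<in> (+) d0 ` A i0"
      then obtain s t where "u = d0 + s" "(Q ^^ K) y = d0 + t" "s \<in> A i0" "t \<in> A i0"
        using d0 by auto
      moreover from this have "norm s < r" "norm t < r" using r(2)[of i0] by force+
      ultimately show "u \<in> ball ((Q ^^ K) y) (2 * r)"
        using norm_triangle_ineq4[of t s] by (simp add: dist_norm)
    qed
    with inner have inside: "(+) d0 ` A i0 \<subseteq> interior (supertile K l)" by blast
    define P where "P = (SIGMA i:UNIV. \<D> K i l)"
    have P: "finite P" "(i0, d0) \<in> P" using finite_digits d0 by (auto simp: P_def)
    have "(\<Sum>(i, d)\<in>P. inner_vol i) = (\<Sum>p\<in>P. measure lebesgue ((+) (snd p) ` interior (A (fst p))))"
      by (intro sum.cong) (auto simp: inner_vol_def measure_translation)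
    also have "\<dots> \<le> measure lebesgue (interior (supertile K l))"
    proof (rule finite_measure_disjoint_le[OF P(1)])
      show "disjoint_family_on (\<lambda>p. (+) (snd p) ` interior (A (fst p))) P"
        using digit_tiles_interior_disjoint unfolding P_def disjoint_family_on_def by fastforce
      have "interior ((+) d ` A i) \<subseteq> interior (supertile K l)" if "d \<in> \<D> K i l" for d i
        using that unfolding supertile_def by (intro interior_mono digit_tile_subset)
      then show "(\<Union>p\<in>P. (+) (snd p) ` interior (A (fst p))) \<subseteq> interior (supertile K l)"
        by (force simp: P_def interior_translation)
      show "interior (supertile K l) \<in> lmeasurable"
        using bounded_subset[OF compact_imp_bounded[OF compact_supertile] interior_subset]
        by (intro lmeasurable_bounded_borel borel_open open_interior)
    qed (auto intro: measurable_translation lmeasurable_A)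
    also have "\<dots> = theta ^ K * inner_vol l"
      unfolding interior_supertile inner_vol_def by (intro measure_Qn_image bounded_interior_A) auto
    finally have w: "(\<Sum>(i, d)\<in>P. inner_vol i) \<le> theta ^ K * inner_vol l" .
    have "theta ^ K * b l = measure lebesgue ((Q ^^ K) ` (A l - interior (A l)))"
      unfolding b_def by (intro measure_Qn_image[symmetric] boundary_A)
    also have "(Q ^^ K) ` (A l - interior (A l)) = supertile K l - interior (supertile K l)"
      using interior_supertile[of K l] bij_Qn by (simp add: supertile_def image_set_diff bij_is_inj)
    \<comment> \<open>The tile (i0, d0) lies in the interior of the supertile and misses its
      boundary; leaving it out makes the estimate strict.\<close>
    also have "measure lebesgue \<dots> \<le> (\<Sum>p\<in>P - {(i0, d0)}. measure lebesgue ((+) (snd p) ` (A (fst p) - interior (A (fst p)))))"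
    proof (rule finite_measure_cover_le)
      show "supertile K l - interior (supertile K l)
        \<subseteq> (\<Union>p\<in>P - {(i0, d0)}. (+) (snd p) ` (A (fst p) - interior (A (fst p))))"
      proof
        fix u assume u: "u \<in> supertile K l - interior (supertile K l)"
        then obtain i d where d: "d \<in> \<D> K i l" "u \<in> (+) d ` A i"
          unfolding supertile_def using mem_A_digits by blast
        have "interior ((+) d ` A i) \<subseteq> interior (supertile K l)"
          using d unfolding supertile_def by (intro interior_mono digit_tile_subset)
        then have "u \<notin> (+) d ` interior (A i)" using u unfolding interior_translation by blast
        moreover have "(i, d) \<noteq> (i0, d0)" using u d inside by blast
        ultimately show "u \<in> (\<Union>p\<in>P - {(i0, d0)}. (+) (snd p) ` (A (fst p) - interior (A (fst p))))"
          using d unfolding P_def by (intro UN_I[of "(i, d)"]) auto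
      qed
      have "supertile K l - interior (supertile K l) \<in> sets borel"
        using compact_imp_closed[OF compact_supertile] by auto
      then show "supertile K l - interior (supertile K l) \<in> sets lebesgue" by auto
    qed (use P in \<open>auto intro: measurable_translation lmeasurable_A\<close>)
    also have "\<dots> = (\<Sum>(i, d)\<in>P - {(i0, d0)}. b i)"
      by (intro sum.cong) (auto simp: b_def measure_translation)
    also have "\<dots> \<le> (\<Sum>(i, d)\<in>P - {(i0, d0)}. \<rho> * inner_vol i)"
      by (intro sum_mono) (auto simp: le)
    also have "\<dots> = \<rho> * ((\<Sum>(i, d)\<in>P. inner_vol i) - inner_vol i0)"
      using P by (simp add: sum_diff1 sum_distrib_left[symmetric] split_def)
    also have "\<dots> \<le> \<rho> * (theta ^ K * inner_vol l - inner_vol i0)"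
      using \<rho> w by (intro mult_left_mono) auto
    also have "\<dots> < \<rho> * (theta ^ K * inner_vol l)"
      using \<rho> inner_vol_pos by (intro mult_strict_left_mono) auto
    also have "\<dots> = theta ^ K * b l" using l inner_vol_pos[of l] by simp
    finally show False by simp
  qed
  then have "b j \<le> 0" using le[of j] inner_vol_pos[of j] by (meson less_imp_le mult_nonpos_nonneg order_trans)
  then show ?thesis unfolding b_def by (simp add: antisym)
qed

lemma measure_A: "measure lebesgue (A j) = inner_vol j"
proof -
  have "measure lebesgue (A j - interior (A j)) = measure lebesgue (A j) - inner_vol j"
    unfolding inner_vol_def using lmeasurable_A
    by (intro measurable_measure_Diff) (auto simp: interior_subset)
  then show ?thesis using measure_boundary_A by simp
qed

text \<open>Pulled back by Q^n, the radius R drops below 1 / (k + 1) for large n, so the layer is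
  contained in the Q^n image of a fixed layer of the prototile. The fixed layers decrease to the
  null boundary, and k is chosen before n to bring their volume below \<epsilon>.\<close>

lemma supertile_boundary_layer:
  assumes "\<epsilon> > 0" "R > 0"
  shows "\<forall>\<^sub>F n in sequentially. \<forall>j.
    measure lebesgue (supertile n j - {h. ball h R \<subseteq> supertile n j}) \<le> \<epsilon> * theta ^ n"
proof -
  define B where "B j k = A j - {h. ball h (1 / real (Suc k)) \<subseteq> A j}" for j k
  have Bm: "B j k \<in> sets borel" "bounded (B j k)" for j k
    unfolding B_def
    by (intro sets.Diff borel_A borel_closed closed_inner_parallel_set)
      (rule bounded_subset[OF bounded_A Diff_subset])
  have INT: "(\<Inter>k. B j k) = A j - interior (A j)" for j
  proof -
    have "(\<exists>k. ball h (1 / real (Suc k)) \<subseteq> A j) \<longleftrightarrow> h \<in> interior (A j)" for h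
    proof
      assume "h \<in> interior (A j)"
      then obtain e where e: "e > 0" "ball h e \<subseteq> A j" by (auto simp: mem_interior)
      then obtain k where "1 / real (Suc k) < e" using nat_approx_posE by blast
      then have "ball h (1 / real (Suc k)) \<subseteq> ball h e" by (intro subset_ball) simp
      then show "\<exists>k. ball h (1 / real (Suc k)) \<subseteq> A j" using e by blast
    next
      assume "\<exists>k. ball h (1 / real (Suc k)) \<subseteq> A j"
      then obtain k where "ball h (1 / real (Suc k)) \<subseteq> A j" ..
      then show "h \<in> interior (A j)" unfolding mem_interior by (intro exI[of _ "1 / real (Suc k)"]) simp
    qed
    then show ?thesis unfolding B_def by blast
  qed
  have dec: "decseq (B j)" for j
  proof (rule decseq_SucI, rule subsetI)
    fix k h assume h: "h \<in> B j (Suc k)"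
    have "ball h (1 / real (Suc (Suc k))) \<subseteq> ball h (1 / real (Suc k))"
      by (intro subset_ball divide_left_mono) auto
    with h show "h \<in> B j k" unfolding B_def by blast
  qed
  have "(\<lambda>k. measure lebesgue (B j k)) \<longlonglongrightarrow> 0" for j
  proof -
    have "(\<lambda>k. measure lebesgue (B j k)) \<longlonglongrightarrow> measure lebesgue (\<Inter>k. B j k)"
      using lmeasurable_bounded_borel[OF Bm] dec
      by (intro Lim_measure_decseq) (auto simp del: emeasure_completion dest: fmeasurableD fmeasurableD2)
    then show ?thesis unfolding INT measure_boundary_A .
  qed
  then have "\<forall>\<^sub>F k in sequentially. \<forall>j. measure lebesgue (B j k) < \<epsilon>"
    using assms by (intro eventually_all_finite order_tendstoD(2)) auto
  then obtain k where k: "\<And>j. measure lebesgue (B j k) < \<epsilon>"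
    using eventually_happens by force
  have "\<forall>\<^sub>F n in sequentially. \<forall>y. ball ((Q ^^ n) y) R \<subseteq> (Q ^^ n) ` ball y (1 / real (Suc k))"
    by (rule ball_subset_Qn_ball) (use assms in auto)
  then show ?thesis
  proof eventually_elim
    case (elim n)
    show ?case
    proof
      fix j
      have sub: "supertile n j - {h. ball h R \<subseteq> supertile n j} \<subseteq> (Q ^^ n) ` B j k"
      proof
        fix u assume u: "u \<in> supertile n j - {h. ball h R \<subseteq> supertile n j}"
        then obtain y where y: "u = (Q ^^ n) y" "y \<in> A j" by (auto simp: supertile_def)
        have "\<not> ball y (1 / real (Suc k)) \<subseteq> A j"
        proof
          assume "ball y (1 / real (Suc k)) \<subseteq> A j"
          then have "(Q ^^ n) ` ball y (1 / real (Suc k)) \<subseteq> supertile n j"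
            unfolding supertile_def by (rule image_mono)
          with elim have "ball u R \<subseteq> supertile n j" unfolding y by blast
          with u show False by blast
        qed
        then show "u \<in> (Q ^^ n) ` B j k" using y by (auto simp: B_def)
      qed
      have "measure lebesgue (supertile n j - {h. ball h R \<subseteq> supertile n j}) \<le> measure lebesgue ((Q ^^ n) ` B j k)"
      proof (rule measure_mono_fmeasurable[OF sub])
        have "supertile n j - {h. ball h R \<subseteq> supertile n j} \<in> sets borel"
          by (intro sets.Diff borel_closed closed_inner_parallel_set compact_imp_closed compact_supertile)
        then show "supertile n j - {h. ball h R \<subseteq> supertile n j} \<in> sets lebesgue" by auto
        show "(Q ^^ n) ` B j k \<in> lmeasurable"
          using Bm by (intro lmeasurable_bounded_borel Qn_image_borel Qn_image_bounded)
      qed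
      also have "\<dots> = theta ^ n * measure lebesgue (B j k)" using Bm by (rule measure_Qn_image)
      also have "\<dots> \<le> theta ^ n * \<epsilon>" using k[of j] theta(1) by (intro mult_left_mono) auto
      finally show "measure lebesgue (supertile n j - {h. ball h R \<subseteq> supertile n j}) \<le> \<epsilon> * theta ^ n"
        by (simp add: mult.commute)
    qed
  qed
qed

text \<open>A tile of \<open>\<Lambda>\<close> inside a supertile of level \<open>n\<close> descends from it, since it also lies in the
  supertile of its own ancestor.\<close>

lemma supertile_locality:
  assumes r: "\<And>i. A i \<subseteq> ball 0 r" and x: "x \<in> \<Lambda> j"
    and ball: "ball g (\<rho> + r) \<subseteq> (+) ((Q ^^ n) x) ` supertile n j" and u: "u \<in> ball g \<rho>"
  shows "u \<in> \<Lambda> i \<longleftrightarrow> u - (Q ^^ n) x \<in> \<D> n i j"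
proof
  assume "u - (Q ^^ n) x \<in> \<D> n i j"
  then show "u \<in> \<Lambda> i" using digit_in_\<Lambda>[OF x] by fastforce
next
  assume "u \<in> \<Lambda> i"
  then obtain l y d where y: "y \<in> \<Lambda> l" and d: "d \<in> \<D> n i l" and eq: "u = (Q ^^ n) y + d"
    using mem_\<Lambda>_digits[of u i n] by blast
  have "(+) u ` A i \<subseteq> ball g (\<rho> + r)"
  proof
    fix v assume "v \<in> (+) u ` A i"
    then obtain a where "v = u + a" "norm a < r" using r by force
    then show "v \<in> ball g (\<rho> + r)"
      using u norm_triangle_ineq4[of "g - u" a] by (simp add: dist_norm algebra_simps)
  qed
  then have 1: "interior ((+) u ` A i) \<subseteq> interior ((+) ((Q ^^ n) x) ` supertile n j)"
    using ball by (intro interior_mono) blast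
  have "(+) u ` A i = (+) ((Q ^^ n) y) ` (+) d ` A i"
    unfolding eq by (simp add: image_image add.assoc)
  also have "\<dots> \<subseteq> (+) ((Q ^^ n) y) ` supertile n l"
    unfolding supertile_def using digit_tile_subset[OF d] by (rule image_mono)
  finally have 2: "interior ((+) u ` A i) \<subseteq> interior ((+) ((Q ^^ n) y) ` supertile n l)"
    by (rule interior_mono)
  have "interior ((+) u ` A i) \<noteq> {}" using interior_A_nonempty by (simp add: interior_translation)
  then have "(y, l) = (x, j)"
    using supertiles_interior_disjoint[OF x y, of n] 1 2 unfolding interior_translation by blast
  then show "u - (Q ^^ n) x \<in> \<D> n i j" using d eq by simp
qed

end

section \<open>Counting patterns in windows\<close>

lemma mem_shift: "y \<in> shift g \<Gamma> i \<longleftrightarrow> y + g \<in> \<Gamma> i"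
  unfolding shift_def by (metis (no_types, lifting) add_diff_cancel diff_add_cancel image_iff)

lemma shift_shift: "shift g (shift h \<Gamma>) = shift (g + h) \<Gamma>"
proof
  show "shift g (shift h \<Gamma>) i = shift (g + h) \<Gamma> i" for i
    by (rule set_eqI) (simp add: mem_shift add.assoc)
qed

text \<open>The cylinder condition reduced to the list of cubes that are hit. For elements of the
  hull a hit cube holds exactly one point of its colour automatically, because the mesh is finer
  than the separation.\<close>

definition has_pattern :: "nat \<Rightarrow> ((real ^ 'd::finite) set \<times> 'k::finite) set \<Rightarrow> ('d, 'k) kset \<Rightarrow> bool" where
  "has_pattern m S \<Gamma> \<longleftrightarrow> (\<forall>C\<in>coloured_cubes m. \<Gamma> (snd C) \<inter> fst C \<noteq> {} \<longleftrightarrow> C \<in> S)"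

lemma finite_coloured_cubes: "finite (coloured_cubes m :: ((real ^ 'd::finite) set \<times> 'k::finite) set)"
proof -
  have "finite (PiE UNIV (\<lambda>_ :: 'd. {-(4 ^ m)..<4 ^ m :: int}))" by (intro finite_PiE) auto
  moreover have "(coloured_cubes m :: ((real ^ 'd) set \<times> 'k) set)
    \<subseteq> (\<lambda>(k, i). (grid_cube m k, i)) ` (PiE UNIV (\<lambda>_ :: 'd. {-(4 ^ m)..<4 ^ m :: int}) \<times> UNIV)"
    unfolding coloured_cubes_def by (force simp: PiE_UNIV_domain)
  ultimately show ?thesis by (meson finite_SigmaI finite_code finite_imageI finite_subset)
qed

lemma coloured_cubesE:
  assumes "C \<in> coloured_cubes m" obtains k where "fst C = grid_cube m k"
  using assms by (auto simp: coloured_cubes_def)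

lemma grid_cube_borel: "grid_cube m k \<in> sets borel"
proof -
  have "grid_cube m k = (\<Inter>j. {x. of_int (k j) / 2 ^ m \<le> x $ j} \<inter> {x. x $ j < (of_int (k j) + 1) / 2 ^ m})"
    by (auto simp: grid_cube_def)
  also have "\<dots> \<in> sets borel"
    by (intro sets.finite_INT sets.Int borel_closed borel_open closed_halfspace_component_ge_cart
        open_halfspace_component_lt_cart) auto
  finally show ?thesis .
qed

lemma grid_cube_bounded: "bounded (grid_cube m k)"
  by (rule bounded_subset[OF bounded_cbox[of "\<chi> j. of_int (k j) / 2 ^ m" "\<chi> j. (of_int (k j) + 1) / 2 ^ m"]])
    (simp add: grid_cube_def mem_box_cart subset_iff less_imp_le)

lemma coloured_cubes_radius:
  obtains \<rho> where "\<rho> > 0" "\<And>C. C \<in> (coloured_cubes m :: ((real ^ 'd::finite) set \<times> 'k::finite) set) \<Longrightarrow> fst C \<subseteq> ball 0 \<rho>"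
proof -
  have "bounded (\<Union>C\<in>(coloured_cubes m :: ((real ^ 'd) set \<times> 'k) set). fst C)"
    by (intro bounded_UN finite_coloured_cubes) (metis coloured_cubesE grid_cube_bounded)
  then obtain \<rho> where "\<rho> > 0" "(\<Union>C\<in>(coloured_cubes m :: ((real ^ 'd) set \<times> 'k) set). fst C) \<subseteq> ball 0 \<rho>"
    using bounded_subset_ballD by blast
  then show ?thesis using that by blast
qed

text \<open>The cubes reach only as far as \<rho>, so the pattern at g is decided by the points in
  the ball of that radius about g.\<close>

lemma has_pattern_shift_cong:
  fixes \<Gamma> \<Gamma>' :: "('d::finite, 'k::finite) kset"
  assumes "\<And>C. C \<in> (coloured_cubes m :: ((real ^ 'd) set \<times> 'k) set) \<Longrightarrow> fst C \<subseteq> ball 0 \<rho>"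
    and "\<And>i u. u \<in> ball g \<rho> \<Longrightarrow> u \<in> \<Gamma> i \<longleftrightarrow> u - v \<in> \<Gamma>' i"
  shows "has_pattern m S (shift g \<Gamma>) \<longleftrightarrow> has_pattern m S (shift (g - v) \<Gamma>')"
proof -
  have "y \<in> shift g \<Gamma> i \<longleftrightarrow> y \<in> shift (g - v) \<Gamma>' i" if "C \<in> coloured_cubes m" "y \<in> fst C" for C :: "(real ^ 'd) set \<times> 'k" and y i
  proof -
    have "norm y < \<rho>" using assms(1)[OF that(1)] that(2) by auto
    then have "y + g \<in> ball g \<rho>" by (simp add: dist_norm)
    from assms(2)[OF this, of i] show ?thesis by (simp add: mem_shift add_diff_eq)
  qed
  then have "shift g \<Gamma> (snd C) \<inter> fst C = shift (g - v) \<Gamma>' (snd C) \<inter> fst C" if "C \<in> coloured_cubes m" for C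
    using that by blast
  then show ?thesis by (simp add: has_pattern_def)
qed

text \<open>A cube is hit at position g exactly when g lies in one of countably many reflected
  translates of it, and only finitely many cubes are involved.\<close>

lemma has_pattern_borel:
  fixes \<Gamma> :: "('d::finite, 'k::finite) kset"
  assumes "\<And>i. countable (\<Gamma> i)"
  shows "{g. has_pattern m S (shift g \<Gamma>)} \<in> sets borel"
proof -
  define M where "M C = (\<Union>y\<in>\<Gamma> (snd C). (\<lambda>g. y - g) -` fst C)" for C
  have M: "M C \<in> sets borel" if C: "C \<in> coloured_cubes m" for C
    unfolding M_def
  proof (rule sets.countable_UN''[OF assms])
    fix y
    obtain k where "fst C = grid_cube m k" using C by (rule coloured_cubesE)
    then show "(\<lambda>g. y - g) -` fst C \<in> sets borel"
      using measurable_sets[of "\<lambda>g. y - g" borel borel "fst C"] grid_cube_borel[of m k]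
      by simp
  qed
  have mem: "g \<in> M C \<longleftrightarrow> shift g \<Gamma> (snd C) \<inter> fst C \<noteq> {}" for g C
    unfolding M_def shift_def by blast
  define H where "H C = (if C \<in> S then M C else - M C)" for C
  have "{g. has_pattern m S (shift g \<Gamma>)} = {g. \<forall>C\<in>coloured_cubes m. g \<in> H C}"
    unfolding has_pattern_def mem[symmetric] by (intro Collect_cong ball_cong) (auto simp: H_def)
  also have "\<dots> = (\<Inter>C\<in>coloured_cubes m. H C)" by blast
  also have "\<dots> \<in> sets borel"
  proof (cases "coloured_cubes m = ({} :: ((real ^ 'd) set \<times> 'k) set)")
    case False
    then show ?thesis using M by (intro sets.finite_INT finite_coloured_cubes) (auto simp: H_def)
  qed simp
  finally show ?thesis .
qed

section \<open>Occurrences inside supertiles and the resulting volume estimates\<close>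

context substitution_tiling
begin

abbreviation inner_layer :: "nat \<Rightarrow> 'k \<Rightarrow> real \<Rightarrow> (real ^ 'd) set" where
  "inner_layer n j R \<equiv> supertile n j - {h. ball h R \<subseteq> supertile n j}"

text \<open>The digit sets stand for the points of a supertile placed at the origin, so this depends
  on the type j and not on a position in the tiling. With R = \<rho> + r, everything that decides
  the pattern at h lies inside the supertile.\<close>

definition occurrences :: "nat \<Rightarrow> ((real ^ 'd) set \<times> 'k) set \<Rightarrow> real \<Rightarrow> nat \<Rightarrow> 'k \<Rightarrow> (real ^ 'd) set" where
  "occurrences m S R n j = {h. ball h R \<subseteq> supertile n j \<and> has_pattern m S (shift h (\<lambda>i. \<D> n i j))}"

lemma countable_\<Lambda>: "countable (\<Lambda> i)"
  by (rule uniform_discrete_countable[OF uniform_discrete_\<Lambda>])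

lemma supertile_radius: obtains c where "c > 0" "\<And>j. supertile n j \<subseteq> ball 0 c"
proof -
  have "bounded (\<Union>j. supertile n j)" using compact_supertile by (simp add: bounded_UN compact_imp_bounded)
  then obtain c where "c > 0" "(\<Union>j. supertile n j) \<subseteq> ball 0 c" using bounded_subset_ballD by blast
  then show ?thesis using that by blast
qed

lemma finite_\<Lambda>_window: "finite {(x, j). x \<in> \<Lambda> j \<and> (Q ^^ n) x \<in> ball a L}"
proof -
  have "linear (inv (Q ^^ n))" by (intro inj_linear_imp_inv_linear linear_Qn bij_is_inj bij_Qn)
  then have bd: "bounded (inv (Q ^^ n) ` ball a L)"
    by (intro bounded_linear_image) (simp_all add: linear_linear)
  have "x \<in> inv (Q ^^ n) ` ball a L" if "(Q ^^ n) x \<in> ball a L" for x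
    using that bij_Qn[of n] by (metis bij_inv_eq_iff imageI)
  then have "{(x, j). x \<in> \<Lambda> j \<and> (Q ^^ n) x \<in> ball a L} \<subseteq> (\<Union>j. (\<lambda>x. (x, j)) ` (\<Lambda> j \<inter> inv (Q ^^ n) ` ball a L))"
    by (auto simp only: mem_Collect_eq split_def prod.sel intro!: UN_I image_eqI[of _ "\<lambda>x. (x, _)"] IntI)
  moreover have "finite (\<Union>j. (\<lambda>x. (x, j)) ` (\<Lambda> j \<inter> inv (Q ^^ n) ` ball a L))"
    using uniform_discrete_finite_Int_bounded[OF uniform_discrete_\<Lambda> bd] by simp
  ultimately show ?thesis by (rule finite_subset)
qed

lemma occurrences_borel: "occurrences m S R n j \<in> sets borel"
proof -
  have "occurrences m S R n j = {h. ball h R \<subseteq> supertile n j} \<inter> {h. has_pattern m S (shift h (\<lambda>i. \<D> n i j))}"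
    by (auto simp: occurrences_def)
  also have "\<dots> \<in> sets borel"
    by (intro sets.Int borel_closed closed_inner_parallel_set has_pattern_borel)
      (simp add: finite_digits countable_finite)
  finally show ?thesis .
qed

lemma occurrences_subset: "R > 0 \<Longrightarrow> occurrences m S R n j \<subseteq> interior (supertile n j)"
  by (auto simp: occurrences_def mem_interior)

lemma bounded_supertile: "bounded (supertile n j)"
  by (rule compact_imp_bounded[OF compact_supertile])

lemma lmeasurable_supertile: "supertile n j \<in> lmeasurable" "interior (supertile n j) \<in> lmeasurable"
  "inner_layer n j R \<in> lmeasurable" "R > 0 \<Longrightarrow> occurrences m S R n j \<in> lmeasurable"
proof -
  have b: "bounded (interior (supertile n j))" by (rule bounded_subset[OF bounded_supertile interior_subset])
  show "supertile n j \<in> lmeasurable" "interior (supertile n j) \<in> lmeasurable"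
    by (intro lmeasurable_bounded_borel b bounded_supertile borel_open borel_closed open_interior
        compact_imp_closed compact_supertile)+
  show "inner_layer n j R \<in> lmeasurable"
    by (intro lmeasurable_bounded_borel sets.Diff borel_closed closed_inner_parallel_set
        compact_imp_closed compact_supertile) (rule bounded_subset[OF bounded_supertile Diff_subset])
  show "occurrences m S R n j \<in> lmeasurable" if "R > 0"
    using occurrences_borel bounded_subset[OF b occurrences_subset[OF that]] by (rule lmeasurable_bounded_borel)
qed

lemma measure_supertile: "measure lebesgue (supertile n j) = theta ^ n * inner_vol j"
  "measure lebesgue (interior (supertile n j)) = theta ^ n * inner_vol j"
  unfolding interior_supertile
  by (simp_all add: supertile_def measure_Qn_image borel_A bounded_A bounded_interior_A measure_A)
    (simp add: inner_vol_def)

text \<open>The margin adds the reach of the cubes to the radius of the tiles carried by the points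
  in them; with both, \<open>supertile_locality\<close> identifies these points with digits.\<close>

lemma has_pattern_in_supertile:
  assumes "\<And>i. A i \<subseteq> ball 0 r" "\<And>C. C \<in> (coloured_cubes m :: ((real ^ 'd) set \<times> 'k) set) \<Longrightarrow> fst C \<subseteq> ball 0 \<rho>"
    and "x \<in> \<Lambda> j" "ball h (\<rho> + r) \<subseteq> supertile n j"
  shows "has_pattern m S (shift ((Q ^^ n) x + h) \<Lambda>) \<longleftrightarrow> h \<in> occurrences m S (\<rho> + r) n j"
proof -
  have "ball ((Q ^^ n) x + h) (\<rho> + r) = (+) ((Q ^^ n) x) ` ball h (\<rho> + r)" by (rule ball_translation)
  also have "\<dots> \<subseteq> (+) ((Q ^^ n) x) ` supertile n j" using assms(4) by (rule image_mono)
  finally have "has_pattern m S (shift ((Q ^^ n) x + h) \<Lambda>)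
      \<longleftrightarrow> has_pattern m S (shift ((Q ^^ n) x + h - (Q ^^ n) x) (\<lambda>i. \<D> n i j))"
    by (intro has_pattern_shift_cong[OF assms(2)] supertile_locality[OF assms(1,3)])
  then show ?thesis using assms(4) by (simp add: occurrences_def)
qed

text \<open>A position in the window lies in some supertile, and if it shows the pattern it is a
  deep occurrence or in the boundary layer. The hypothesis trades this volume for a \<tau>-fraction
  of the interior, and the interiors are disjoint. Supertiles meeting the window stay within twice
  their radius of it, which gives the enlargement.\<close>

lemma pattern_upper_bound:
  fixes S :: "((real ^ 'd) set \<times> 'k) set"
  assumes r: "r > 0" "\<And>i. A i \<subseteq> ball 0 r"
    and \<rho>: "\<rho> > 0" "\<And>C. C \<in> (coloured_cubes m :: ((real ^ 'd) set \<times> 'k) set) \<Longrightarrow> fst C \<subseteq> ball 0 \<rho>"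
    and le: "\<And>j. measure lebesgue (occurrences m S (\<rho> + r) n j) + measure lebesgue (inner_layer n j (\<rho> + r))
      \<le> \<tau> * theta ^ n * inner_vol j"
  shows "\<exists>c>0. \<forall>a L. measure lebesgue ({g. has_pattern m S (shift g \<Lambda>)} \<inter> ball a L) \<le> \<tau> * measure lebesgue (ball a (L + c))"
proof -
  let ?R = "\<rho> + r" and ?G = "{g. has_pattern m S (shift g \<Lambda>)}"
  have R: "?R > 0" using r \<rho> by simp
  \<comment> \<open>The sign of \<tau> follows from the hypothesis at any single colour;
    \<open>undefined\<close> serves as an arbitrary one.\<close>
  have "0 \<le> \<tau> * (theta ^ n * inner_vol undefined)"
    unfolding mult.assoc[symmetric] by (rule order_trans[OF _ le]) (simp add: add_nonneg_nonneg)
  then have \<tau>: "\<tau> \<ge> 0"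
    using mult_pos_pos[OF zero_less_power[OF theta(1), of n] inner_vol_pos[of undefined]]
    by (metis less_le_not_le linorder_le_less_linear mult_neg_pos)
  obtain c where c: "c > 0" "\<And>j. supertile n j \<subseteq> ball 0 c" using supertile_radius by metis
  show ?thesis
  proof (intro exI[of _ "2 * c"] conjI allI)
    fix a L
    define I where "I = {(x, j). x \<in> \<Lambda> j \<and> (+) ((Q ^^ n) x) ` supertile n j \<inter> ball a L \<noteq> {}}"
    have near: "norm (a - (Q ^^ n) x) < L + c" if "(x, j) \<in> I" for x j
    proof -
      have "(+) ((Q ^^ n) x) ` supertile n j \<inter> ball a L \<noteq> {}" using that unfolding I_def by simp
      then obtain s where "s \<in> supertile n j" "dist a ((Q ^^ n) x + s) < L" unfolding ball_def by blast
      moreover from this have "norm s < c" using c(2)[of j] by auto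
      ultimately show ?thesis
        using norm_triangle_ineq[of "a - ((Q ^^ n) x + s)" s] by (simp add: dist_norm)
    qed
    have "I \<subseteq> {(x, j). x \<in> \<Lambda> j \<and> (Q ^^ n) x \<in> ball a (L + c)}"
      using near by (auto simp: I_def dist_norm)
    then have I: "finite I" using finite_\<Lambda>_window by (rule finite_subset)
    let ?F = "\<lambda>p. (+) ((Q ^^ n) (fst p)) ` (occurrences m S ?R n (snd p) \<union> inner_layer n (snd p) ?R)"
    have "measure lebesgue (?G \<inter> ball a L) \<le> (\<Sum>p\<in>I. measure lebesgue (?F p))"
    proof (rule finite_measure_cover_le[OF I])
      show "?F p \<in> lmeasurable" for p
        using lmeasurable_supertile R by (intro measurable_translation fmeasurable.Un)
      have "?G \<inter> ball a L \<in> sets borel" by (intro sets.Int has_pattern_borel countable_\<Lambda> borel_open open_ball)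
      then show "?G \<inter> ball a L \<in> sets lebesgue" by auto
      show "?G \<inter> ball a L \<subseteq> (\<Union>p\<in>I. ?F p)"
      proof
        fix g assume g: "g \<in> ?G \<inter> ball a L"
        obtain j x where x: "x \<in> \<Lambda> j" "g \<in> (+) ((Q ^^ n) x) ` supertile n j" using supertiles_cover by blast
        then obtain h where h: "h \<in> supertile n j" "g = (Q ^^ n) x + h" by blast
        have "(x, j) \<in> I" using x g unfolding I_def by blast
        moreover have "h \<in> occurrences m S ?R n j \<union> inner_layer n j ?R"
          using has_pattern_in_supertile[OF r(2) \<rho>(2) x(1)] h g by auto
        ultimately show "g \<in> (\<Union>p\<in>I. ?F p)" using h by (intro UN_I[of "(x, j)"]) auto
      qed
    qed
    also have "\<dots> \<le> (\<Sum>p\<in>I. \<tau> * measure lebesgue ((+) ((Q ^^ n) (fst p)) ` interior (supertile n (snd p))))"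
    proof (rule sum_mono)
      fix p
      have "measure lebesgue (?F p) = measure lebesgue (occurrences m S ?R n (snd p) \<union> inner_layer n (snd p) ?R)"
        by (rule measure_translation)
      also have "\<dots> \<le> measure lebesgue (occurrences m S ?R n (snd p)) + measure lebesgue (inner_layer n (snd p) ?R)"
        using lmeasurable_supertile R by (intro measure_Un_le) (auto dest: fmeasurableD)
      also have "\<dots> \<le> \<tau> * theta ^ n * inner_vol (snd p)" by (rule le)
      finally show "measure lebesgue (?F p) \<le> \<tau> * measure lebesgue ((+) ((Q ^^ n) (fst p)) ` interior (supertile n (snd p)))"
        by (simp add: measure_translation measure_supertile mult.assoc)
    qed
    also have "\<dots> = \<tau> * (\<Sum>p\<in>I. measure lebesgue ((+) ((Q ^^ n) (fst p)) ` interior (supertile n (snd p))))"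
      by (simp add: sum_distrib_left)
    also have "\<dots> \<le> \<tau> * measure lebesgue (ball a (L + 2 * c))"
    proof (intro mult_left_mono finite_measure_disjoint_le[OF I] \<tau>)
      show "(+) ((Q ^^ n) (fst p)) ` interior (supertile n (snd p)) \<in> lmeasurable" for p
        using lmeasurable_supertile by (intro measurable_translation)
      show "disjoint_family_on (\<lambda>p. (+) ((Q ^^ n) (fst p)) ` interior (supertile n (snd p))) I"
        unfolding disjoint_family_on_def
        by (intro ballI impI supertiles_interior_disjoint) (auto simp: I_def)
      show "(\<Union>p\<in>I. (+) ((Q ^^ n) (fst p)) ` interior (supertile n (snd p))) \<subseteq> ball a (L + 2 * c)"
      proof clarsimp
        fix x j s assume xj: "(x, j) \<in> I" and s: "s \<in> interior (supertile n j)"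
        have "norm s < c" using s c(2)[of j] interior_subset[of "supertile n j"] by auto
        with near[OF xj] show "dist a ((Q ^^ n) x + s) < L + 2 * c"
          using norm_triangle_ineq4[of "a - (Q ^^ n) x" s] by (simp add: dist_norm algebra_simps)
      qed
    qed auto
    finally show "measure lebesgue (?G \<inter> ball a L) \<le> \<tau> * measure lebesgue (ball a (L + 2 * c))" .
  qed (use c in simp)
qed

definition max_vol :: real where "max_vol = Max (range inner_vol)"

lemma inner_vol_le: "inner_vol j \<le> max_vol" by (simp add: max_vol_def)

text \<open>Each supertile of level \<open>n + K\<close> contains two supertiles of level \<open>n\<close> and type \<open>j\<close>
  at distance \<open>Q\<^sup>n v\<close>.\<close>

lemma pattern_pair_lower_bound:
  fixes S :: "((real ^ 'd) set \<times> 'k) set"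
  assumes r: "r > 0" "\<And>i. A i \<subseteq> ball 0 r"
    and \<rho>: "\<rho> > 0" "\<And>C. C \<in> (coloured_cubes m :: ((real ^ 'd) set \<times> 'k) set) \<Longrightarrow> fst C \<subseteq> ball 0 \<rho>"
    and v: "\<And>l. \<exists>b. b \<in> \<D> K j l \<and> b + v \<in> \<D> K j l"
  shows "\<exists>c>0. \<forall>a L. measure lebesgue (occurrences m S (\<rho> + r) n j) * measure lebesgue (ball a (L - c))
    \<le> theta ^ (n + K) * max_vol *
      measure lebesgue ({g. has_pattern m S (shift g \<Lambda>) \<and> has_pattern m S (shift (g + (Q ^^ n) v) \<Lambda>)} \<inter> ball a L)"
proof -
  let ?R = "\<rho> + r" and ?G = "{g. has_pattern m S (shift g \<Lambda>) \<and> has_pattern m S (shift (g + (Q ^^ n) v) \<Lambda>)}"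
  let ?N = "n + K" and ?E = "occurrences m S (\<rho> + r) n j"
  have R: "?R > 0" using r \<rho> by simp
  obtain b where b: "\<And>l. b l \<in> \<D> K j l" "\<And>l. b l + v \<in> \<D> K j l" using v by metis
  obtain c where c: "c > 0" "\<And>j. supertile ?N j \<subseteq> ball 0 c" using supertile_radius by metis
  show ?thesis
  \<comment> \<open>Shrinking the window by twice the supertile radius puts every supertile that
    meets the smaller ball inside the larger one.\<close>
  proof (intro exI[of _ "2 * c"] conjI allI)
    fix a L
    define I where "I = {(x, l). x \<in> \<Lambda> l \<and> (+) ((Q ^^ ?N) x) ` supertile ?N l \<subseteq> ball a L}"
    define W where "W = {(x, l). x \<in> \<Lambda> l \<and> (Q ^^ ?N) x \<in> ball a (L + c)}"
    have "I \<subseteq> W"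
    proof
      fix p assume p: "p \<in> I"
      obtain x l where p': "p = (x, l)" by (cases p)
      have x: "x \<in> \<Lambda> l" "(+) ((Q ^^ ?N) x) ` supertile ?N l \<subseteq> ball a L"
        using p unfolding p' I_def by simp_all
      obtain s where s: "s \<in> supertile ?N l" using A_nonempty[of l] unfolding supertile_def by blast
      have "norm s < c" using s c(2)[of l] by auto
      moreover have "dist a ((Q ^^ ?N) x + s) < L" using x s by auto
      ultimately have "norm (a - (Q ^^ ?N) x) < L + c"
        using norm_triangle_ineq[of "a - ((Q ^^ ?N) x + s)" s] by (simp add: dist_norm)
      with x show "p \<in> W" by (simp add: W_def p' dist_norm)
    qed
    then have I: "finite I" unfolding W_def using finite_\<Lambda>_window by (rule finite_subset)
    have "measure lebesgue (ball a (L - 2 * c)) \<le> (\<Sum>p\<in>I. measure lebesgue ((+) ((Q ^^ ?N) (fst p)) ` supertile ?N (snd p)))"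
    proof (rule finite_measure_cover_le[OF I])
      show "(+) ((Q ^^ ?N) (fst p)) ` supertile ?N (snd p) \<in> lmeasurable" for p
        by (intro measurable_translation lmeasurable_supertile)
      show "ball a (L - 2 * c) \<subseteq> (\<Union>p\<in>I. (+) ((Q ^^ ?N) (fst p)) ` supertile ?N (snd p))"
      proof
        fix g assume g: "g \<in> ball a (L - 2 * c)"
        obtain l x where x: "x \<in> \<Lambda> l" "g \<in> (+) ((Q ^^ ?N) x) ` supertile ?N l" using supertiles_cover by blast
        then obtain h where h: "h \<in> supertile ?N l" "g = (Q ^^ ?N) x + h" by blast
        have "(Q ^^ ?N) x + s \<in> ball a L" if "s \<in> supertile ?N l" for s
        proof -
          have "norm s < c" "norm h < c" using that h c(2)[of l] by auto
          moreover have "norm (a - g) < L - 2 * c" using g by (simp add: dist_norm)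
          moreover have "a - ((Q ^^ ?N) x + s) = (a - g) + (h - s)" by (simp add: h)
          ultimately have "norm (a - ((Q ^^ ?N) x + s)) < L"
            using norm_triangle_ineq[of "a - g" "h - s"] norm_triangle_ineq4[of h s] by (simp only:)
          then show ?thesis by (simp add: dist_norm)
        qed
        then have "(x, l) \<in> I" using x by (auto simp: I_def)
        then show "g \<in> (\<Union>p\<in>I. (+) ((Q ^^ ?N) (fst p)) ` supertile ?N (snd p))"
          using x by (intro UN_I[of "(x, l)"]) auto
      qed
    qed auto
    also have "\<dots> = (\<Sum>p\<in>I. theta ^ ?N * inner_vol (snd p))"
      by (simp add: measure_translation measure_supertile)
    also have "\<dots> \<le> (\<Sum>p\<in>I. theta ^ ?N * max_vol)"
      using theta(1) inner_vol_le by (intro sum_mono mult_left_mono) auto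
    also have "\<dots> = card I * (theta ^ ?N * max_vol)" by simp
    finally have 1: "measure lebesgue (ball a (L - 2 * c)) \<le> card I * (theta ^ ?N * max_vol)" .
    \<comment> \<open>The point of \<open>\<Lambda> j\<close> that carries the first of the two
      level-n supertiles below p. The second is carried by \<open>y p + v\<close>, so applying Q^n
      separates them by \<open>(Q ^^ n) v\<close>.\<close>
    define y where "y p = (Q ^^ K) (fst p) + b (snd p)" for p
    have split: "(Q ^^ ?N) x = (Q ^^ n) ((Q ^^ K) x)" for x by (simp add: funpow_add)
    have sub: "(+) ((Q ^^ n) (y (x, l))) ` supertile n j \<subseteq> (+) ((Q ^^ ?N) x) ` supertile ?N l" for x l
    proof
      fix u assume "u \<in> (+) ((Q ^^ n) (y (x, l))) ` supertile n j"
      then obtain s where s: "s \<in> A j" "u = (Q ^^ n) (y (x, l)) + (Q ^^ n) s" by (auto simp: supertile_def)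
      have "b l + s \<in> (Q ^^ K) ` A l" using digit_tile_subset[OF b(1)] s by blast
      then have "(Q ^^ n) (b l + s) \<in> supertile ?N l" by (auto simp: supertile_def funpow_add)
      moreover have "u = (Q ^^ ?N) x + (Q ^^ n) (b l + s)"
        by (simp add: s y_def split Qn_add add.assoc)
      ultimately show "u \<in> (+) ((Q ^^ ?N) x) ` supertile ?N l" by blast
    qed
    have "card I * measure lebesgue ?E = (\<Sum>p\<in>I. measure lebesgue ((+) ((Q ^^ n) (y p)) ` ?E))"
      by (simp add: measure_translation)
    also have "\<dots> \<le> measure lebesgue (?G \<inter> ball a L)"
    proof (rule finite_measure_disjoint_le[OF I])
      show "(+) ((Q ^^ n) (y p)) ` ?E \<in> lmeasurable" for p
        using R by (intro measurable_translation lmeasurable_supertile)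
      show "disjoint_family_on (\<lambda>p. (+) ((Q ^^ n) (y p)) ` ?E) I"
        unfolding disjoint_family_on_def
      proof (intro ballI impI)
        fix p p' assume p: "p \<in> I" "p' \<in> I" "p \<noteq> p'"
        have "(+) ((Q ^^ n) (y q)) ` ?E \<subseteq> (+) ((Q ^^ ?N) (fst q)) ` interior (supertile ?N (snd q))" for q
        proof -
          have "(+) ((Q ^^ n) (y q)) ` ?E \<subseteq> (+) ((Q ^^ n) (y q)) ` interior (supertile n j)"
            by (intro image_mono occurrences_subset R)
          also have "\<dots> \<subseteq> interior ((+) ((Q ^^ ?N) (fst q)) ` supertile ?N (snd q))"
            using sub[of "fst q" "snd q"] by (simp add: interior_mono flip: interior_translation)
          finally show ?thesis by (simp add: interior_translation)
        qed
        moreover have "(+) ((Q ^^ ?N) (fst p)) ` interior (supertile ?N (snd p)) \<inter>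
            (+) ((Q ^^ ?N) (fst p')) ` interior (supertile ?N (snd p')) = {}"
          using p by (intro supertiles_interior_disjoint) (auto simp: I_def)
        ultimately show "(+) ((Q ^^ n) (y p)) ` ?E \<inter> (+) ((Q ^^ n) (y p')) ` ?E = {}" by blast
      qed
      have "{g. has_pattern m S (shift (g + (Q ^^ n) v) \<Lambda>)} = {g. has_pattern m S (shift g (shift ((Q ^^ n) v) \<Lambda>))}"
        by (simp add: shift_shift)
      also have "\<dots> \<in> sets borel"
        by (intro has_pattern_borel) (simp add: shift_def countable_\<Lambda>)
      finally have B: "{g. has_pattern m S (shift (g + (Q ^^ n) v) \<Lambda>)} \<in> sets borel" .
      have "{g. has_pattern m S (shift g \<Lambda>)} \<inter> {g. has_pattern m S (shift (g + (Q ^^ n) v) \<Lambda>)} \<inter> ball a L \<in> sets borel"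
        by (intro sets.Int B has_pattern_borel countable_\<Lambda>) simp
      then show "?G \<inter> ball a L \<in> lmeasurable"
        by (intro lmeasurable_bounded_borel) (simp_all add: Collect_conj_eq bounded_Int)
      show "(\<Union>p\<in>I. (+) ((Q ^^ n) (y p)) ` ?E) \<subseteq> ?G \<inter> ball a L"
      proof clarify
        fix x l h assume xl: "(x, l) \<in> I" and h: "h \<in> ?E"
        have x: "x \<in> \<Lambda> l" "(+) ((Q ^^ ?N) x) ` supertile ?N l \<subseteq> ball a L"
          using xl unfolding I_def by simp_all
        have hb: "ball h ?R \<subseteq> supertile n j" using h by (simp add: occurrences_def)
        have "h \<in> supertile n j" using h occurrences_subset[OF R] interior_subset by blast
        then have inb: "(Q ^^ n) (y (x, l)) + h \<in> ball a L" using sub[of x l] x(2) by blast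
        have "y (x, l) \<in> \<Lambda> j" "y (x, l) + v \<in> \<Lambda> j"
          unfolding y_def using digit_in_\<Lambda>[OF x(1) b(1)] digit_in_\<Lambda>[OF x(1) b(2)] by (simp_all add: add.assoc)
        then have "has_pattern m S (shift ((Q ^^ n) (y (x, l)) + h) \<Lambda>)"
          "has_pattern m S (shift ((Q ^^ n) (y (x, l) + v) + h) \<Lambda>)"
          using has_pattern_in_supertile[OF r(2) \<rho>(2) _ hb] h by simp_all
        moreover have "(Q ^^ n) (y (x, l) + v) + h = (Q ^^ n) (y (x, l)) + h + (Q ^^ n) v"
          by (simp add: Qn_add)
        ultimately show "(Q ^^ n) (y (x, l)) + h \<in> ?G \<inter> ball a L" using inb by simp
      qed
    qed
    finally have 2: "card I * measure lebesgue ?E \<le> measure lebesgue (?G \<inter> ball a L)" .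
    have pos: "0 \<le> theta ^ ?N * max_vol"
      using theta(1) inner_vol_le[of undefined] inner_vol_pos[of undefined] by (intro mult_nonneg_nonneg) auto
    have "measure lebesgue ?E * measure lebesgue (ball a (L - 2 * c))
      \<le> measure lebesgue ?E * (card I * (theta ^ ?N * max_vol))"
      using 1 by (intro mult_left_mono) auto
    also have "\<dots> = theta ^ ?N * max_vol * (card I * measure lebesgue ?E)" by (simp add: mult_ac)
    also have "\<dots> \<le> theta ^ ?N * max_vol * measure lebesgue (?G \<inter> ball a L)"
      using 2 pos by (rule mult_left_mono)
    finally show "measure lebesgue ?E * measure lebesgue (ball a (L - 2 * c))
      \<le> theta ^ ?N * max_vol * measure lebesgue (?G \<inter> ball a L)" .
  qed (use c in simp)
qed

end

section \<open>The hull\<close>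

lemma near_mono:
  assumes "near e \<Gamma> \<Gamma>'" "0 < e" "e \<le> e'" shows "near e' \<Gamma> \<Gamma>'"
  unfolding near_def
proof (intro allI subsetI)
  fix i y assume "y \<in> ball 0 (1 / e') \<inter> \<Gamma>' i"
  moreover have "1 / e' \<le> 1 / e" using assms by (simp add: frac_le)
  ultimately have "y \<in> ball 0 (1 / e) \<inter> \<Gamma>' i" by auto
  then show "y \<in> {x + b |x b. x \<in> \<Gamma> i \<and> b \<in> ball 0 e'}"
    using assms(1,3) unfolding near_def by force
qed

text \<open>The window of radius 1 / e' moved by g has to fit into the one of radius 1 / e, which is
  the last hypothesis.\<close>

lemma near_shift:
  assumes "near e \<Gamma> \<Gamma>'" "0 < e" "e \<le> e'" "1 / e' + norm g \<le> 1 / e"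
  shows "near e' (shift g \<Gamma>) (shift g \<Gamma>')"
  unfolding near_def
proof (intro allI subsetI)
  fix i y assume y: "y \<in> ball 0 (1 / e') \<inter> shift g \<Gamma>' i"
  then have "norm (y + g) < 1 / e" using norm_triangle_ineq[of y g] assms(4) by auto
  then have "y + g \<in> ball 0 (1 / e) \<inter> \<Gamma>' i" using y by (simp add: mem_shift)
  then obtain x b where "x \<in> \<Gamma> i" "norm b < e" "y + g = x + b"
    using assms(1) unfolding near_def by force
  then have "x - g \<in> shift g \<Gamma> i" "b \<in> ball 0 e'" "y = (x - g) + b"
    using assms(3) by (auto simp: mem_shift algebra_simps)
  then show "y \<in> {x + b |x b. x \<in> shift g \<Gamma> i \<and> b \<in> ball 0 e'}" by blast
qed

lemma delone_translation:
  fixes S :: "'a::real_normed_vector set"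
  assumes "delone S" shows "delone ((\<lambda>x. x - g) ` S)"
proof -
  have "relatively_dense ((\<lambda>x. x - g) ` S)"
    unfolding relatively_dense_def
  proof -
    obtain R where R: "R > 0" "\<And>x. \<exists>y\<in>S. dist x y \<le> R"
      using assms by (auto simp: delone_def relatively_dense_def)
    have "\<exists>y\<in>(\<lambda>x. x - g) ` S. dist x y \<le> R" for x
      using R(2)[of "x + g"] by (auto simp: dist_norm algebra_simps)
    with R show "\<exists>R>0. \<forall>x. \<exists>y\<in>(\<lambda>x. x - g) ` S. dist x y \<le> R" by blast
  qed
  moreover have "uniform_discrete ((\<lambda>x. x - g) ` S)"
    using assms unfolding delone_def uniform_discrete_def by (fastforce simp: dist_norm)
  ultimately show ?thesis by (simp add: delone_def)
qed

lemma delone_kset_shift: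
  assumes "delone_kset \<Gamma>" shows "delone_kset (shift g \<Gamma>)"
proof -
  have "supp (shift g \<Gamma>) = (\<lambda>x. x - g) ` supp \<Gamma>" by (auto simp: supp_def shift_def)
  moreover have "disjoint_family (shift g \<Gamma>)"
    using assms unfolding delone_kset_def disjoint_family_on_def by (auto simp: set_eq_iff mem_shift)
  ultimately show ?thesis
    using assms delone_translation unfolding delone_kset_def by (auto simp: shift_def)
qed

lemma kset_uniform_discrete: "delone_kset \<Gamma> \<Longrightarrow> uniform_discrete (\<Gamma> i)"
  by (simp add: delone_kset_def delone_def)

text \<open>Since \<open>near\<close> is monotone in its parameter, the cap and the infimum in
  \<open>kdist\<close> disappear once arbitrarily small distances are asked for.\<close>

lemma mem_hull_iff:
  fixes \<Lambda> \<Gamma> :: "('d::finite, 'k::finite) kset"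
  assumes "delone_kset \<Lambda>"
  shows "\<Gamma> \<in> hull_of \<Lambda> \<longleftrightarrow>
    delone_kset \<Gamma> \<and> (\<forall>e>0. \<exists>a. near e \<Gamma> (shift a \<Lambda>) \<and> near e (shift a \<Lambda>) \<Gamma>)"
proof -
  interpret Metric_space "{\<Gamma> :: ('d, 'k) kset. delone_kset \<Gamma>}" kdist by (rule Metric_space_kdist)
  have "\<Gamma> \<in> hull_of \<Lambda> \<longleftrightarrow> delone_kset \<Gamma> \<and> (\<forall>r>0. \<exists>a. kdist \<Gamma> (shift a \<Lambda>) < r)"
    unfolding hull_of_def kset_topology_def metric_closure_of
    using delone_kset_shift[OF assms] by (auto simp: in_mball)
  also have "(\<forall>r>0. \<exists>a. kdist \<Gamma> (shift a \<Lambda>) < r)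
      \<longleftrightarrow> (\<forall>e>0. \<exists>a. near e \<Gamma> (shift a \<Lambda>) \<and> near e (shift a \<Lambda>) \<Gamma>)"
  proof (intro iffI allI impI)
    fix e :: real assume *: "\<forall>r>0. \<exists>a. kdist \<Gamma> (shift a \<Lambda>) < r" and "e > 0"
    then have "0 < min e (1 / sqrt 2)" by simp
    with * obtain a where "kdist \<Gamma> (shift a \<Lambda>) < min e (1 / sqrt 2)" by blast
    then show "\<exists>a. near e \<Gamma> (shift a \<Lambda>) \<and> near e (shift a \<Lambda>) \<Gamma>"
      unfolding kdist_less_iff by (intro exI[of _ a]) (auto intro: near_mono)
  next
    fix r :: real assume *: "\<forall>e>0. \<exists>a. near e \<Gamma> (shift a \<Lambda>) \<and> near e (shift a \<Lambda>) \<Gamma>" and "r > 0"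
    then obtain a where "near (r / 2) \<Gamma> (shift a \<Lambda>) \<and> near (r / 2) (shift a \<Lambda>) \<Gamma>" by (meson half_gt_zero)
    then show "\<exists>a. kdist \<Gamma> (shift a \<Lambda>) < r"
      unfolding kdist_less_iff using \<open>r > 0\<close> by (intro exI[of _ a] disjI2 exI[of _ "r / 2"]) auto
  qed
  finally show ?thesis .
qed

lemma shift_mem_hull:
  assumes \<Lambda>: "delone_kset \<Lambda>" and "\<Gamma> \<in> hull_of \<Lambda>" shows "shift g \<Gamma> \<in> hull_of \<Lambda>"
  unfolding mem_hull_iff[OF \<Lambda>]
proof (intro conjI allI impI)
  have \<Gamma>: "delone_kset \<Gamma>" "\<And>e. e > 0 \<Longrightarrow> \<exists>a. near e \<Gamma> (shift a \<Lambda>) \<and> near e (shift a \<Lambda>) \<Gamma>"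
    using assms(2) unfolding mem_hull_iff[OF \<Lambda>] by auto
  show "delone_kset (shift g \<Gamma>)" using \<Gamma>(1) by (rule delone_kset_shift)
  fix e' :: real assume e': "e' > 0"
  \<comment> \<open>Chosen so that the window of radius 1 / e exactly absorbs the shift by
    g.\<close>
  define e where "e = inverse (1 / e' + norm g)"
  have pos: "1 / e' + norm g > 0" using e' by (intro add_pos_nonneg) auto
  then have e: "e > 0" "1 / e = 1 / e' + norm g" by (simp_all add: e_def inverse_eq_divide)
  have "1 / e' \<le> 1 / e" using e by simp
  then have "e \<le> e'" using e(1) e' by (simp add: field_simps)
  moreover obtain a where "near e \<Gamma> (shift a \<Lambda>)" "near e (shift a \<Lambda>) \<Gamma>" using \<Gamma>(2) e by blast
  ultimately have "near e' (shift g \<Gamma>) (shift g (shift a \<Lambda>))" "near e' (shift g (shift a \<Lambda>)) (shift g \<Gamma>)"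
    using e by (auto intro: near_shift)
  then show "\<exists>a. near e' (shift g \<Gamma>) (shift a \<Lambda>) \<and> near e' (shift a \<Lambda>) (shift g \<Gamma>)"
    unfolding shift_shift by blast
qed

text \<open>Separation is given for \<Lambda> only. Since the mesh is strictly below \<eta> / 2, the
  slack s absorbs the errors of approximation by a translate, and the two approximating points fall
  into one small ball, centred at one of them.\<close>

lemma hull_at_most_one_point:
  fixes \<Lambda> \<Gamma> :: "('d::finite, 'k::finite) kset"
  assumes \<Lambda>: "delone_kset \<Lambda>" and \<Gamma>: "\<Gamma> \<in> hull_of \<Lambda>"
    and sep: "\<And>c x y. \<lbrakk>x \<in> supp \<Lambda>; y \<in> supp \<Lambda>; infnorm (x - c) < \<eta> / 2; infnorm (y - c) < \<eta> / 2\<rbrakk> \<Longrightarrow> x = y"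
    and "1 / 2 ^ m < \<eta> / 2"
    and x: "x \<in> \<Gamma> i" "x \<in> grid_cube m k" and y: "y \<in> \<Gamma> i" "y \<in> grid_cube m k"
  shows "x = y"
proof (rule ccontr)
  assume "x \<noteq> y"
  define s where "s = \<eta> / 2 - 1 / 2 ^ m"
  have s: "s > 0" using assms(4) by (simp add: s_def)
  \<comment> \<open>The bounds in turn: the two errors together stay below s, they cannot bridge the
    distance between x and y, and both points lie in the window of radius 1 / e.\<close>
  define e where "e = Min {s / 2, dist x y / 2, 1 / (norm x + 1), 1 / (norm y + 1)}"
  have npos: "norm x + 1 > 0" "norm y + 1 > 0" by (simp_all add: add_nonneg_pos)
  have e: "e > 0" "e \<le> s / 2" "e \<le> dist x y / 2" "e \<le> 1 / (norm x + 1)" "e \<le> 1 / (norm y + 1)"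
    using s \<open>x \<noteq> y\<close> npos unfolding e_def by auto
  obtain a where a: "near e (shift a \<Lambda>) \<Gamma>" using \<Gamma> e(1) unfolding mem_hull_iff[OF \<Lambda>] by blast
  have "norm x + 1 \<le> 1 / e" "norm y + 1 \<le> 1 / e" using e npos by (simp_all add: field_simps)
  then have "x \<in> ball 0 (1 / e) \<inter> \<Gamma> i" "y \<in> ball 0 (1 / e) \<inter> \<Gamma> i" using x y by simp_all
  then have "x \<in> {x + b |x b. x \<in> shift a \<Lambda> i \<and> b \<in> ball 0 e}" "y \<in> {x + b |x b. x \<in> shift a \<Lambda> i \<and> b \<in> ball 0 e}"
    using subsetD[OF spec[OF a[unfolded near_def], of i]] by blast+
  then obtain x' b y' c where x': "x' \<in> shift a \<Lambda> i" "norm b < e" "x = x' + b"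
    and y': "y' \<in> shift a \<Lambda> i" "norm c < e" "y = y' + c" unfolding mem_Collect_eq mem_ball_0 by blast
  have "infnorm (y - x) \<le> 1 / 2 ^ m"
    unfolding infnorm_Max
  proof (rule Max.boundedI)
    show "v \<le> 1 / 2 ^ m" if v: "v \<in> (\<lambda>i. \<bar>(y - x) \<bullet> i\<bar>) ` Basis" for v
    proof -
      obtain j where v: "v = \<bar>y $ j - x $ j\<bar>"
        using v by (auto simp: Basis_vec_def inner_axis inner_diff_left)
      have "of_int (k j) / 2 ^ m \<le> x $ j" "x $ j < (of_int (k j) + 1) / 2 ^ m"
        "of_int (k j) / 2 ^ m \<le> y $ j" "y $ j < (of_int (k j) + 1) / 2 ^ m"
        using x(2) y(2) by (auto simp: grid_cube_def)
      then show ?thesis unfolding v add_divide_distrib by linarith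
    qed
  qed auto
  moreover have "infnorm (b - c) < s"
    using infnorm_le_norm[of "b - c"] norm_triangle_ineq4[of b c] x'(2) y'(2) e(2) by linarith
  moreover have "infnorm (y' - x') \<le> infnorm (y - x) + infnorm (b - c)"
    using infnorm_triangle[of "y - x" "b - c"] by (simp add: x'(3) y'(3))
  ultimately have d: "infnorm ((y' + a) - (x' + a)) < \<eta> / 2" by (simp add: s_def)
  moreover have "x' + a \<in> supp \<Lambda>" "y' + a \<in> supp \<Lambda>" using x'(1) y'(1) by (auto simp: mem_shift supp_def)
  moreover have "infnorm ((x' + a) - (x' + a)) < \<eta> / 2"
    using d infnorm_pos_le[of "(y' + a) - (x' + a)"] by (simp add: infnorm_0)
  ultimately have "x' + a = y' + a" using sep by blast
  then have "x - y = b - c" by (simp add: x'(3) y'(3))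
  then show False
    using norm_triangle_ineq4[of b c] x'(2) y'(2) e(3) by (simp add: dist_norm)
qed

lemma coloured_cube_subset_box:
  assumes "C \<in> coloured_cubes m" shows "fst C \<subseteq> box_of m"
proof
  fix x assume x: "x \<in> fst C"
  obtain k where k: "fst C = grid_cube m k" "\<And>j. -(4 ^ m) \<le> k j" "\<And>j. k j < 4 ^ m"
    using assms by (auto simp: coloured_cubes_def)
  have "-(2 ^ m) \<le> x $ j \<and> x $ j < 2 ^ m" for j
  proof -
    have f: "(4::real) ^ m = 2 ^ m * 2 ^ m" by (simp flip: power_mult_distrib)
    have "-(4 ^ m) \<le> real_of_int (k j)" "real_of_int (k j) + 1 \<le> 4 ^ m"
      using k(2)[of j] k(3)[of j] of_int_le_iff[of "-(4 ^ m)" "k j", where 'a = real]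
        of_int_le_iff[of "k j + 1" "4 ^ m", where 'a = real] by simp_all
    then have "-(2 ^ m) \<le> real_of_int (k j) / 2 ^ m" "(real_of_int (k j) + 1) / 2 ^ m \<le> 2 ^ m"
      unfolding f by (simp_all add: pos_le_divide_eq pos_divide_le_eq)
    moreover have "real_of_int (k j) / 2 ^ m \<le> x $ j" "x $ j < (real_of_int (k j) + 1) / 2 ^ m"
      using x unfolding k grid_cube_def by blast+
    ultimately show ?thesis by linarith
  qed
  then show "x \<in> box_of m" by (simp add: box_of_def)
qed

lemma bounded_box_of: "bounded (box_of m)"
  by (rule bounded_subset[OF bounded_cbox[of "\<chi> j. -(2 ^ m)" "\<chi> j. 2 ^ m"]])
    (simp add: box_of_def mem_box_cart subset_iff less_imp_le)

text \<open>Bounded parts of a hull element are finite, and a cube holds at most one point of each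
  colour, so of the conditions on a cube pattern only the list of hit cubes remains.\<close>

lemma mem_grid_cylinder_iff:
  fixes \<Lambda> \<Gamma> :: "('d::finite, 'k::finite) kset"
  assumes \<Lambda>: "delone_kset \<Lambda>" and \<Gamma>: "\<Gamma> \<in> hull_of \<Lambda>"
    and sep: "\<And>c x y. \<lbrakk>x \<in> supp \<Lambda>; y \<in> supp \<Lambda>; infnorm (x - c) < \<eta> / 2; infnorm (y - c) < \<eta> / 2\<rbrakk> \<Longrightarrow> x = y"
    and m: "1 / 2 ^ m < \<eta> / 2" and S: "S \<subseteq> coloured_cubes m"
  shows "\<Gamma> \<in> grid_cylinder \<Lambda> m S \<longleftrightarrow> has_pattern m S \<Gamma>"
proof -
  let ?P = "coloured_points \<Gamma> \<inter> box_of m \<times> UNIV"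
  have P: "p \<in> ?P \<inter> fst C \<times> {snd C} \<longleftrightarrow> snd p = snd C \<and> fst p \<in> \<Gamma> (snd C) \<inter> fst C"
    if "C \<in> coloured_cubes m" for C p
    using coloured_cube_subset_box[OF that] by (cases p) (auto simp: coloured_points_def)
  have "finite ?P"
  proof (rule finite_subset)
    show "?P \<subseteq> (\<Union>i. (\<lambda>x. (x, i)) ` (\<Gamma> i \<inter> box_of m))" by (auto simp: coloured_points_def)
    have "delone_kset \<Gamma>" using \<Gamma> mem_hull_iff[OF \<Lambda>] by blast
    then show "finite (\<Union>i. (\<lambda>x. (x, i)) ` (\<Gamma> i \<inter> box_of m))"
      by (intro finite_UN_I finite_imageI uniform_discrete_finite_Int_bounded kset_uniform_discrete bounded_box_of) simp
  qed
  then have "\<Gamma> \<in> grid_cylinder \<Lambda> m S \<longleftrightarrow> (\<forall>C\<in>S. \<exists>!p. p \<in> ?P \<inter> fst C \<times> {snd C}) \<and>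
      (\<forall>C\<in>coloured_cubes m - S. ?P \<inter> fst C \<times> {snd C} = {})"
    using \<Gamma> unfolding grid_cylinder_def cube_patterns_def by blast
  also have "(\<forall>C\<in>S. \<exists>!p. p \<in> ?P \<inter> fst C \<times> {snd C}) \<longleftrightarrow> (\<forall>C\<in>S. \<Gamma> (snd C) \<inter> fst C \<noteq> {})"
  proof (rule ball_cong[OF refl])
    fix C assume "C \<in> S"
    then have C: "C \<in> coloured_cubes m" using S by blast
    obtain k where k: "fst C = grid_cube m k" using C by (rule coloured_cubesE)
    have uniq: "x = y" if "x \<in> \<Gamma> (snd C) \<inter> fst C" "y \<in> \<Gamma> (snd C) \<inter> fst C" for x y
    proof (rule hull_at_most_one_point[OF \<Lambda> \<Gamma> _ m])
      show "x' = y'" if "x' \<in> supp \<Lambda>" "y' \<in> supp \<Lambda>" "infnorm (x' - c) < \<eta> / 2" "infnorm (y' - c) < \<eta> / 2"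
        for c x' y' using that by (rule sep)
      show "x \<in> \<Gamma> (snd C)" "x \<in> grid_cube m k" "y \<in> \<Gamma> (snd C)" "y \<in> grid_cube m k"
        using that unfolding k by blast+
    qed
    show "(\<exists>!p. p \<in> ?P \<inter> fst C \<times> {snd C}) \<longleftrightarrow> \<Gamma> (snd C) \<inter> fst C \<noteq> {}"
    proof
      assume "\<exists>!p. p \<in> ?P \<inter> fst C \<times> {snd C}"
      then show "\<Gamma> (snd C) \<inter> fst C \<noteq> {}" unfolding P[OF C] by blast
    next
      assume "\<Gamma> (snd C) \<inter> fst C \<noteq> {}"
      then obtain x where x: "x \<in> \<Gamma> (snd C) \<inter> fst C" by blast
      show "\<exists>!p. p \<in> ?P \<inter> fst C \<times> {snd C}"
        unfolding P[OF C] using x uniq by (intro ex1I[of _ "(x, snd C)"]) (auto simp: prod_eq_iff)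
    qed
  qed
  also have "(\<forall>C\<in>coloured_cubes m - S. ?P \<inter> fst C \<times> {snd C} = {}) \<longleftrightarrow>
      (\<forall>C\<in>coloured_cubes m - S. \<Gamma> (snd C) \<inter> fst C = {})"
  proof (rule ball_cong[OF refl])
    fix C assume "C \<in> coloured_cubes m - S"
    then have C: "C \<in> coloured_cubes m" by blast
    show "?P \<inter> fst C \<times> {snd C} = {} \<longleftrightarrow> \<Gamma> (snd C) \<inter> fst C = {}"
    proof
      assume *: "?P \<inter> fst C \<times> {snd C} = {}"
      have "x \<notin> \<Gamma> (snd C) \<inter> fst C" for x using P[OF C, of "(x, snd C)"] unfolding * by simp
      then show "\<Gamma> (snd C) \<inter> fst C = {}" by blast
    next
      assume *: "\<Gamma> (snd C) \<inter> fst C = {}"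
      show "?P \<inter> fst C \<times> {snd C} = {}" using P[OF C] unfolding * by blast
    qed
  qed
  finally show ?thesis using S unfolding has_pattern_def by blast
qed

section \<open>Limits of pattern occurrences\<close>

text \<open>When h n stays below g in every coordinate, y - h n approaches y - g from above, and the
  cubes are closed on the lower and open on the upper side.\<close>

lemma grid_cube_left_continuous:
  assumes h: "h \<longlonglongrightarrow> g" and le: "\<And>n j. h n $ j \<le> g $ j"
  shows "\<forall>\<^sub>F n in sequentially. y - h n \<in> grid_cube m k \<longleftrightarrow> y - g \<in> grid_cube m k"
proof -
  have "\<forall>\<^sub>F n in sequentially. (a \<le> (y - h n) $ j \<and> (y - h n) $ j < b) \<longleftrightarrow> (a \<le> (y - g) $ j \<and> (y - g) $ j < b)"
    for a b j
  proof -
    have lim: "(\<lambda>n. (y - h n) $ j) \<longlonglongrightarrow> (y - g) $ j" by (intro tendsto_intros h)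
    have ge: "(y - g) $ j \<le> (y - h n) $ j" for n using le by simp
    consider "(y - g) $ j < a" | "a \<le> (y - g) $ j" "(y - g) $ j < b" | "b \<le> (y - g) $ j" by linarith
    then show ?thesis
    proof cases
      case 1
      show ?thesis using order_tendstoD(2)[OF lim 1] by eventually_elim (use 1 in linarith)
    next
      case 2
      show ?thesis using order_tendstoD(2)[OF lim 2(2)] by eventually_elim (use 2 ge in \<open>meson order_trans\<close>)
    next
      case 3
      show ?thesis by (rule always_eventually) (use 3 ge in \<open>meson leD order_trans\<close>)
    qed
  qed
  then have "\<forall>\<^sub>F n in sequentially. \<forall>j. (of_int (k j) / 2 ^ m \<le> (y - h n) $ j \<and> (y - h n) $ j < (of_int (k j) + 1) / 2 ^ m)
      \<longleftrightarrow> (of_int (k j) / 2 ^ m \<le> (y - g) $ j \<and> (y - g) $ j < (of_int (k j) + 1) / 2 ^ m)"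
    by (intro eventually_all_finite)
  then show ?thesis unfolding grid_cube_def mem_Collect_eq by (rule eventually_mono) blast
qed

text \<open>For positions within distance 1 of g only finitely many points of \<Gamma> can enter a
  cube, so finitely many eventual statements are combined.\<close>

lemma has_pattern_left_continuous:
  fixes \<Gamma> :: "('d::finite, 'k::finite) kset"
  assumes \<Gamma>: "\<And>i. uniform_discrete (\<Gamma> i)" and h: "h \<longlonglongrightarrow> g" and le: "\<And>n j. h n $ j \<le> g $ j"
  shows "\<forall>\<^sub>F n in sequentially. has_pattern m S (shift (h n) \<Gamma>) \<longleftrightarrow> has_pattern m S (shift g \<Gamma>)"
proof -
  obtain \<rho> where \<rho>: "\<And>C. C \<in> (coloured_cubes m :: ((real ^ 'd) set \<times> 'k) set) \<Longrightarrow> fst C \<subseteq> ball 0 \<rho>"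
    using coloured_cubes_radius[of m] by metis
  have "\<forall>\<^sub>F n in sequentially. \<forall>C\<in>(coloured_cubes m :: ((real ^ 'd) set \<times> 'k) set).
      shift (h n) \<Gamma> (snd C) \<inter> fst C \<noteq> {} \<longleftrightarrow> shift g \<Gamma> (snd C) \<inter> fst C \<noteq> {}"
  proof (intro eventually_ball_finite finite_coloured_cubes ballI)
    fix C :: "(real ^ 'd) set \<times> 'k" assume C: "C \<in> coloured_cubes m"
    obtain k where k: "fst C = grid_cube m k" using C by (rule coloured_cubesE)
    define Y where "Y = \<Gamma> (snd C) \<inter> ball g (\<rho> + 1)"
    have "finite Y" unfolding Y_def by (intro uniform_discrete_finite_Int_bounded \<Gamma> bounded_ball)
    then have 1: "\<forall>\<^sub>F n in sequentially. \<forall>y\<in>Y. y - h n \<in> fst C \<longleftrightarrow> y - g \<in> fst C"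
      unfolding k by (intro eventually_ball_finite ballI grid_cube_left_continuous h le)
    have 2: "\<forall>\<^sub>F n in sequentially. dist (h n) g < 1" using tendstoD[OF h, of 1] by simp
    have mem: "(shift u \<Gamma> (snd C) \<inter> fst C \<noteq> {}) \<longleftrightarrow> (\<exists>y\<in>Y. y - u \<in> fst C)" if u: "dist u g < 1" for u
    proof -
      have "y \<in> ball g (\<rho> + 1)" if "y - u \<in> fst C" for y
        using \<rho>[OF C] that u dist_triangle[of g y u] by (force simp: dist_norm norm_minus_commute)
      then show ?thesis unfolding shift_def Y_def by blast
    qed
    show "\<forall>\<^sub>F n in sequentially. shift (h n) \<Gamma> (snd C) \<inter> fst C \<noteq> {} \<longleftrightarrow> shift g \<Gamma> (snd C) \<inter> fst C \<noteq> {}"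
      using 1 2
    proof eventually_elim
      case (elim n)
      then show ?case using mem[of "h n"] mem[of g] by simp
    qed
  qed
  then show ?thesis unfolding has_pattern_def by (rule eventually_mono) simp
qed

section \<open>Dyadic approximation of positions from below\<close>

definition dyadic_index :: "nat \<Rightarrow> real ^ 'd \<Rightarrow> 'd::finite \<Rightarrow> int" where
  "dyadic_index n g = (\<lambda>j. \<lfloor>2 ^ n * g $ j\<rfloor>)"

definition dyadic_point :: "nat \<Rightarrow> ('d::finite \<Rightarrow> int) \<Rightarrow> real ^ 'd" where
  "dyadic_point n k = (\<chi> j. of_int (k j) / 2 ^ n)"

lemma dyadic_index_vimage: "dyadic_index n -` {k} = grid_cube n k"
proof -
  have "\<lfloor>2 ^ n * x\<rfloor> = l \<longleftrightarrow> of_int l / 2 ^ n \<le> x \<and> x < (of_int l + 1) / 2 ^ n" for x :: real and l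
    by (simp add: floor_eq_iff pos_divide_le_eq pos_less_divide_eq mult.commute)
  then show ?thesis unfolding dyadic_index_def grid_cube_def by (auto simp: fun_eq_iff)
qed

lemma measurable_dyadic_index: "dyadic_index n \<in> measurable borel (count_space UNIV)"
  by (subst measurable_count_space_eq2_countable)
    (auto simp: dyadic_index_vimage grid_cube_borel)

lemma dyadic_point_le: "dyadic_point n (dyadic_index n g) $ j \<le> g $ j"
  by (simp add: dyadic_point_def dyadic_index_def pos_divide_le_eq mult.commute)

lemma dyadic_point_tendsto: "(\<lambda>n. dyadic_point n (dyadic_index n g)) \<longlonglongrightarrow> g"
proof (rule vec_tendstoI)
  fix j
  show "(\<lambda>n. dyadic_point n (dyadic_index n g) $ j) \<longlonglongrightarrow> g $ j"
  proof (rule tendsto_sandwich)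
    have "(\<lambda>n. g $ j - (1 / 2) ^ n) \<longlonglongrightarrow> g $ j - 0"
      by (intro tendsto_intros LIMSEQ_realpow_zero) auto
    then show "(\<lambda>n. g $ j - (1 / 2) ^ n) \<longlonglongrightarrow> g $ j" by simp
    show "\<forall>\<^sub>F n in sequentially. g $ j - (1 / 2) ^ n \<le> dyadic_point n (dyadic_index n g) $ j"
    proof (intro always_eventually allI)
      fix n
      have "(2 ^ n * g $ j - 1) / 2 ^ n \<le> of_int \<lfloor>2 ^ n * g $ j\<rfloor> / 2 ^ n"
        by (intro divide_right_mono) (linarith, simp)
      then show "g $ j - (1 / 2) ^ n \<le> dyadic_point n (dyadic_index n g) $ j"
        by (simp add: dyadic_point_def dyadic_index_def diff_divide_distrib power_one_over)
    qed
  qed (auto simp: dyadic_point_le)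
qed

section \<open>Patterns along a sequence approaching a hull element\<close>

lemma grid_cube_between_boxes:
  obtains l u where "box l u \<subseteq> grid_cube m k" "grid_cube m k \<subseteq> cbox l u"
proof
  show "box (\<chi> j. of_int (k j) / 2 ^ m) (\<chi> j. (of_int (k j) + 1) / 2 ^ m) \<subseteq> grid_cube m k"
    "grid_cube m k \<subseteq> cbox (\<chi> j. of_int (k j) / 2 ^ m) (\<chi> j. (of_int (k j) + 1) / 2 ^ m)"
    by (simp_all add: grid_cube_def mem_box_cart subset_iff less_imp_le)
qed

text \<open>Outside the null set of positions that put a point of \<open>\<Gamma> i\<close> on the
  boundary of the box, two cases remain. A point in the open box survives small perturbations; a
  closed box without points has positive distance from them. Both are stable along X. Admitting any
  B between the open and the closed box covers the half-open cubes.\<close>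

lemma near_sequence_meets_cube_AE:
  fixes \<Gamma> :: "('d::finite, 'k::finite) kset"
  assumes \<Gamma>: "uniform_discrete (\<Gamma> i)" and B: "box l u \<subseteq> B" "B \<subseteq> cbox l u"
    and near: "\<And>n. near (1 / real (Suc n)) \<Gamma> (X n)" "\<And>n. near (1 / real (Suc n)) (X n) \<Gamma>"
  shows "AE g in lebesgue. \<forall>\<^sub>F n in sequentially. shift g (X n) i \<inter> B \<noteq> {} \<longleftrightarrow> shift g \<Gamma> i \<inter> B \<noteq> {}"
proof -
  define N where "N = (\<Union>y\<in>\<Gamma> i. cbox (y - u) (y - l) - box (y - u) (y - l))"
  have "negligible N"
    unfolding N_def using uniform_discrete_countable[OF \<Gamma>] negligible_frontier_interval
    by (intro negligible_countable_Union) auto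
  moreover have "\<forall>\<^sub>F n in sequentially. shift g (X n) i \<inter> B \<noteq> {} \<longleftrightarrow> shift g \<Gamma> i \<inter> B \<noteq> {}"
    if g: "g \<notin> N" for g
  proof (cases "\<exists>y\<in>\<Gamma> i. y - g \<in> box l u")
    case True
    then obtain y where y: "y \<in> \<Gamma> i" "y - g \<in> box l u" by blast
    then obtain e where e: "e > 0" "ball (y - g) e \<subseteq> box l u"
      using open_contains_ball[of "box l u"] by (metis open_box)
    obtain N where N: "real N > norm y" "real N > 1 / e"
      using reals_Archimedean2[of "max (norm y) (1 / e)"] by auto
    have "shift g (X n) i \<inter> B \<noteq> {}" if n: "n \<ge> N" for n
    proof -
      have "y \<in> ball 0 (1 / (1 / real (Suc n))) \<inter> \<Gamma> i" using y N n by simp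
      then obtain x b where x: "x \<in> X n i" "b \<in> ball 0 (1 / real (Suc n))" "y = x + b"
        using near(2)[of n] unfolding near_def by blast
      have "1 / e < real (Suc n)" using N n by simp
      then have "1 / real (Suc n) < e" using e(1) by (simp add: field_simps)
      then have "norm b < e" using x(2) by simp
      then have "x - g \<in> ball (y - g) e" using x(3) by (simp add: dist_norm)
      then have "x - g \<in> B" using e B by blast
      then show ?thesis using x(1) unfolding shift_def by blast
    qed
    moreover have "shift g \<Gamma> i \<inter> B \<noteq> {}" using y B unfolding shift_def by blast
    ultimately show ?thesis unfolding eventually_sequentially by blast
  next
    case False
    have out: "y - g \<notin> cbox l u" if y: "y \<in> \<Gamma> i" for y
    proof
      assume "y - g \<in> cbox l u"
      moreover have "y - g \<notin> box l u" using False y by blast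
      moreover have "y - g \<in> cbox l u \<longleftrightarrow> g \<in> cbox (y - u) (y - l)" "y - g \<in> box l u \<longleftrightarrow> g \<in> box (y - u) (y - l)"
        by (auto simp: mem_box_cart algebra_simps)
      ultimately show False using g y unfolding N_def by blast
    qed
    define W where "W = cbox (l + g) (u + g)"
    have W: "x \<in> W \<longleftrightarrow> x - g \<in> cbox l u" for x unfolding W_def by (auto simp: mem_box_cart algebra_simps)
    have "compact W" by (simp add: W_def)
    moreover have "closed (\<Gamma> i)" by (rule uniform_discrete_imp_closed[OF \<Gamma>])
    moreover have "W \<inter> \<Gamma> i = {}" using out W by blast
    ultimately obtain d where d: "d > 0" "\<And>x y. x \<in> W \<Longrightarrow> y \<in> \<Gamma> i \<Longrightarrow> d \<le> dist x y"
      using separate_compact_closed by metis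
    obtain c where c: "\<And>x. x \<in> W \<Longrightarrow> norm x \<le> c"
      using compact_imp_bounded[OF \<open>compact W\<close>] bounded_iff by metis
    obtain N where N: "real N > c" "real N > 1 / d"
      using reals_Archimedean2[of "max c (1 / d)"] by auto
    have "shift g (X n) i \<inter> B = {}" if n: "n \<ge> N" for n
    proof (rule ccontr)
      assume "shift g (X n) i \<inter> B \<noteq> {}"
      then obtain x where x: "x \<in> X n i" "x - g \<in> B" unfolding shift_def by blast
      then have xW: "x \<in> W" using W B by blast
      then have "norm x \<le> c" by (rule c)
      then have "x \<in> ball 0 (1 / (1 / real (Suc n))) \<inter> X n i" using x N n by simp
      then obtain y b where y: "y \<in> \<Gamma> i" "b \<in> ball 0 (1 / real (Suc n))" "x = y + b"
        using near(1)[of n] unfolding near_def by blast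
      have "1 / d < real (Suc n)" using N n by simp
      then have "1 / real (Suc n) < d" using d(1) by (simp add: field_simps)
      then have "dist x y < d" using y by (simp add: dist_norm)
      then show False using d(2)[OF xW y(1)] by simp
    qed
    moreover have "shift g \<Gamma> i \<inter> B = {}" using out B unfolding shift_def by blast
    ultimately show ?thesis unfolding eventually_sequentially by blast
  qed
  ultimately show ?thesis
    by (intro AE_I'[of N]) (auto simp: negligible_iff_null_sets)
qed

lemma has_pattern_near_sequence_AE:
  fixes \<Gamma> :: "('d::finite, 'k::finite) kset"
  assumes \<Gamma>: "\<And>i. uniform_discrete (\<Gamma> i)"
    and near: "\<And>n. near (1 / real (Suc n)) \<Gamma> (X n)" "\<And>n. near (1 / real (Suc n)) (X n) \<Gamma>"
  shows "AE g in lebesgue. \<forall>\<^sub>F n in sequentially. has_pattern m S (shift g (X n)) \<longleftrightarrow> has_pattern m S (shift g \<Gamma>)"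
proof -
  have "AE g in lebesgue. \<forall>C\<in>(coloured_cubes m :: ((real ^ 'd) set \<times> 'k) set).
    \<forall>\<^sub>F n in sequentially. shift g (X n) (snd C) \<inter> fst C \<noteq> {} \<longleftrightarrow> shift g \<Gamma> (snd C) \<inter> fst C \<noteq> {}"
  proof (intro AE_finite_allI finite_coloured_cubes)
    fix C :: "(real ^ 'd) set \<times> 'k" assume "C \<in> coloured_cubes m"
    then obtain k where k: "fst C = grid_cube m k" by (rule coloured_cubesE)
    obtain l u where "box l u \<subseteq> fst C" "fst C \<subseteq> cbox l u"
      using grid_cube_between_boxes[of m k] unfolding k by metis
    then show "AE g in lebesgue. \<forall>\<^sub>F n in sequentially.
        shift g (X n) (snd C) \<inter> fst C \<noteq> {} \<longleftrightarrow> shift g \<Gamma> (snd C) \<inter> fst C \<noteq> {}"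
      using \<Gamma> near by (intro near_sequence_meets_cube_AE) auto
  qed
  then show ?thesis
  proof eventually_elim
    case (elim g)
    then have "\<forall>\<^sub>F n in sequentially. \<forall>C\<in>(coloured_cubes m :: ((real ^ 'd) set \<times> 'k) set).
      shift g (X n) (snd C) \<inter> fst C \<noteq> {} \<longleftrightarrow> shift g \<Gamma> (snd C) \<inter> fst C \<noteq> {}"
      by (intro eventually_ball_finite finite_coloured_cubes) blast
    then show ?case unfolding has_pattern_def by (rule eventually_mono) simp
  qed
qed

lemma measure_tendsto_AE:
  fixes X :: "nat \<Rightarrow> 'a::euclidean_space set"
  assumes "\<And>n. X n \<in> lmeasurable" "Y \<in> lmeasurable" "W \<in> lmeasurable" "\<And>n. X n \<subseteq> W"
    and "AE g in lebesgue. \<forall>\<^sub>F n in sequentially. g \<in> X n \<longleftrightarrow> g \<in> Y"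
  shows "(\<lambda>n. measure lebesgue (X n)) \<longlonglongrightarrow> measure lebesgue Y"
proof -
  have "(\<lambda>n. integral\<^sup>L lebesgue (indicat_real (X n))) \<longlonglongrightarrow> integral\<^sup>L lebesgue (indicat_real Y)"
  proof (rule integral_dominated_convergence[where w = "indicat_real W"])
    show "AE x in lebesgue. (\<lambda>n. indicat_real (X n) x) \<longlonglongrightarrow> indicat_real Y x"
      using assms(5)
    proof eventually_elim
      case (elim x)
      then have "\<forall>\<^sub>F n in sequentially. indicat_real (X n) x = indicat_real Y x"
        by eventually_elim (simp add: indicator_def)
      then show ?case by (rule tendsto_eventually)
    qed
    show "AE x in lebesgue. norm (indicat_real (X n) x) \<le> indicat_real W x" for n
      using assms(4)[of n] by (intro AE_I2) (auto split: split_indicator)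
  qed (use assms in \<open>auto dest: fmeasurableD simp flip: lmeasurable_iff_integrable\<close>)
  then show ?thesis using assms by (simp add: fmeasurableD)
qed

text \<open>The case w = 0 gives the plain occurrences, so the averaging lemmas serve the upper and
  the lower bound alike.\<close>

definition pattern_pair_times ::
  "nat \<Rightarrow> ((real ^ 'd) set \<times> 'k) set \<Rightarrow> real ^ 'd \<Rightarrow> ('d::finite, 'k::finite) kset \<Rightarrow> (real ^ 'd) set" where
  "pattern_pair_times m S w \<Gamma> = {g. has_pattern m S (shift g \<Gamma>) \<and> has_pattern m S (shift (g + w) \<Gamma>)}"

lemma pattern_pair_times_borel:
  assumes "\<And>i. countable (\<Gamma> i)" shows "pattern_pair_times m S w \<Gamma> \<in> sets borel"
proof -
  have "pattern_pair_times m S w \<Gamma> = {g. has_pattern m S (shift g \<Gamma>)} \<inter> {g. has_pattern m S (shift g (shift w \<Gamma>))}"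
    by (auto simp: pattern_pair_times_def shift_shift)
  also have "\<dots> \<in> sets borel"
    by (intro sets.Int has_pattern_borel) (use assms in \<open>simp_all add: shift_def\<close>)
  finally show ?thesis .
qed

lemma pattern_pair_times_shift:
  "pattern_pair_times m S w (shift a \<Gamma>) \<inter> ball 0 L = (\<lambda>x. x - a) ` (pattern_pair_times m S w \<Gamma> \<inter> ball a L)"
proof (rule set_eqI)
  fix g
  have "g \<in> (\<lambda>x. x - a) ` (pattern_pair_times m S w \<Gamma> \<inter> ball a L) \<longleftrightarrow> g + a \<in> pattern_pair_times m S w \<Gamma> \<inter> ball a L"
    by (metis (no_types, lifting) add_diff_cancel diff_add_cancel image_iff)
  then show "g \<in> pattern_pair_times m S w (shift a \<Gamma>) \<inter> ball 0 L \<longleftrightarrow>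
    g \<in> (\<lambda>x. x - a) ` (pattern_pair_times m S w \<Gamma> \<inter> ball a L)"
    by (simp add: pattern_pair_times_def shift_shift dist_norm algebra_simps)
qed

text \<open>Translates of \<Lambda> approaching \<Gamma> eventually show the same patterns at almost
  every position, and dominated convergence carries this over to volumes. Bounds for \<Lambda> that
  are uniform in the centre of the window thus pass to \<Gamma>.\<close>

lemma hull_pattern_pair_times_limit:
  fixes \<Lambda> \<Gamma> :: "('d::finite, 'k::finite) kset"
  assumes \<Lambda>: "delone_kset \<Lambda>" and \<Gamma>: "\<Gamma> \<in> hull_of \<Lambda>"
  obtains a where "(\<lambda>n. measure lebesgue (pattern_pair_times m S w \<Lambda> \<inter> ball (a n) L))
    \<longlonglongrightarrow> measure lebesgue (pattern_pair_times m S w \<Gamma> \<inter> ball 0 L)"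
proof -
  have "delone_kset \<Gamma>" and "\<forall>n. \<exists>a. near (1 / real (Suc n)) \<Gamma> (shift a \<Lambda>) \<and> near (1 / real (Suc n)) (shift a \<Lambda>) \<Gamma>"
    using \<Gamma> unfolding mem_hull_iff[OF \<Lambda>] by simp_all
  then obtain a where a: "\<And>n. near (1 / real (Suc n)) \<Gamma> (shift (a n) \<Lambda>)" "\<And>n. near (1 / real (Suc n)) (shift (a n) \<Lambda>) \<Gamma>"
    by metis
  have ud: "uniform_discrete (\<Gamma> i)" for i using \<open>delone_kset \<Gamma>\<close> by (rule kset_uniform_discrete)
  have meas: "pattern_pair_times m S w X \<inter> ball 0 L \<in> lmeasurable" if "delone_kset X" for X :: "('d, 'k) kset"
    by (intro lmeasurable_bounded_borel sets.Int pattern_pair_times_borel uniform_discrete_countable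
        kset_uniform_discrete that) (auto simp: bounded_Int)
  have *: "AE g in lebesgue. \<forall>\<^sub>F n in sequentially.
      has_pattern m S (shift g (shift (a n) \<Lambda>)) \<longleftrightarrow> has_pattern m S (shift g \<Gamma>)"
    by (rule has_pattern_near_sequence_AE[OF ud a])
  have "AE g in lebesgue. \<forall>\<^sub>F n in sequentially.
      has_pattern m S (shift (g + w) (shift (a n) \<Lambda>)) \<longleftrightarrow> has_pattern m S (shift (g + w) \<Gamma>)"
  proof -
    \<comment> \<open>For the second pattern the exceptional positions lie in the same null set
      translated by - w.\<close>
    obtain N where N: "N \<in> null_sets lebesgue" "\<And>g. g \<notin> N \<Longrightarrow> \<forall>\<^sub>F n in sequentially.
      has_pattern m S (shift g (shift (a n) \<Lambda>)) \<longleftrightarrow> has_pattern m S (shift g \<Gamma>)"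
      using AE_E3[OF *] by (metis Diff_iff UNIV_I space_borel space_completion space_lborel)
    have "negligible ((\<lambda>x. x - w) ` N)"
      using N(1) negligible_translation[of N "- w"] by (simp add: negligible_iff_null_sets)
    moreover have "g + w \<notin> N" if "g \<notin> (\<lambda>x. x - w) ` N" for g
      using that image_eqI[of g "\<lambda>x. x - w" "g + w" N] by auto
    ultimately show ?thesis
      using N(2) by (intro AE_I'[of "(\<lambda>x. x - w) ` N"]) (auto simp: negligible_iff_null_sets)
  qed
  with * have "AE g in lebesgue. \<forall>\<^sub>F n in sequentially.
      g \<in> pattern_pair_times m S w (shift (a n) \<Lambda>) \<inter> ball 0 L \<longleftrightarrow> g \<in> pattern_pair_times m S w \<Gamma> \<inter> ball 0 L"
  proof eventually_elim
    case (elim g)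
    then show ?case by eventually_elim (simp add: pattern_pair_times_def)
  qed
  then have "(\<lambda>n. measure lebesgue (pattern_pair_times m S w (shift (a n) \<Lambda>) \<inter> ball 0 L))
      \<longlonglongrightarrow> measure lebesgue (pattern_pair_times m S w \<Gamma> \<inter> ball 0 L)"
    by (intro measure_tendsto_AE[where W = "ball 0 L"] meas delone_kset_shift \<Lambda> \<open>delone_kset \<Gamma>\<close>) auto
  then show ?thesis
    using that unfolding pattern_pair_times_shift measure_translation_subtract by blast
qed

section \<open>Averaging over the hull\<close>

lemma space_invariant_probability:
  assumes "invariant_probability \<Lambda> \<mu>" shows "space \<mu> = hull_of \<Lambda>"
proof -
  have "sets \<mu> = sets (hull_borel \<Lambda>)" using assms by (simp add: invariant_probability_def)
  then have "space \<mu> = space (hull_borel \<Lambda>)" by (rule sets_eq_imp_space_eq)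
  then show ?thesis by (simp add: hull_borel_def space_measure_of_conv)
qed

text \<open>The invariance equation forces preimages of sets of positive measure to be measurable, since
  \<open>emeasure\<close> vanishes off the measurable sets.\<close>

lemma invariant_probability_vimage:
  assumes "invariant_probability \<Lambda> \<mu>" "E \<in> sets \<mu>"
  shows "emeasure \<mu> (shift g -` E \<inter> space \<mu>) = emeasure \<mu> E"
    and "emeasure \<mu> E > 0 \<Longrightarrow> shift g -` E \<inter> space \<mu> \<in> sets \<mu>"
proof -
  show eq: "emeasure \<mu> (shift g -` E \<inter> space \<mu>) = emeasure \<mu> E"
    using assms by (simp add: invariant_probability_def)
  then show "emeasure \<mu> E > 0 \<Longrightarrow> shift g -` E \<inter> space \<mu> \<in> sets \<mu>"
    using emeasure_notin_sets by fastforce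
qed

text \<open>Left continuity approximates \<open>g\<close> by dyadic points, so that only countably many shifts enter.\<close>

lemma pattern_pair_times_measurable:
  fixes \<Lambda> :: "('d::finite, 'k::finite) kset" and \<mu> :: "('d, 'k) kset measure"
  assumes \<Lambda>: "delone_kset \<Lambda>" and inv: "invariant_probability \<Lambda> \<mu>"
    and E: "\<And>g. {\<Gamma> \<in> space \<mu>. has_pattern m S (shift g \<Gamma>)} \<in> sets \<mu>"
  shows "Measurable.pred (\<mu> \<Otimes>\<^sub>M borel) (\<lambda>x. snd x \<in> pattern_pair_times m S w (fst x))"
proof -
  define R where "R g \<Gamma> \<longleftrightarrow> g \<in> pattern_pair_times m S w \<Gamma>" for g and \<Gamma> :: "('d, 'k) kset"
  have R: "Measurable.pred \<mu> (R g)" for g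
    unfolding R_def pattern_pair_times_def mem_Collect_eq
    by (intro pred_intros_logic) (simp_all add: pred_def E)
  have step: "Measurable.pred (\<mu> \<Otimes>\<^sub>M borel) (\<lambda>x. R (dyadic_point n (dyadic_index n (snd x))) (fst x))" for n
  proof (rule measurable_compose_countable[where g = "\<lambda>x. dyadic_index n (snd x)" and
        f = "\<lambda>k x. R (dyadic_point n k) (fst x)"])
    show "Measurable.pred (\<mu> \<Otimes>\<^sub>M borel) (\<lambda>x. R (dyadic_point n k) (fst x))" for k
      by (rule measurable_compose[OF measurable_fst R])
    show "(\<lambda>x. dyadic_index n (snd x)) \<in> measurable (\<mu> \<Otimes>\<^sub>M borel) (count_space UNIV)"
      by (rule measurable_compose[OF measurable_snd measurable_dyadic_index])
  qed
  \<comment> \<open>Membership is eventually constant along the dyadic approximations from below, so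
    it equals a countable combination of measurable conditions.\<close>
  have "R (snd x) (fst x) \<longleftrightarrow> (\<exists>N. \<forall>n\<ge>N. R (dyadic_point n (dyadic_index n (snd x))) (fst x))"
    if x: "x \<in> space (\<mu> \<Otimes>\<^sub>M borel)" for x
  proof -
    have "fst x \<in> hull_of \<Lambda>"
      using x unfolding space_pair_measure space_invariant_probability[OF inv] by (metis mem_Times_iff)
    then have ud: "uniform_discrete (fst x i)" for i
      unfolding mem_hull_iff[OF \<Lambda>] by (auto intro: kset_uniform_discrete)
    have lim: "(\<lambda>n. dyadic_point n (dyadic_index n (snd x)) + v) \<longlonglongrightarrow> snd x + v" for v
      by (intro tendsto_intros dyadic_point_tendsto)
    have "\<forall>\<^sub>F n in sequentially. has_pattern m S (shift (dyadic_point n (dyadic_index n (snd x)) + v) (fst x))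
        \<longleftrightarrow> has_pattern m S (shift (snd x + v) (fst x))" for v
      by (rule has_pattern_left_continuous[OF ud lim]) (simp add: dyadic_point_le)
    from this[of 0] this[of w]
    have "\<forall>\<^sub>F n in sequentially. R (dyadic_point n (dyadic_index n (snd x))) (fst x) \<longleftrightarrow> R (snd x) (fst x)"
      unfolding R_def pattern_pair_times_def by eventually_elim simp
    then obtain N where N: "\<And>n. n \<ge> N \<Longrightarrow> R (dyadic_point n (dyadic_index n (snd x))) (fst x) \<longleftrightarrow> R (snd x) (fst x)"
      by (auto simp: eventually_sequentially)
    show ?thesis
    proof
      assume "R (snd x) (fst x)"
      then show "\<exists>N. \<forall>n\<ge>N. R (dyadic_point n (dyadic_index n (snd x))) (fst x)" using N by blast
    next
      assume "\<exists>N. \<forall>n\<ge>N. R (dyadic_point n (dyadic_index n (snd x))) (fst x)"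
      then obtain N' where "\<And>n. n \<ge> N' \<Longrightarrow> R (dyadic_point n (dyadic_index n (snd x))) (fst x)" by blast
      from this[of "max N N'"] N[of "max N N'"] show "R (snd x) (fst x)" by simp
    qed
  qed
  then have "Measurable.pred (\<mu> \<Otimes>\<^sub>M borel) (\<lambda>x. R (snd x) (fst x)) \<longleftrightarrow>
    Measurable.pred (\<mu> \<Otimes>\<^sub>M borel) (\<lambda>x. \<exists>N. \<forall>n\<ge>N. R (dyadic_point n (dyadic_index n (snd x))) (fst x))"
    by (rule measurable_cong)
  moreover have "Measurable.pred (\<mu> \<Otimes>\<^sub>M borel) (\<lambda>x. \<exists>N. \<forall>n\<ge>N. R (dyadic_point n (dyadic_index n (snd x))) (fst x))"
    by (rule pred_intros_countable(2), rule pred_intros_countable(1), rule pred_intros_imp'(1), rule step)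
  ultimately have "Measurable.pred (\<mu> \<Otimes>\<^sub>M borel) (\<lambda>x. R (snd x) (fst x))" by (rule iffD2)
  then show ?thesis unfolding R_def .
qed

text \<open>Fubini: for fixed g, the hull elements having g among their pair times form the preimage
  of the pair event under \<open>shift g\<close>, which has the same measure by invariance.
  Integration over the ball contributes its volume.\<close>

lemma integral_pattern_pair_times:
  fixes \<Lambda> :: "('d::finite, 'k::finite) kset" and \<mu> :: "('d, 'k) kset measure"
  assumes \<Lambda>: "delone_kset \<Lambda>" and inv: "invariant_probability \<Lambda> \<mu>"
    and E: "\<And>g. {\<Gamma> \<in> space \<mu>. has_pattern m S (shift g \<Gamma>)} \<in> sets \<mu>"
  shows "(\<integral>\<^sup>+ \<Gamma>. ennreal (measure lebesgue (pattern_pair_times m S w \<Gamma> \<inter> ball 0 L)) \<partial>\<mu>)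
    = ennreal (measure lebesgue (ball (0 :: real ^ 'd) L)) *
      emeasure \<mu> {\<Gamma> \<in> space \<mu>. has_pattern m S \<Gamma> \<and> has_pattern m S (shift w \<Gamma>)}"
proof -
  let ?F = "{\<Gamma> \<in> space \<mu>. has_pattern m S \<Gamma> \<and> has_pattern m S (shift w \<Gamma>)}"
  have sp: "space \<mu> = hull_of \<Lambda>" by (rule space_invariant_probability[OF inv])
  interpret finite_measure \<mu> by (rule finite_measureI) (use inv in \<open>simp add: invariant_probability_def\<close>)
  interpret pair_sigma_finite \<mu> lborel ..
  have F: "?F \<in> sets \<mu>"
  proof -
    have "?F = {\<Gamma> \<in> space \<mu>. has_pattern m S (shift 0 \<Gamma>)} \<inter> {\<Gamma> \<in> space \<mu>. has_pattern m S (shift w \<Gamma>)}"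
      by (auto simp: shift_def)
    then show ?thesis using E by simp
  qed
  define f where "f x = indicator (ball 0 L) (snd x) * (if snd x \<in> pattern_pair_times m S w (fst x) then 1 else 0 :: ennreal)"
    for x :: "('d, 'k) kset \<times> (real ^ 'd)"
  have f: "f \<in> borel_measurable (\<mu> \<Otimes>\<^sub>M lborel)"
  proof -
    have "(\<lambda>x. indicator (ball 0 L) (snd x) :: ennreal) \<in> borel_measurable (\<mu> \<Otimes>\<^sub>M borel)"
      by (rule measurable_compose[OF measurable_snd borel_measurable_indicator]) simp
    moreover have "(\<lambda>x. if snd x \<in> pattern_pair_times m S w (fst x) then 1 else 0 :: ennreal)
        \<in> borel_measurable (\<mu> \<Otimes>\<^sub>M borel)"
      using pattern_pair_times_measurable[OF assms] by (intro measurable_If measurable_const) (simp_all add: pred_def)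
    ultimately have "f \<in> borel_measurable (\<mu> \<Otimes>\<^sub>M borel)" unfolding f_def by (rule borel_measurable_times_ennreal)
    then show ?thesis by (simp cong: measurable_cong_sets)
  qed
  have "(\<integral>\<^sup>+ \<Gamma>. ennreal (measure lebesgue (pattern_pair_times m S w \<Gamma> \<inter> ball 0 L)) \<partial>\<mu>)
      = (\<integral>\<^sup>+ \<Gamma>. \<integral>\<^sup>+ g. f (\<Gamma>, g) \<partial>lborel \<partial>\<mu>)"
  proof (rule nn_integral_cong)
    fix \<Gamma> assume "\<Gamma> \<in> space \<mu>"
    then have "delone_kset \<Gamma>" using sp mem_hull_iff[OF \<Lambda>] by blast
    then have B: "pattern_pair_times m S w \<Gamma> \<inter> ball 0 L \<in> sets borel"
      by (intro sets.Int pattern_pair_times_borel uniform_discrete_countable kset_uniform_discrete) auto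
    have "(\<integral>\<^sup>+ g. f (\<Gamma>, g) \<partial>lborel) = (\<integral>\<^sup>+ g. indicator (pattern_pair_times m S w \<Gamma> \<inter> ball 0 L) g \<partial>lborel)"
      by (intro nn_integral_cong) (simp add: f_def split: split_indicator)
    also have "\<dots> = emeasure lborel (pattern_pair_times m S w \<Gamma> \<inter> ball 0 L)"
      using B by (intro nn_integral_indicator) simp
    also have "\<dots> = ennreal (measure lebesgue (pattern_pair_times m S w \<Gamma> \<inter> ball 0 L))"
      using B emeasure_bounded_finite[of "pattern_pair_times m S w \<Gamma> \<inter> ball 0 L"]
      by (simp add: emeasure_eq_ennreal_measure bounded_Int)
    finally show "ennreal (measure lebesgue (pattern_pair_times m S w \<Gamma> \<inter> ball 0 L)) = (\<integral>\<^sup>+ g. f (\<Gamma>, g) \<partial>lborel)" ..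
  qed
  also have "\<dots> = (\<integral>\<^sup>+ g. \<integral>\<^sup>+ \<Gamma>. f (\<Gamma>, g) \<partial>\<mu> \<partial>lborel)"
    using Fubini[OF f] by simp
  also have "\<dots> = (\<integral>\<^sup>+ g. indicator (ball (0 :: real ^ 'd) L) g * emeasure \<mu> ?F \<partial>lborel)"
  proof (rule nn_integral_cong)
    fix g :: "real ^ 'd"
    let ?Fg = "{\<Gamma> \<in> space \<mu>. g \<in> pattern_pair_times m S w \<Gamma>}"
    have "shift g \<Gamma> \<in> space \<mu>" if "\<Gamma> \<in> space \<mu>" for \<Gamma>
      using that unfolding sp by (rule shift_mem_hull[OF \<Lambda>])
    then have eq: "?Fg = shift g -` ?F \<inter> space \<mu>"
      by (auto simp: pattern_pair_times_def shift_shift add.commute)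
    have Fg: "?Fg \<in> sets \<mu>"
    proof -
      have "?Fg = {\<Gamma> \<in> space \<mu>. has_pattern m S (shift g \<Gamma>)} \<inter> {\<Gamma> \<in> space \<mu>. has_pattern m S (shift (g + w) \<Gamma>)}"
        by (auto simp: pattern_pair_times_def)
      then show ?thesis using E by simp
    qed
    have "(\<integral>\<^sup>+ \<Gamma>. f (\<Gamma>, g) \<partial>\<mu>) = (\<integral>\<^sup>+ \<Gamma>. indicator (ball 0 L) g * indicator ?Fg \<Gamma> \<partial>\<mu>)"
      by (intro nn_integral_cong) (simp add: f_def split: split_indicator)
    also have "\<dots> = indicator (ball 0 L) g * emeasure \<mu> ?Fg" using Fg by (rule nn_integral_cmult_indicator)
    also have "emeasure \<mu> ?Fg = emeasure \<mu> ?F" unfolding eq by (rule invariant_probability_vimage(1)[OF inv F])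
    finally show "(\<integral>\<^sup>+ \<Gamma>. f (\<Gamma>, g) \<partial>\<mu>) = indicator (ball 0 L) g * emeasure \<mu> ?F" .
  qed
  also have "\<dots> = emeasure lborel (ball (0 :: real ^ 'd) L) * emeasure \<mu> ?F"
    by (subst nn_integral_multc) (auto intro!: borel_measurable_indicator)
  also have "emeasure lborel (ball (0 :: real ^ 'd) L) = ennreal (measure lebesgue (ball (0 :: real ^ 'd) L))"
    using emeasure_bounded_finite[of "ball (0 :: real ^ 'd) L"] by (simp add: emeasure_eq_ennreal_measure)
  finally show ?thesis .
qed

text \<open>Windows of hull elements inherit the bounds as limits of windows of \<Lambda>, and
  integration against a probability measure keeps constants. One-sided bounds that are uniform in
  the centre thus play the part of frequencies.\<close>

lemma hull_average_bounds:
  fixes \<Lambda> :: "('d::finite, 'k::finite) kset" and \<mu> :: "('d, 'k) kset measure" and w :: "real ^ 'd"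
  assumes \<Lambda>: "delone_kset \<Lambda>" and inv: "invariant_probability \<Lambda> \<mu>"
    and E: "\<And>g. {\<Gamma> \<in> space \<mu>. has_pattern m S (shift g \<Gamma>)} \<in> sets \<mu>"
  defines "F \<equiv> {\<Gamma> \<in> space \<mu>. has_pattern m S \<Gamma> \<and> has_pattern m S (shift w \<Gamma>)}"
  shows "(\<And>a. measure lebesgue (pattern_pair_times m S w \<Lambda> \<inter> ball a L) \<le> U)
      \<Longrightarrow> measure lebesgue (ball (0 :: real ^ 'd) L) * measure \<mu> F \<le> U"
    and "(\<And>a. U \<le> measure lebesgue (pattern_pair_times m S w \<Lambda> \<inter> ball a L))
      \<Longrightarrow> U \<le> measure lebesgue (ball (0 :: real ^ 'd) L) * measure \<mu> F"
proof -
  interpret finite_measure \<mu> by (rule finite_measureI) (use inv in \<open>simp add: invariant_probability_def\<close>)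
  let ?V = "\<lambda>\<Gamma>. measure lebesgue (pattern_pair_times m S w \<Gamma> \<inter> ball 0 L)"
  have int: "(\<integral>\<^sup>+ \<Gamma>. ennreal (?V \<Gamma>) \<partial>\<mu>) = ennreal (measure lebesgue (ball (0 :: real ^ 'd) L) * measure \<mu> F)"
    unfolding integral_pattern_pair_times[OF \<Lambda> inv E] F_def emeasure_eq_measure
    by (simp add: ennreal_mult)
  have lim: "\<exists>a. (\<lambda>n. measure lebesgue (pattern_pair_times m S w \<Lambda> \<inter> ball (a n) L)) \<longlonglongrightarrow> ?V \<Gamma>"
    if "\<Gamma> \<in> space \<mu>" for \<Gamma>
    using hull_pattern_pair_times_limit[OF \<Lambda>] that space_invariant_probability[OF inv] by metis
  {
    assume le: "\<And>a. measure lebesgue (pattern_pair_times m S w \<Lambda> \<inter> ball a L) \<le> U"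
    have U: "U \<ge> 0" using le[of 0] by (rule order_trans[rotated]) simp
    have "?V \<Gamma> \<le> U" if \<Gamma>: "\<Gamma> \<in> space \<mu>" for \<Gamma>
    proof -
      obtain a where "(\<lambda>n. measure lebesgue (pattern_pair_times m S w \<Lambda> \<inter> ball (a n) L)) \<longlonglongrightarrow> ?V \<Gamma>"
        using lim[OF \<Gamma>] by blast
      then show ?thesis by (rule LIMSEQ_le_const2) (use le in blast)
    qed
    then have "(\<integral>\<^sup>+ \<Gamma>. ennreal (?V \<Gamma>) \<partial>\<mu>) \<le> (\<integral>\<^sup>+ \<Gamma>. ennreal U \<partial>\<mu>)"
      by (intro nn_integral_mono ennreal_leI)
    then show "measure lebesgue (ball (0 :: real ^ 'd) L) * measure \<mu> F \<le> U"
      using U inv unfolding int by (simp add: invariant_probability_def)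
  next
    assume ge: "\<And>a. U \<le> measure lebesgue (pattern_pair_times m S w \<Lambda> \<inter> ball a L)"
    have "U \<le> ?V \<Gamma>" if \<Gamma>: "\<Gamma> \<in> space \<mu>" for \<Gamma>
    proof -
      obtain a where "(\<lambda>n. measure lebesgue (pattern_pair_times m S w \<Lambda> \<inter> ball (a n) L)) \<longlonglongrightarrow> ?V \<Gamma>"
        using lim[OF \<Gamma>] by blast
      then show ?thesis by (rule LIMSEQ_le_const) (use ge in blast)
    qed
    then have "(\<integral>\<^sup>+ \<Gamma>. ennreal U \<partial>\<mu>) \<le> (\<integral>\<^sup>+ \<Gamma>. ennreal (?V \<Gamma>) \<partial>\<mu>)"
      by (intro nn_integral_mono ennreal_leI)
    then show "U \<le> measure lebesgue (ball (0 :: real ^ 'd) L) * measure \<mu> F"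
      using inv unfolding int by (simp add: invariant_probability_def)
  }
qed

section \<open>Comparison of ball volumes\<close>

lemma measure_ball_center:
  fixes a :: "'a::euclidean_space"
  shows "measure lebesgue (ball a L) = measure lebesgue (ball (0 :: 'a) L)"
  using measure_translation[of a "ball 0 L"] ball_translation[of a 0 L] by simp

text \<open>The ratio of the two volumes is the power of 1 + c / L with the dimension as exponent,
  which tends to 1. This removes the change of the windows by a constant radius.\<close>

lemma ball_volume_density_le:
  fixes \<alpha> \<beta> c :: real
  assumes "\<And>L. L > 0 \<Longrightarrow> \<alpha> * measure lebesgue (ball (0 :: 'a::euclidean_space) L)
    \<le> \<beta> * measure lebesgue (ball (0 :: 'a) (L + c))" and c: "c > 0"
  shows "\<alpha> \<le> \<beta>"
proof -
  let ?u = "measure lebesgue (ball (0 :: 'a) 1)"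
  have u: "?u > 0" by (simp add: content_ball_pos)
  have "\<alpha> \<le> \<beta> * (1 + c / real (Suc n)) ^ DIM('a)" for n
  proof -
    let ?L = "real (Suc n)"
    have "\<alpha> * (?L ^ DIM('a) * ?u) \<le> \<beta> * ((?L + c) ^ DIM('a) * ?u)"
      using assms(1)[of ?L] c content_ball_conv_unit_ball[of ?L "0 :: 'a"]
        content_ball_conv_unit_ball[of "?L + c" "0 :: 'a"] by simp
    then have "\<alpha> * ?L ^ DIM('a) \<le> \<beta> * (?L + c) ^ DIM('a)" using u by (simp flip: mult.assoc)
    also have "?L + c = ?L * (1 + c / ?L)" by (simp add: field_simps)
    finally have "\<alpha> * ?L ^ DIM('a) \<le> (\<beta> * (1 + c / ?L) ^ DIM('a)) * ?L ^ DIM('a)"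
      by (simp only: power_mult_distrib mult_ac)
    then show ?thesis by (rule mult_right_le_imp_le) simp
  qed
  moreover have "(\<lambda>n. \<beta> * (1 + c / real (Suc n)) ^ DIM('a)) \<longlonglongrightarrow> \<beta> * (1 + 0) ^ DIM('a)"
    by (intro tendsto_intros LIMSEQ_Suc lim_const_over_n)
  ultimately show ?thesis using LIMSEQ_le_const by fastforce
qed

section \<open>Legal return vectors as digit differences\<close>

context substitution_tiling
begin

text \<open>A tile is recorded only as a support with a colour, so its position must be recovered by
  injectivity of translation before the next digit is added.\<close>

lemma tile_substitution_funpow_subset:
  "(tile_substitution Q D A ^^ n) {prototile A j} \<subseteq> {translate_tile d (prototile A i) |d i. d \<in> \<D> n i j}"
proof (induction n)
  case 0
  have "prototile A j = translate_tile 0 (prototile A j)" by (simp add: translate_tile_def)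
  then show ?case by auto
next
  case (Suc n)
  show ?case
  proof
    fix T assume "T \<in> (tile_substitution Q D A ^^ Suc n) {prototile A j}"
    then obtain u x i l where T: "T = translate_tile (u + Q x) (prototile A i)" "u \<in> D i l"
      "translate_tile x (prototile A l) \<in> (tile_substitution Q D A ^^ n) {prototile A j}"
      by (auto simp: tile_substitution_def)
    then obtain d l' where d: "translate_tile x (prototile A l) = translate_tile d (prototile A l')" "d \<in> \<D> n l' j"
      using Suc by blast
    then have "l' = l" "(+) x ` A l = (+) d ` A l" by (auto simp: translate_tile_def prototile_def)
    then have "d = x" using compact_translation_inj[OF compact_A A_nonempty] by metis
    have "u + Q x \<in> \<D> (Suc n) i j"
      using T(2) d(2) unfolding \<open>l' = l\<close> \<open>d = x\<close> by (auto simp: add.commute)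
    then show "T \<in> {translate_tile d (prototile A i) |d i. d \<in> \<D> (Suc n) i j}" using T(1) by blast
  qed
qed

text \<open>The common translation of the patch cancels, and two tiles of equal colour with supports
  differing by z come from digits differing by z.\<close>

lemma Xi_legal_digits:
  assumes "z \<in> Xi_legal Q D A \<Lambda>" obtains n i j d where "d \<in> \<D> n i j" "d + z \<in> \<D> n i j"
proof -
  obtain P T T' where P: "legal Q D A P" "T \<in> P" "T' \<in> P" "T' = translate_tile z T"
    using assms unfolding Xi_legal_def by blast
  then obtain k j y P' where P': "P' \<subseteq> (tile_substitution Q D A ^^ k) {prototile A j}" "P = translate_tile y ` P'"
    unfolding legal_def by blast
  have "P' \<subseteq> {translate_tile d (prototile A i) |d i. d \<in> \<D> k i j}"
    using P'(1) tile_substitution_funpow_subset by (rule order_trans)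
  then have ex: "\<exists>d i. U = translate_tile y (translate_tile d (prototile A i)) \<and> d \<in> \<D> k i j" if "U \<in> P" for U
    using that unfolding P'(2) by blast
  obtain d i where d: "T = translate_tile y (translate_tile d (prototile A i))" "d \<in> \<D> k i j"
    using ex[OF P(2)] by auto
  obtain d' i' where d': "T' = translate_tile y (translate_tile d' (prototile A i'))" "d' \<in> \<D> k i' j"
    using ex[OF P(3)] by auto
  have "i' = i" "(+) (y + d') ` A i = (+) (z + y + d) ` A i"
    using P(4) unfolding d(1) d'(1) by (auto simp: translate_tile_def prototile_def image_image add.assoc)
  then have "y + d' = z + y + d" using compact_translation_inj[OF compact_A A_nonempty] by metis
  then have "d' = d + z" by (simp add: algebra_simps)
  then show ?thesis using that d(2) d'(2) \<open>i' = i\<close> by blast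
qed

text \<open>A legal pair has a fixed level n, a fixed descendant colour c and a fixed ancestor
  colour e. By primitivity p levels above connect e to any ancestor j, and p levels below connect c
  to any descendant i. The lower levels multiply the difference by Q^p, and K = n + 2 p.\<close>

lemma Xi_legal_uniform_digits:
  assumes "z \<in> Xi_legal Q D A \<Lambda>"
  obtains p K where "\<And>i j. \<exists>b. b \<in> \<D> K i j \<and> b + (Q ^^ p) z \<in> \<D> K i j"
proof -
  obtain n c e d where d: "d \<in> \<D> n c e" "d + z \<in> \<D> n c e" using Xi_legal_digits[OF assms] .
  obtain p where p: "\<And>i j. \<D> p i j \<noteq> {}" using primitive_digits by metis
  have "\<exists>b. b \<in> \<D> (p + (n + p)) i j \<and> b + (Q ^^ p) z \<in> \<D> (p + (n + p)) i j" for i j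
  proof -
    obtain f g where f: "f \<in> \<D> p e j" and g: "g \<in> \<D> p i c" using p by blast
    have "(Q ^^ n) f + d \<in> \<D> (n + p) c j" "(Q ^^ n) f + (d + z) \<in> \<D> (n + p) c j"
      unfolding digits_add[OF linear_Q] using d f by blast+
    then have "(Q ^^ p) ((Q ^^ n) f + d) + g \<in> \<D> (p + (n + p)) i j"
      "(Q ^^ p) ((Q ^^ n) f + (d + z)) + g \<in> \<D> (p + (n + p)) i j"
      unfolding digits_add[OF linear_Q, of D p "n + p"] using g by blast+
    moreover have "(Q ^^ p) ((Q ^^ n) f + (d + z)) + g = (Q ^^ p) ((Q ^^ n) f + d) + g + (Q ^^ p) z"
      by (simp add: Qn_add)
    ultimately show ?thesis by metis
  qed
  then show ?thesis using that by blast
qed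

end

text \<open>The premise of positive measure excludes null cylinders, for which the strict inequality
  would read 0 > 0; it is also the source of measurability in the proof.\<close>

theorem lemma5p1:
  fixes \<Lambda> :: "('d::finite, 'k::finite) kset"
    and Q :: "real ^ 'd \<Rightarrow> real ^ 'd"
    and D :: "'k \<Rightarrow> 'k \<Rightarrow> (real ^ 'd) set"
    and A :: "'k \<Rightarrow> (real ^ 'd) set"
    and \<mu> :: "('d, 'k) kset measure"
    and \<eta> :: real and m0 :: nat and z :: "real ^ 'd"
  assumes "substitution_delone Q D \<Lambda>"
    and "primitive (substitution_matrix D)"
    and "prototile_supports Q D A"
    and "representable A \<Lambda>"
    and "invariant_probability \<Lambda> \<mu>"
    and "\<eta> > 0"
    and "\<And>c x y. \<lbrakk>x \<in> supp \<Lambda>; y \<in> supp \<Lambda>; infnorm (x - c) < \<eta> / 2; infnorm (y - c) < \<eta> / 2\<rbrakk> \<Longrightarrow> x = y"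
    and "1 / 2 ^ m0 < \<eta> / 2"
    and "z \<in> Xi_legal Q D A \<Lambda>"
  shows "\<exists>\<delta>>0. \<forall>m\<ge>m0. \<forall>S\<in>cube_selections m.
           measure \<mu> (grid_cylinder \<Lambda> m S) > 0 \<longrightarrow>
           (\<exists>n0. \<forall>n\<ge>n0.
              measure \<mu> (grid_cylinder \<Lambda> m S \<inter> shift (- ((Q ^^ n) z)) ` grid_cylinder \<Lambda> m S)
                > \<delta> * measure \<mu> (grid_cylinder \<Lambda> m S))"
proof -
  interpret substitution_tiling \<Lambda> Q D A by unfold_locales (fact assms)+
  have \<Lambda>: "delone_kset \<Lambda>" using assms(1) unfolding substitution_delone_def by (rule conjunct1)
  have space_\<mu>: "space \<mu> = hull_of \<Lambda>" by (rule space_invariant_probability[OF assms(5)])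
  obtain p K where pK: "\<And>i j. \<exists>b. b \<in> \<D> K i j \<and> b + (Q ^^ p) z \<in> \<D> K i j"
    using Xi_legal_uniform_digits[OF assms(9)] by metis
  obtain r where r: "r > 0" "\<And>i. A i \<subseteq> ball 0 r" using tile_radius by metis
  define min_vol where "min_vol = Min (range inner_vol)"
  have "min_vol \<in> range inner_vol" unfolding min_vol_def by (rule Min_in) auto
  then have min_vol: "min_vol > 0" "\<And>j. min_vol \<le> inner_vol j"
    using inner_vol_pos by (auto simp: min_vol_def)
  have max_vol: "max_vol > 0" using inner_vol_pos inner_vol_le by (metis less_le_trans)
  \<comment> \<open>Deep occurrences in one type of level-n supertile will fill more than half of
    \<tau> times \<open>theta ^ n * min_vol\<close>, while a supertile of level n + K has volume at
    most \<open>theta ^ (n + K) * max_vol\<close>. The quotient of these bounds is \<delta> times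
    \<tau>.\<close>
  define \<delta> where "\<delta> = min_vol / (2 * theta ^ K * max_vol)"
  show ?thesis
  proof (intro exI[of _ \<delta>] conjI allI impI ballI)
    show "\<delta> > 0" unfolding \<delta>_def using min_vol max_vol theta(1) by simp
    fix m and S :: "((real ^ 'd) set \<times> 'k) set"
    assume m: "m0 \<le> m" and S: "S \<in> cube_selections m"
    let ?E = "grid_cylinder \<Lambda> m S"
    assume pos: "measure \<mu> ?E > 0"
    have "(1::real) / 2 ^ m \<le> 1 / 2 ^ m0" using m by (simp add: frac_le power_increasing)
    then have \<eta>: "1 / 2 ^ m < \<eta> / 2" using assms(8) by linarith
    have E_iff: "\<Gamma> \<in> ?E \<longleftrightarrow> \<Gamma> \<in> space \<mu> \<and> has_pattern m S \<Gamma>" for \<Gamma>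
    proof (cases "\<Gamma> \<in> hull_of \<Lambda>")
      case True
      have "\<Gamma> \<in> ?E \<longleftrightarrow> has_pattern m S \<Gamma>"
      proof (rule mem_grid_cylinder_iff[OF \<Lambda> True _ \<eta>])
        show "x = y" if "x \<in> supp \<Lambda>" "y \<in> supp \<Lambda>" "infnorm (x - c) < \<eta> / 2" "infnorm (y - c) < \<eta> / 2" for c x y
          using that by (rule assms(7))
        show "S \<subseteq> coloured_cubes m" using S by (simp add: cube_selections_def)
      qed
      then show ?thesis using True space_\<mu> by simp
    qed (simp add: space_\<mu> grid_cylinder_def)
    \<comment> \<open>\<open>measure\<close> is 0 off the measurable sets, so a positive value
      certifies measurability.\<close>
    have E_sets: "?E \<in> sets \<mu>" using pos measure_notin_sets by fastforce
    then have E_pos: "emeasure \<mu> ?E > 0" using pos by (simp add: measure_def enn2real_positive_iff)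
    have shift_space: "shift g \<Gamma> \<in> space \<mu>" if "\<Gamma> \<in> space \<mu>" for g \<Gamma>
      using that unfolding space_\<mu> by (rule shift_mem_hull[OF \<Lambda>])
    have pattern_sets: "{\<Gamma> \<in> space \<mu>. has_pattern m S (shift g \<Gamma>)} \<in> sets \<mu>" for g
    proof -
      have "{\<Gamma> \<in> space \<mu>. has_pattern m S (shift g \<Gamma>)} = shift g -` ?E \<inter> space \<mu>"
        using E_iff shift_space by blast
      then show ?thesis using invariant_probability_vimage(2)[OF assms(5) E_sets E_pos] by simp
    qed
    let ?F = "\<lambda>w. {\<Gamma> \<in> space \<mu>. has_pattern m S \<Gamma> \<and> has_pattern m S (shift w \<Gamma>)}"
    have shift_0: "shift 0 \<Gamma> = \<Gamma>" for \<Gamma> :: "('d, 'k) kset" by (simp add: shift_def)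
    have F_0: "?F 0 = ?E" using E_iff by (auto simp: shift_0)
    have F_w: "?F w = ?E \<inter> shift (- w) ` ?E" for w
    proof -
      have "\<Gamma> \<in> shift (- w) ` ?E \<longleftrightarrow> shift w \<Gamma> \<in> ?E" for \<Gamma>
      proof
        assume "\<Gamma> \<in> shift (- w) ` ?E"
        then obtain \<Gamma>' where "\<Gamma>' \<in> ?E" "\<Gamma> = shift (- w) \<Gamma>'" by blast
        then show "shift w \<Gamma> \<in> ?E" by (simp add: shift_shift shift_0)
      next
        assume "shift w \<Gamma> \<in> ?E"
        moreover have "\<Gamma> = shift (- w) (shift w \<Gamma>)" by (simp add: shift_shift shift_0)
        ultimately show "\<Gamma> \<in> shift (- w) ` ?E" by (intro image_eqI[where x = "shift w \<Gamma>"])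
      qed
      then show ?thesis using E_iff shift_space by blast
    qed
    obtain \<rho> where \<rho>: "\<rho> > 0" "\<And>C. C \<in> (coloured_cubes m :: ((real ^ 'd) set \<times> 'k) set) \<Longrightarrow> fst C \<subseteq> ball 0 \<rho>"
      using coloured_cubes_radius[of m] by metis
    define \<tau> where "\<tau> = measure \<mu> ?E"
    have \<tau>: "\<tau> > 0" using pos by (simp add: \<tau>_def)
    \<comment> \<open>The share 1/8 is below 3/4 - 1/2, the gap between the fraction found by
      averaging and the fraction used for \<delta>.\<close>
    have "\<forall>\<^sub>F n in sequentially. \<forall>j. measure lebesgue (inner_layer n j (\<rho> + r)) \<le> \<tau> * min_vol / 8 * theta ^ n"
      using \<tau> min_vol r \<rho> by (intro supertile_boundary_layer) auto
    then obtain N where N: "\<And>n j. n \<ge> N \<Longrightarrow>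
        measure lebesgue (inner_layer n j (\<rho> + r)) \<le> \<tau> * min_vol / 8 * theta ^ n"
      by (auto simp: eventually_sequentially)
    have main: "measure \<mu> (?F ((Q ^^ n) ((Q ^^ p) z))) > \<delta> * \<tau>" if n: "n \<ge> N" for n
    proof -
      \<comment> \<open>If every type of supertile stayed within 3/4 of the expected volume,
        averaging over large windows would give \<tau> <= 3/4 \<tau>.\<close>
      have "\<exists>j. measure lebesgue (occurrences m S (\<rho> + r) n j) + measure lebesgue (inner_layer n j (\<rho> + r))
          > 3 / 4 * \<tau> * theta ^ n * inner_vol j"
      proof (rule ccontr)
        assume "\<not> ?thesis"
        then have "measure lebesgue (occurrences m S (\<rho> + r) n j) + measure lebesgue (inner_layer n j (\<rho> + r))
          \<le> 3 / 4 * \<tau> * theta ^ n * inner_vol j" for j by (meson not_le)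
        from pattern_upper_bound[OF r \<rho> this]
        obtain c where c: "c > 0" "\<And>a L. measure lebesgue ({g. has_pattern m S (shift g \<Lambda>)} \<inter> ball a L)
            \<le> 3 / 4 * \<tau> * measure lebesgue (ball a (L + c))" by blast
        have "\<tau> \<le> 3 / 4 * \<tau>"
        proof (rule ball_volume_density_le[OF _ c(1)])
          fix L :: real
          have "measure lebesgue (pattern_pair_times m S 0 \<Lambda> \<inter> ball a L) \<le> 3 / 4 * \<tau> * measure lebesgue (ball (0 :: real ^ 'd) (L + c))"
            for a
            using c(2)[of a L] unfolding measure_ball_center[of a] by (simp add: pattern_pair_times_def)
          from hull_average_bounds(1)[OF \<Lambda> assms(5) pattern_sets this]
          show "\<tau> * measure lebesgue (ball (0 :: real ^ 'd) L) \<le> 3 / 4 * \<tau> * measure lebesgue (ball (0 :: real ^ 'd) (L + c))"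
            unfolding F_0 \<tau>_def by (simp add: mult.commute)
        qed
        with \<tau> show False by simp
      qed
      then obtain j where j: "measure lebesgue (occurrences m S (\<rho> + r) n j) + measure lebesgue (inner_layer n j (\<rho> + r))
          > 3 / 4 * \<tau> * theta ^ n * inner_vol j" ..
      let ?e = "measure lebesgue (occurrences m S (\<rho> + r) n j)"
      have \<theta>n: "theta ^ n > 0" using theta(1) by simp
      have "3 / 4 * (\<tau> * theta ^ n * min_vol) \<le> 3 / 4 * (\<tau> * theta ^ n * inner_vol j)"
        using \<tau> \<theta>n min_vol(2)[of j] by simp
      then have e: "?e > 1 / 2 * (\<tau> * theta ^ n * min_vol)"
        using j N[OF n, of j] mult_pos_pos[OF mult_pos_pos[OF \<tau> \<theta>n] min_vol(1)] by (simp add: mult_ac)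
      let ?w = "(Q ^^ n) ((Q ^^ p) z)" and ?c = "theta ^ (n + K) * max_vol"
      from pattern_pair_lower_bound[OF r \<rho> pK]
      obtain c where c: "c > 0" "\<And>a L. ?e * measure lebesgue (ball a (L - c)) \<le> ?c *
          measure lebesgue (pattern_pair_times m S ?w \<Lambda> \<inter> ball a L)"
        unfolding pattern_pair_times_def by blast
      have cpos: "?c > 0" using theta(1) max_vol by simp
      have "?e \<le> ?c * measure \<mu> (?F ?w)"
      proof (rule ball_volume_density_le[OF _ c(1)])
        fix L :: real
        \<comment> \<open>The window of radius L + c is taken so that the loss of c leaves
          L.\<close>
        have "?e * measure lebesgue (ball (0 :: real ^ 'd) L) / ?c
            \<le> measure lebesgue (pattern_pair_times m S ?w \<Lambda> \<inter> ball a (L + c))" for a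
          using c(2)[of a "L + c"] cpos unfolding measure_ball_center[of a] by (simp add: pos_divide_le_eq mult.commute)
        from hull_average_bounds(2)[OF \<Lambda> assms(5) pattern_sets this]
        show "?e * measure lebesgue (ball (0 :: real ^ 'd) L)
            \<le> ?c * measure \<mu> (?F ?w) * measure lebesgue (ball (0 :: real ^ 'd) (L + c))"
          using cpos by (simp add: pos_divide_le_eq mult_ac)
      qed
      with e have "1 / 2 * (\<tau> * theta ^ n * min_vol) < ?c * measure \<mu> (?F ?w)" by linarith
      moreover have "1 / 2 * (\<tau> * theta ^ n * min_vol) = ?c * (\<delta> * \<tau>)"
        unfolding \<delta>_def using theta(1) max_vol by (simp add: power_add field_simps)
      ultimately show ?thesis using cpos by (simp only: mult_less_cancel_left_pos)
    qed
    show "\<exists>n0. \<forall>n\<ge>n0. measure \<mu> (?E \<inter> shift (- ((Q ^^ n) z)) ` ?E) > \<delta> * measure \<mu> ?E"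
    \<comment> \<open>The digit pair returns \<open>(Q ^^ p) z\<close>, so level n - p is used,
      which must still be at least N.\<close>
    proof (intro exI[of _ "N + p"] allI impI)
      fix n assume n: "n \<ge> N + p"
      then have "(Q ^^ (n - p)) ((Q ^^ p) z) = (Q ^^ n) z"
        using funpow_add[of "n - p" p Q] by simp
      then show "measure \<mu> (?E \<inter> shift (- ((Q ^^ n) z)) ` ?E) > \<delta> * measure \<mu> ?E"
        using main[of "n - p"] n unfolding F_w \<tau>_def by simp
    qed
  qed
qed

end
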